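(* Let $M$ be a space-time with a $C^{1,1}$-Lorentzian metric $g$, let $p\in M$, and let $U$ be a normal neighbourhood of $p$, with bi-Lipschitz homeomorphism $\exp_p:\tilde U\to U$, such that $$I^+(p,U)=\exp_p(I^+(0)\cap\tilde U),\quad J^+(p,U)=\exp_p(J^+(0)\cap\tilde U),\quad \partial I^+(p,U)=\partial J^+(p,U)=\exp_p(\partial I^+(0)\cap\tilde U).$$ Suppose that $\alpha:[0,1]\to U$ is a future-directed causal curve with $\alpha(0)=p$ and $\alpha(1)\in\partial J^+(p,U)$. Then $\alpha$ lies entirely in $\partial J^+(p,U)$ and there exists a reparametrisation of $\alpha$ as a null-geodesic segment.
   Context: $M$ is a smooth manifold; $C^{1,1}$ means continuously differentiable with locally Lipschitz first order derivatives. A space-time is a Lorentzian manifold (signature $(-+\cdots+)$) with a time-orientation determined by a continuous timelike vector field $X$. A nonzero tangent vector $v$ is timelike if $g(v,v)<0$, null if $g(v,v)=0$, causal if $g(v,v)\le0$; a causal vector is future-directed if $g(X,v)<0$. A locally Lipschitz curve $c$ (which is differentiable almost everywhere) is called timelike (causal, null) if $c'(t)$ has the corresponding property whenever it exists; a causal curve is future-directed if $g(X(c(t)),c'(t))<0$ wherever $c'(t)$ exists. Causal and timelike curves are always understood to be locally Lipschitz. For $p\in A\subseteq M$: $I^+(p,A)$ is the set of $q\in A$ such that there is a future-directed timelike curve in $A$ from $p$ to $q$; $J^+(p,A)$ is the set of $q\in A$ such that there is a future-directed causal curve in $A$ from $p$ to $q$, together with $p$ itself. Boundaries $\partial I^+(p,U)$,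 $\partial J^+(p,U)$ are taken relative to $U$. In $T_pM$, $I^+(0)$ is the set of future-directed $v$ with $g_p(v,v)<0$, and $J^+(0)$ consists of $0$ and all future-directed $v$ with $g_p(v,v)\le0$. $\exp_p$ is the exponential map of $g$ at $p$; a neighbourhood $U$ of $p$ is normal if $\exp_p:\tilde U\to U$ is a bi-Lipschitz homeomorphism for some open $\tilde U\ni0$ in $T_pM$ star-shaped around $0$. (Every $p\in M$ has a basis of normal neighbourhoods satisfying the displayed equalities.) *)

theory Defs
  imports "HOL-Analysis.Analysis"
begin

section \<open>Regularity of maps between Euclidean spaces\<close>

definition locally_lipschitz_on :: "'a::metric_space set \<Rightarrow> ('a \<Rightarrow> 'b::metric_space) \<Rightarrow> bool" where
  "locally_lipschitz_on S f \<longleftrightarrow> (\<forall>x\<in>S. \<exists>r>0. \<exists>L. L-lipschitz_on (S \<inter> ball x r) f)"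

text \<open>\<open>C_k k S f\<close> is meant for open \<open>S\<close>: all iterated partial derivatives of \<open>f\<close> up to order \<open>k\<close>
  exist and are continuous.\<close>

primrec C_k :: "nat \<Rightarrow> 'e::euclidean_space set \<Rightarrow> ('e \<Rightarrow> 'f::real_normed_vector) \<Rightarrow> bool" where
  "C_k 0 S f \<longleftrightarrow> continuous_on S f"
| "C_k (Suc k) S f \<longleftrightarrow> f differentiable_on S \<and> (\<forall>v. C_k k S (\<lambda>x. frechet_derivative f (at x) v))"

definition smooth_on :: "'e::euclidean_space set \<Rightarrow> ('e \<Rightarrow> 'f::real_normed_vector) \<Rightarrow> bool" where
  "smooth_on S f \<longleftrightarrow> (\<forall>k. C_k k S f)"

definition C11_on :: "'e::euclidean_space set \<Rightarrow> ('e \<Rightarrow> 'f::real_normed_vector) \<Rightarrow> bool" where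
  "C11_on S f \<longleftrightarrow> C_k 1 S f \<and> (\<forall>v. locally_lipschitz_on S (\<lambda>x. frechet_derivative f (at x) v))"


section \<open>Smooth manifolds and tangent vectors\<close>

text \<open>The underlying set of the manifold is a whole type \<open>'a\<close>, which carries the manifold topology
  (Hausdorff and second countable by its sort). The model space is \<open>'e\<close>, so the dimension is
  \<open>DIM('e)\<close>. A chart is a pair of its domain and its coordinate map; the values of the coordinate map
  outside the domain are irrelevant.\<close>

type_synonym ('a, 'e) chart = "'a set \<times> ('a \<Rightarrow> 'e)"

definition chart_inv :: "('a, 'e) chart \<Rightarrow> 'e \<Rightarrow> 'a" where
  "chart_inv c = inv_into (fst c) (snd c)"

definition smooth_manifold ::
  "('a::{t2_space,second_countable_topology}, 'e::euclidean_space) chart set \<Rightarrow> bool" where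
  "smooth_manifold A \<longleftrightarrow>
     (\<Union>c\<in>A. fst c) = UNIV \<and>
     (\<forall>c\<in>A. open (fst c) \<and> open (snd c ` fst c) \<and>
            homeomorphism (fst c) (snd c ` fst c) (snd c) (chart_inv c)) \<and>
     (\<forall>c\<in>A. \<forall>d\<in>A. smooth_on (snd c ` (fst c \<inter> fst d)) (snd d \<circ> chart_inv c))"

text \<open>A tangent vector at \<open>p\<close> is the family of its coordinate representations in the charts of the
  atlas around \<open>p\<close>, any two of which are related by the derivative of the chart transition. Entries for
  all other arguments are set to 0, so that vector space operations, the zero vector
  \<open>\<lambda>_. 0\<close> and the topology of the tangent space are those inherited from the function space
  \<open>('a, 'e) chart \<Rightarrow> 'e\<close> (whose topology is that of pointwise convergence; evaluation at any chart
  around \<open>p\<close> identifies the tangent space with \<open>'e\<close>, linearly and topologically).\<close>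

type_synonym ('a, 'e) tangent = "('a, 'e) chart \<Rightarrow> 'e"

definition tangent_space ::
  "('a, 'e::euclidean_space) chart set \<Rightarrow> 'a \<Rightarrow> ('a, 'e) tangent set" where
  "tangent_space A p =
     {v. (\<forall>c\<in>A. \<forall>d\<in>A. p \<in> fst c \<and> p \<in> fst d \<longrightarrow>
            v d = frechet_derivative (snd d \<circ> chart_inv c) (at (snd c p)) (v c)) \<and>
         (\<forall>c. \<not> (c \<in> A \<and> p \<in> fst c) \<longrightarrow> v c = 0)}"

text \<open>The tangent vector at \<open>p\<close> whose representation in the chart \<open>c\<close> is \<open>u\<close>, i.e. the vector
  \<open>\<Sum>i. u\<^sup>i \<partial>\<^sub>i\<close> at \<open>p\<close>.\<close>

definition coord_vector ::
  "('a, 'e::euclidean_space) chart set \<Rightarrow> ('a, 'e) chart \<Rightarrow> 'a \<Rightarrow> 'e \<Rightarrow> ('a, 'e) tangent" where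
  "coord_vector A c p u =
     (\<lambda>d. if d \<in> A \<and> p \<in> fst d
          then frechet_derivative (snd d \<circ> chart_inv c) (at (snd c p)) u else 0)"


section \<open>Space-times\<close>

type_synonym ('a, 'e) metric = "'a \<Rightarrow> ('a, 'e) tangent \<Rightarrow> ('a, 'e) tangent \<Rightarrow> real"

text \<open>\<open>metric_coords A g c x\<close> is the coordinate expression of the metric at the point with
  coordinates \<open>x\<close>; its values on basis vectors are the components \<open>g\<^sub>i\<^sub>j(x)\<close>.\<close>

definition metric_coords ::
  "('a, 'e::euclidean_space) chart set \<Rightarrow> ('a, 'e) metric \<Rightarrow> ('a, 'e) chart \<Rightarrow> 'e \<Rightarrow> 'e \<Rightarrow> 'e \<Rightarrow> real" where
  "metric_coords A g c x u w =
     g (chart_inv c x) (coord_vector A c (chart_inv c x) u) (coord_vector A c (chart_inv c x) w)"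

text \<open>The signature \<open>(-+\<dots>+)\<close> is expressed by an orthonormal family of \<open>DIM('e)\<close> vectors, indexed by
  the standard basis of \<open>'e\<close>, exactly one of which has square \<open>-1\<close>. Such a family is automatically a
  basis of the tangent space.\<close>

definition lorentzian_form :: 
  "('a, 'e::euclidean_space) tangent set \<Rightarrow> (('a, 'e) tangent \<Rightarrow> ('a, 'e) tangent \<Rightarrow> real) \<Rightarrow> bool" where
  "lorentzian_form T h \<longleftrightarrow>
     (\<forall>v\<in>T. \<forall>w\<in>T. h v w = h w v) \<and>
     (\<forall>v\<in>T. \<forall>w\<in>T. \<forall>z\<in>T. \<forall>r s. h (\<lambda>c. r *\<^sub>R v c + s *\<^sub>R w c) z = r * h v z + s * h w z) \<and>
     (\<exists>b :: 'e \<Rightarrow> ('a, 'e) tangent. \<exists>i0\<in>Basis. (\<forall>i\<in>Basis. b i \<in> T) \<and>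
        (\<forall>i\<in>Basis. \<forall>j\<in>Basis. h (b i) (b j) = (if i \<noteq> j then 0 else if i = i0 then - 1 else 1)))"

definition C11_lorentzian_metric ::
  "('a, 'e::euclidean_space) chart set \<Rightarrow> ('a, 'e) metric \<Rightarrow> bool" where
  "C11_lorentzian_metric A g \<longleftrightarrow>
     (\<forall>p. lorentzian_form (tangent_space A p) (g p)) \<and>
     (\<forall>c\<in>A. \<forall>u w. C11_on (snd c ` fst c) (\<lambda>x. metric_coords A g c x u w))"

definition timelike :: "('a, 'e::euclidean_space) metric \<Rightarrow> 'a \<Rightarrow> ('a, 'e) tangent \<Rightarrow> bool" where
  "timelike g p v \<longleftrightarrow> v \<noteq> (\<lambda>_. 0) \<and> g p v v < 0"

definition null :: "('a, 'e::euclidean_space) metric \<Rightarrow> 'a \<Rightarrow> ('a, 'e) tangent \<Rightarrow> bool" where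
  "null g p v \<longleftrightarrow> v \<noteq> (\<lambda>_. 0) \<and> g p v v = 0"

definition causal :: "('a, 'e::euclidean_space) metric \<Rightarrow> 'a \<Rightarrow> ('a, 'e) tangent \<Rightarrow> bool" where
  "causal g p v \<longleftrightarrow> v \<noteq> (\<lambda>_. 0) \<and> g p v v \<le> 0"

definition continuous_vector_field ::
  "('a::topological_space, 'e::euclidean_space) chart set \<Rightarrow> ('a \<Rightarrow> ('a, 'e) tangent) \<Rightarrow> bool" where
  "continuous_vector_field A X \<longleftrightarrow>
     (\<forall>p. X p \<in> tangent_space A p) \<and> (\<forall>c\<in>A. continuous_on (fst c) (\<lambda>p. X p c))"

definition C11_spacetime ::
  "('a::{t2_space,second_countable_topology}, 'e::euclidean_space) chart set \<Rightarrow> ('a, 'e) metric \<Rightarrow>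
   ('a \<Rightarrow> ('a, 'e) tangent) \<Rightarrow> bool" where
  "C11_spacetime A g X \<longleftrightarrow>
     smooth_manifold A \<and> C11_lorentzian_metric A g \<and>
     continuous_vector_field A X \<and> (\<forall>p. timelike g p (X p))"


section \<open>Curves and causality relations\<close>

text \<open>Below, \<open>I\<close> is always a nondegenerate compact interval. Derivatives of curves are taken
  within \<open>I\<close>, hence are one-sided at the endpoints.\<close>

definition locally_lipschitz_curve ::
  "('a::topological_space, 'e::euclidean_space) chart set \<Rightarrow> real set \<Rightarrow> (real \<Rightarrow> 'a) \<Rightarrow> bool" where
  "locally_lipschitz_curve A I \<gamma> \<longleftrightarrow>
     continuous_on I \<gamma> \<and>
     (\<forall>c\<in>A. locally_lipschitz_on {t\<in>I. \<gamma> t \<in> fst c} (snd c \<circ> \<gamma>))"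

definition curve_differentiable ::
  "('a, 'e::euclidean_space) chart set \<Rightarrow> real set \<Rightarrow> (real \<Rightarrow> 'a) \<Rightarrow> real \<Rightarrow> bool" where
  "curve_differentiable A I \<gamma> t \<longleftrightarrow>
     (\<exists>c\<in>A. \<gamma> t \<in> fst c \<and> (snd c \<circ> \<gamma>) differentiable (at t within I))"

definition velocity ::
  "('a, 'e::euclidean_space) chart set \<Rightarrow> real set \<Rightarrow> (real \<Rightarrow> 'a) \<Rightarrow> real \<Rightarrow> ('a, 'e) tangent" where
  "velocity A I \<gamma> t =
     (\<lambda>c. if c \<in> A \<and> \<gamma> t \<in> fst c then vector_derivative (snd c \<circ> \<gamma>) (at t within I) else 0)"

definition future_timelike_curve ::
  "('a::topological_space, 'e::euclidean_space) chart set \<Rightarrow> ('a, 'e) metric \<Rightarrow>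
   ('a \<Rightarrow> ('a, 'e) tangent) \<Rightarrow> real set \<Rightarrow> (real \<Rightarrow> 'a) \<Rightarrow> bool" where
  "future_timelike_curve A g X I \<gamma> \<longleftrightarrow>
     locally_lipschitz_curve A I \<gamma> \<and>
     (\<forall>t\<in>I. curve_differentiable A I \<gamma> t \<longrightarrow>
        timelike g (\<gamma> t) (velocity A I \<gamma> t) \<and> g (\<gamma> t) (X (\<gamma> t)) (velocity A I \<gamma> t) < 0)"

definition future_causal_curve ::
  "('a::topological_space, 'e::euclidean_space) chart set \<Rightarrow> ('a, 'e) metric \<Rightarrow>
   ('a \<Rightarrow> ('a, 'e) tangent) \<Rightarrow> real set \<Rightarrow> (real \<Rightarrow> 'a) \<Rightarrow> bool" where
  "future_causal_curve A g X I \<gamma> \<longleftrightarrow>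
     locally_lipschitz_curve A I \<gamma> \<and>
     (\<forall>t\<in>I. curve_differentiable A I \<gamma> t \<longrightarrow>
        causal g (\<gamma> t) (velocity A I \<gamma> t) \<and> g (\<gamma> t) (X (\<gamma> t)) (velocity A I \<gamma> t) < 0)"

definition chronological_future ::
  "('a::topological_space, 'e::euclidean_space) chart set \<Rightarrow> ('a, 'e) metric \<Rightarrow>
   ('a \<Rightarrow> ('a, 'e) tangent) \<Rightarrow> 'a \<Rightarrow> 'a set \<Rightarrow> 'a set" where
  "chronological_future A g X p S =
     {q\<in>S. \<exists>a b \<gamma>. a < b \<and> future_timelike_curve A g X {a..b} \<gamma> \<and> \<gamma> ` {a..b} \<subseteq> S \<and>
                  \<gamma> a = p \<and> \<gamma> b = q}"

definition causal_future ::
  "('a::topological_space, 'e::euclidean_space) chart set \<Rightarrow> ('a, 'e) metric \<Rightarrow>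
   ('a \<Rightarrow> ('a, 'e) tangent) \<Rightarrow> 'a \<Rightarrow> 'a set \<Rightarrow> 'a set" where
  "causal_future A g X p S =
     {q\<in>S. \<exists>a b \<gamma>. a < b \<and> future_causal_curve A g X {a..b} \<gamma> \<and> \<gamma> ` {a..b} \<subseteq> S \<and>
                  \<gamma> a = p \<and> \<gamma> b = q} \<union> {p}"

definition timelike_cone ::
  "('a, 'e::euclidean_space) chart set \<Rightarrow> ('a, 'e) metric \<Rightarrow> ('a \<Rightarrow> ('a, 'e) tangent) \<Rightarrow>
   'a \<Rightarrow> ('a, 'e) tangent set" where
  "timelike_cone A g X p = {v \<in> tangent_space A p. timelike g p v \<and> g p (X p) v < 0}"

definition causal_cone ::
  "('a, 'e::euclidean_space) chart set \<Rightarrow> ('a, 'e) metric \<Rightarrow> ('a \<Rightarrow> ('a, 'e) tangent) \<Rightarrow>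
   'a \<Rightarrow> ('a, 'e) tangent set" where
  "causal_cone A g X p =
     {\<lambda>_. 0} \<union> {v \<in> tangent_space A p. causal g p v \<and> g p (X p) v < 0}"


section \<open>Geodesics, exponential map and normal neighbourhoods\<close>

text \<open>\<open>christoffel A g c x u v\<close> is the vector with components
  \<open>\<Gamma>\<^sup>k\<^sub>i\<^sub>j(x) u\<^sup>i v\<^sup>j\<close>; multiplying
  \<open>\<Gamma>\<^sup>k\<^sub>i\<^sub>j = 1/2 g\<^sup>k\<^sup>m (\<partial>\<^sub>i g\<^sub>j\<^sub>m + \<partial>\<^sub>j g\<^sub>i\<^sub>m - \<partial>\<^sub>m g\<^sub>i\<^sub>j)\<close> by the
  (nondegenerate) matrix of the metric avoids its inverse.\<close>

definition christoffel ::
  "('a, 'e::euclidean_space) chart set \<Rightarrow> ('a, 'e) metric \<Rightarrow> ('a, 'e) chart \<Rightarrow> 'e \<Rightarrow> 'e \<Rightarrow> 'e \<Rightarrow> 'e" where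
  "christoffel A g c x u v =
     (THE w. \<forall>z. metric_coords A g c x w z =
        (frechet_derivative (\<lambda>y. metric_coords A g c y v z) (at x) u
       + frechet_derivative (\<lambda>y. metric_coords A g c y u z) (at x) v
       - frechet_derivative (\<lambda>y. metric_coords A g c y u v) (at x) z) / 2)"

definition geodesic ::
  "('a::topological_space, 'e::euclidean_space) chart set \<Rightarrow> ('a, 'e) metric \<Rightarrow> real set \<Rightarrow>
   (real \<Rightarrow> 'a) \<Rightarrow> bool" where
  "geodesic A g I \<gamma> \<longleftrightarrow>
     continuous_on I \<gamma> \<and>
     (\<forall>t\<in>I. \<forall>c\<in>A. \<gamma> t \<in> fst c \<longrightarrow>
        ((snd c \<circ> \<gamma>) has_vector_derivative velocity A I \<gamma> t c) (at t within I) \<and>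
        ((\<lambda>s. velocity A I \<gamma> s c) has_vector_derivative
           - christoffel A g c (snd c (\<gamma> t)) (velocity A I \<gamma> t c) (velocity A I \<gamma> t c)) (at t within I))"

definition null_geodesic ::
  "('a::topological_space, 'e::euclidean_space) chart set \<Rightarrow> ('a, 'e) metric \<Rightarrow> real set \<Rightarrow>
   (real \<Rightarrow> 'a) \<Rightarrow> bool" where
  "null_geodesic A g I \<gamma> \<longleftrightarrow> geodesic A g I \<gamma> \<and> (\<forall>t\<in>I. null g (\<gamma> t) (velocity A I \<gamma> t))"

definition exp_domain ::
  "('a::topological_space, 'e::euclidean_space) chart set \<Rightarrow> ('a, 'e) metric \<Rightarrow> 'a \<Rightarrow>
   ('a, 'e) tangent set" where
  "exp_domain A g p =
     {v \<in> tangent_space A p. \<exists>\<gamma>. geodesic A g {0..1} \<gamma> \<and> \<gamma> 0 = p \<and> velocity A {0..1} \<gamma> 0 = v}"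

definition exp_map ::
  "('a::topological_space, 'e::euclidean_space) chart set \<Rightarrow> ('a, 'e) metric \<Rightarrow> 'a \<Rightarrow>
   ('a, 'e) tangent \<Rightarrow> 'a" where
  "exp_map A g p v =
     (THE q. \<exists>\<gamma>. geodesic A g {0..1} \<gamma> \<and> \<gamma> 0 = p \<and> velocity A {0..1} \<gamma> 0 = v \<and> \<gamma> 1 = q)"

text \<open>As neither the manifold nor its tangent spaces carry a distinguished distance, the
  bi-Lipschitz condition is the usual chart-independent one: the map and its inverse are locally
  Lipschitz when expressed in charts.\<close>

definition bi_lipschitz_homeomorphism ::
  "('a::topological_space, 'e::euclidean_space) chart set \<Rightarrow> 'a \<Rightarrow> ('a, 'e) tangent set \<Rightarrow> 'a set \<Rightarrow>
   (('a, 'e) tangent \<Rightarrow> 'a) \<Rightarrow> bool" where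
  "bi_lipschitz_homeomorphism A p V U f \<longleftrightarrow>
     homeomorphism V U f (inv_into V f) \<and>
     (\<forall>c\<in>A. \<forall>d\<in>A. p \<in> fst c \<longrightarrow>
        locally_lipschitz_on {u. coord_vector A c p u \<in> V \<and> f (coord_vector A c p u) \<in> fst d}
          (\<lambda>u. snd d (f (coord_vector A c p u))) \<and>
        locally_lipschitz_on (snd d ` (U \<inter> fst d)) (\<lambda>x. inv_into V f (chart_inv d x) c))"

definition normal_neighbourhood ::
  "('a::topological_space, 'e::euclidean_space) chart set \<Rightarrow> ('a, 'e) metric \<Rightarrow> 'a \<Rightarrow>
   ('a, 'e) tangent set \<Rightarrow> 'a set \<Rightarrow> bool" where
  "normal_neighbourhood A g p V U \<longleftrightarrow>
     open U \<and> p \<in> U \<and>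
     openin (top_of_set (tangent_space A p)) V \<and> (\<lambda>_. 0) \<in> V \<and>
     (\<forall>v\<in>V. \<forall>r\<in>{0..1}. (\<lambda>c. r *\<^sub>R v c) \<in> V) \<and>
     V \<subseteq> exp_domain A g p \<and>
     bi_lipschitz_homeomorphism A p V U (exp_map A g p)"

definition reparametrisation :: "real set \<Rightarrow> real set \<Rightarrow> (real \<Rightarrow> real) \<Rightarrow> bool" where
  "reparametrisation J I \<phi> \<longleftrightarrow> continuous_on J \<phi> \<and> strict_mono_on J \<phi> \<and> \<phi> ` J = I"

end

theory Submission
  imports Defs
begin

text \<open>Let \<open>Q\<close> be the quadratic form of the metric on the tangent space at \<open>p\<close>, and \<open>\<beta> = exp\<inverse> \<circ> \<alpha>\<close>. The
  function \<open>q \<mapsto> Q (exp\<inverse> q)\<close> is differentiable at every point \<open>q\<close> of \<open>U\<close>, its derivative being twice the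
  product with the radial vector \<open>P\<close> at \<open>q\<close>, the final velocity of the geodesic from \<open>p\<close> to \<open>q\<close>: it is the
  energy of that geodesic, which is a critical point of the energy for fixed end points, and neighbouring geodesics
  are close in \<open>C\<^sup>1\<close>. As \<open>P\<close> and \<open>\<alpha>'\<close> are future-directed causal vectors, \<open>Q \<circ> \<beta>\<close> has a nonpositive
  derivative almost everywhere. It vanishes at both ends, hence identically, so \<open>\<alpha>\<close> stays in the boundary and
  \<open>\<alpha>'\<close> is orthogonal to \<open>P\<close>, which forces \<open>\<alpha>' = l P\<close> with \<open>l > 0\<close>. Since the inverse of the exponential
  map is Lipschitz, \<open>\<beta>' = l \<beta>\<close>. Thus \<open>\<beta>\<close> runs along a null ray.\<close>

section \<open>Differentiability almost everywhere of Lipschitz functions\<close>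

text \<open>The derivative of \<beta> cannot be obtained from that of \<alpha> by a chain rule,
  since the inverse of the exponential map is only Lipschitz. Two substitutes are used. For
  \<open>Q \<circ> \<beta>\<close>, the first variation formula has an error quadratic in the
  distance of the two geodesics, because the derivative of the metric is Lipschitz; that distance is
  at most a multiple of the change of the initial vector, because the exponential map is Lipschitz.
  For \<beta> itself, once \<alpha>' = l P is known, \<alpha> is compared with the radial curve that
  passes through the same point with the same velocity: the two agree to first order, and a
  Lipschitz map preserves this. Exceptional null sets are harmless because Lipschitz functions map
  null sets to null sets, so that the sign of an almost everywhere derivative decides monotonicity.
  The factor l may depend on time in an irregular way. Hence no differential equation is solved:
  \<beta> is divided by a linear time function whose derivative along the curve has the same factor
  l, and the quotient is constant.\<close>

lemma image_cball_strict_mono: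
  fixes f :: "real \<Rightarrow> real"
  assumes "strict_mono f" "continuous_on UNIV f" "0 \<le> r"
  shows "f ` cball x r = {f (x - r)..f (x + r)}"
proof -
  have sub: "f ` {x - r..x + r} \<subseteq> {f (x - r)..f (x + r)}"
    using assms(1) by (auto simp: strict_mono_less_eq)
  have "\<exists>z. x - r \<le> z \<and> z \<le> x + r \<and> f z = y" if "f (x - r) \<le> y" "y \<le> f (x + r)" for y
    using that assms by (intro IVT') (auto intro: continuous_on_subset)
  then have "{f (x - r)..f (x + r)} \<subseteq> f ` {x - r..x + r}"
    by fastforce
  with sub show ?thesis by (simp add: cball_eq_atLeastAtMost)
qed

text \<open>Countable additivity on both sides: an injective \<open>f\<close> keeps the intervals
  disjoint, and the image of an interval is the interval between the values at its ends. This
  translates slopes on single intervals into measures of whole families.\<close>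

lemma emeasure_image_disjoint_cballs:
  fixes f :: "real \<Rightarrow> real" and a r :: "'i \<Rightarrow> real"
  assumes f: "strict_mono f" "continuous_on UNIV f" and r: "\<And>i. i \<in> C \<Longrightarrow> 0 < r i"
    and C: "countable C" "pairwise (\<lambda>i j. disjnt (cball (a i) (r i)) (cball (a j) (r j))) C"
  shows "emeasure lborel (\<Union>i\<in>C. cball (a i) (r i)) = (\<integral>\<^sup>+i. ennreal (2 * r i) \<partial>count_space C)"
    and "emeasure lborel (f ` (\<Union>i\<in>C. cball (a i) (r i)))
      = (\<integral>\<^sup>+i. ennreal (f (a i + r i) - f (a i - r i)) \<partial>count_space C)"
proof -
  have disj: "disjoint_family_on (\<lambda>i. cball (a i) (r i)) C"
    using C(2) by (auto simp: disjoint_family_on_def pairwise_def disjnt_def)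
  have inj: "inj f"
    using f(1) by (simp add: strict_mono_imp_inj_on)
  have disjf: "disjoint_family_on (\<lambda>i. f ` cball (a i) (r i)) C"
    using disj inj unfolding disjoint_family_on_def
    by (metis image_Int image_empty)
  have img: "f ` cball (a i) (r i) = {f (a i - r i)..f (a i + r i)}" if "i \<in> C" for i
    using image_cball_strict_mono[OF f] r[OF that] by (simp add: less_imp_le)
  have "emeasure lborel (\<Union>i\<in>C. cball (a i) (r i))
      = (\<integral>\<^sup>+i. emeasure lborel (cball (a i) (r i)) \<partial>count_space C)"
    by (rule emeasure_UN_countable) (use C disj in auto)
  also have "\<dots> = (\<integral>\<^sup>+i. ennreal (2 * r i) \<partial>count_space C)"
    by (rule nn_integral_cong) (use r in \<open>auto simp: cball_eq_atLeastAtMost less_imp_le\<close>)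
  finally show "emeasure lborel (\<Union>i\<in>C. cball (a i) (r i)) = (\<integral>\<^sup>+i. ennreal (2 * r i) \<partial>count_space C)" .
  have "emeasure lborel (f ` (\<Union>i\<in>C. cball (a i) (r i)))
      = emeasure lborel (\<Union>i\<in>C. f ` cball (a i) (r i))"
    by (simp add: image_UN)
  also have "\<dots> = (\<integral>\<^sup>+i. emeasure lborel (f ` cball (a i) (r i)) \<partial>count_space C)"
    by (rule emeasure_UN_countable) (use C disjf in \<open>auto simp: img\<close>)
  also have "\<dots> = (\<integral>\<^sup>+i. ennreal (f (a i + r i) - f (a i - r i)) \<partial>count_space C)"
  proof (rule nn_integral_cong)
    fix i assume i: "i \<in> space (count_space C)"
    then have "f (a i - r i) \<le> f (a i + r i)"
      using r f(1) by (simp add: strict_mono_less_eq less_imp_le)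
    then show "emeasure lborel (f ` cball (a i) (r i)) = ennreal (f (a i + r i) - f (a i - r i))"
      using i by (simp add: img)
  qed
  finally show "emeasure lborel (f ` (\<Union>i\<in>C. cball (a i) (r i)))
      = (\<integral>\<^sup>+i. ennreal (f (a i + r i) - f (a i - r i)) \<partial>count_space C)" .
qed

text \<open>The cover is by non-centred intervals, so that left and right difference quotients are
  treated alike.\<close>

lemma Vitali_interval_cover:
  fixes S O' :: "real set" and P :: "real \<Rightarrow> real \<Rightarrow> bool"
  assumes "open O'" "S \<subseteq> O'"
    and P: "\<forall>x\<in>S. \<forall>d>0. \<exists>c r. x \<in> cball c r \<and> 0 < r \<and> r < d \<and> P c r"
  shows "\<exists>C. countable C \<and> (\<forall>i\<in>C. 0 < snd i \<and> P (fst i) (snd i) \<and> cball (fst i) (snd i) \<subseteq> O') \<and>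
    pairwise (\<lambda>i j. disjnt (cball (fst i) (snd i)) (cball (fst j) (snd j))) C \<and>
    negligible (S - (\<Union>i\<in>C. cball (fst i) (snd i)))"
proof -
  define K where "K = {(c, r). 0 < r \<and> P c r \<and> cball c r \<subseteq> O'}"
  have *: "\<exists>i. i \<in> K \<and> x \<in> cball (fst i) (snd i) \<and> snd i < d" if x: "x \<in> S" and d: "0 < d" for x d
  proof -
    obtain e where e: "e > 0" "ball x e \<subseteq> O'"
      using assms(1,2) x by (meson openE subsetD)
    \<comment> \<open>An interval that contains \<open>x\<close> and has radius below
      \<open>e / 2\<close> lies within distance \<open>e\<close> of \<open>x\<close>, although
      \<open>x\<close> need not be its centre.\<close>
    obtain c r where cr: "x \<in> cball c r" "0 < r" "r < min d (e / 2)" "P c r"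
      using P[rule_format, OF x, of "min d (e / 2)"] d e(1) by auto
    have "cball c r \<subseteq> ball x e"
      using cr by (auto simp: dist_real_def)
    with e cr show ?thesis
      by (intro exI[of _ "(c, r)"]) (auto simp: K_def)
  qed
  have r: "0 < snd i" if "i \<in> K" for i
    using that by (auto simp: K_def)
  show ?thesis
  proof (rule Vitali_covering_theorem_cballs[of K snd S fst, OF r *])
    fix C assume C: "countable C" "C \<subseteq> K"
      "pairwise (\<lambda>i j. disjnt (cball (fst i) (snd i)) (cball (fst j) (snd j))) C"
      "negligible (S - (\<Union>i\<in>C. cball (fst i) (snd i)))"
    have "\<forall>i\<in>C. 0 < snd i \<and> P (fst i) (snd i) \<and> cball (fst i) (snd i) \<subseteq> O'"
      using C(2) unfolding K_def by (fastforce simp: subset_iff)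
    with C show ?thesis by blast
  qed
qed

text \<open>Two nested Vitali coverings: intervals of small slope inside an open superset of
  \<open>S\<close>, and intervals of large slope inside those. Comparing the lengths of their images
  shows that the second family has at most \<open>p / q\<close> times the measure of the open set,
  yet it still covers almost all of \<open>S\<close>. Hence the outer measure of \<open>S\<close> is
  at most \<open>p / q\<close> times itself, and so it vanishes.\<close>

lemma negligible_oscillating_slopes:
  fixes f :: "real \<Rightarrow> real"
  assumes f: "strict_mono f" "continuous_on UNIV f" and pq: "0 < p" "p < q" and S: "bounded S"
    and low: "\<forall>x\<in>S. \<forall>d>0.
      \<exists>c r. x \<in> cball c r \<and> 0 < r \<and> r < d \<and> f (c + r) - f (c - r) \<le> p * (2 * r)"
    and high: "\<forall>x\<in>S. \<forall>d>0.
      \<exists>c r. x \<in> cball c r \<and> 0 < r \<and> r < d \<and> q * (2 * r) \<le> f (c + r) - f (c - r)"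
  shows "negligible S"
proof -
  have shrink: "\<exists>T. S \<subseteq> T \<and> T \<in> lmeasurable \<and> measure lebesgue T \<le> (p / q) * measure lebesgue O'"
    if O': "open O'" "S \<subseteq> O'" "O' \<in> lmeasurable" for O'
  proof -
    note Vitali_interval_cover[where P = "\<lambda>c r. f (c + r) - f (c - r) \<le> p * (2 * r)", OF O'(1,2) low]
    from this obtain C where C: "countable C"
      and C1: "\<forall>i\<in>C. 0 < snd i \<and> f (fst i + snd i) - f (fst i - snd i) \<le> p * (2 * snd i) \<and> cball (fst i) (snd i) \<subseteq> O'"
      and C2: "pairwise (\<lambda>i j. disjnt (cball (fst i) (snd i)) (cball (fst j) (snd j))) C"
      and C3: "negligible (S - (\<Union>i\<in>C. cball (fst i) (snd i)))"
      by (elim exE conjE)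
    \<comment> \<open>The second covering has to take place inside an open set, so the end points of
      the first intervals are dropped; there are countably many of them.\<close>
    define I where "I = (\<Union>i\<in>C. ball (fst i) (snd i))"
    define I' where "I' = (\<Union>i\<in>C. cball (fst i) (snd i))"
    have I: "open I" "I \<subseteq> I'" "I' \<subseteq> O'"
      using C1 by (auto simp: I_def I'_def)
    have "negligible (I' - I)"
    proof (rule negligible_subset)
      show "negligible (\<Union>i\<in>C. sphere (fst i) (snd i))"
        using C by (intro negligible_countable_Union) (auto intro: negligible_sphere)
      show "I' - I \<subseteq> (\<Union>i\<in>C. sphere (fst i) (snd i))"
        unfolding I_def I'_def using cball_diff_eq_sphere by blast
    qed
    then have "negligible ((S - I') \<union> (I' - I))"
      using C3 by (simp add: I'_def)
    then have neg1: "negligible (S - I)"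
      by (rule negligible_subset) auto
    have "S \<inter> I \<subseteq> I" by simp
    from this high have "\<forall>x\<in>S \<inter> I. \<forall>d>0. \<exists>c r. x \<in> cball c r \<and> 0 < r \<and> r < d \<and> q * (2 * r) \<le> f (c + r) - f (c - r)"
      by blast
    note Vitali_interval_cover[where P = "\<lambda>c r. q * (2 * r) \<le> f (c + r) - f (c - r)", OF I(1) \<open>S \<inter> I \<subseteq> I\<close> this]
    from this obtain D where D: "countable D"
      and D1: "\<forall>i\<in>D. 0 < snd i \<and> q * (2 * snd i) \<le> f (fst i + snd i) - f (fst i - snd i) \<and> cball (fst i) (snd i) \<subseteq> I"
      and D2: "pairwise (\<lambda>i j. disjnt (cball (fst i) (snd i)) (cball (fst j) (snd j))) D"
      and D3: "negligible (S \<inter> I - (\<Union>i\<in>D. cball (fst i) (snd i)))"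
      by (elim exE conjE)
    define J where "J = (\<Union>i\<in>D. cball (fst i) (snd i))"
    have JI: "J \<subseteq> I"
      using D1 by (fastforce simp: J_def)
    have meas: "J \<in> sets lborel" "I' \<in> sets lborel"
      using C D by (auto simp: J_def I'_def)
    \<comment> \<open>The chain reads: \<open>q\<close> times the length of \<open>J\<close> is at
      most the length of \<open>f\<close> J\<open>, which is at most that of\<close>f
      \<open>I'\<close>, which is at most \<open>p\<close> times the length of \<open>I'\<close>,
      hence at most \<open>p\<close> times that of \<open>O'\<close>.\<close>
    have "ennreal q * emeasure lborel J = (\<integral>\<^sup>+i. ennreal q * ennreal (2 * snd i) \<partial>count_space D)"
      unfolding J_def using D1 D D2
      by (subst emeasure_image_disjoint_cballs(1)[OF f]) (auto simp: nn_integral_cmult)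
    also have "\<dots> \<le> (\<integral>\<^sup>+i. ennreal (f (fst i + snd i) - f (fst i - snd i)) \<partial>count_space D)"
      by (rule nn_integral_mono) (use D1 pq in \<open>auto simp: ennreal_mult'[symmetric] intro!: ennreal_leI\<close>)
    also have "\<dots> = emeasure lborel (f ` J)"
      unfolding J_def by (rule emeasure_image_disjoint_cballs(2)[OF f, symmetric]) (use D D1 D2 in auto)
    also have "\<dots> \<le> emeasure lborel (f ` I')"
    proof (rule emeasure_mono)
      show "f ` J \<subseteq> f ` I'"
        using JI I by auto
      have "f ` cball (fst i) (snd i) \<in> sets lborel" if "i \<in> C" for i
        using C1 that by (subst image_cball_strict_mono[OF f]) auto
      then show "f ` I' \<in> sets lborel"
        unfolding I'_def image_UN using C by (intro sets.countable_UN'') auto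
    qed
    also have "\<dots> = (\<integral>\<^sup>+i. ennreal (f (fst i + snd i) - f (fst i - snd i)) \<partial>count_space C)"
      unfolding I'_def by (rule emeasure_image_disjoint_cballs(2)[OF f]) (use C C1 C2 in auto)
    also have "\<dots> \<le> (\<integral>\<^sup>+i. ennreal p * ennreal (2 * snd i) \<partial>count_space C)"
      by (rule nn_integral_mono) (use C1 pq in \<open>auto simp: ennreal_mult'[symmetric] intro!: ennreal_leI\<close>)
    also have "\<dots> = ennreal p * emeasure lborel I'"
      unfolding I'_def using C1 C C2
      by (subst emeasure_image_disjoint_cballs(1)[OF f]) (auto simp: nn_integral_cmult)
    also have "emeasure lborel I' = emeasure lebesgue I'"
      using meas by simp
    also have "\<dots> \<le> emeasure lebesgue O'"
      using I O' by (intro emeasure_mono) auto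
    also have "emeasure lebesgue O' = ennreal (measure lebesgue O')"
      using O'(3) by (simp add: emeasure_eq_measure2)
    finally have *: "ennreal q * emeasure lborel J \<le> ennreal p * ennreal (measure lebesgue O')"
      by (simp add: mult_left_mono)
    have "J \<subseteq> O'" using JI I by auto
    then have Jm: "J \<in> lmeasurable"
      using meas O'(3) by (metis bounded_set_imp_lmeasurable fmeasurableI2 sets_completionI_sets sets_lborel)
    have "q * measure lebesgue J \<le> p * measure lebesgue O'"
    proof -
      have eJ: "emeasure lborel J = ennreal (measure lebesgue J)"
        using emeasure_eq_measure2[OF Jm] meas by simp
      have "ennreal (q * measure lebesgue J) \<le> ennreal (p * measure lebesgue O')"
        using * pq unfolding eJ by (simp add: ennreal_mult)
      then show ?thesis using pq by (simp add: ennreal_le_iff)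
    qed
    then have Jle: "measure lebesgue J \<le> (p / q) * measure lebesgue O'"
      using pq by (simp add: field_simps)
    have "negligible (S - J)"
    proof (rule negligible_subset)
      show "negligible ((S - I) \<union> (S \<inter> I - J))"
        using neg1 D3 by (simp add: J_def)
    qed auto
    then have N: "(S - J) \<in> lmeasurable" "measure lebesgue (S - J) = 0"
      by (auto simp: negligible_iff_measure)
    have "measure lebesgue (J \<union> (S - J)) \<le> measure lebesgue J + measure lebesgue (S - J)"
      using N Jm by (intro measure_Un_le) auto
    with Jle N(2) have "measure lebesgue (J \<union> (S - J)) \<le> (p / q) * measure lebesgue O'"
      by simp
    moreover have "J \<union> (S - J) \<in> lmeasurable"
      using N Jm by blast
    ultimately show ?thesis
      by (intro exI[of _ "J \<union> (S - J)"]) auto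
  qed
  \<comment> \<open>\<open>m\<close> is the outer measure of \<open>S\<close>, taken as an infimum
    over measurable supersets because measurability of \<open>S\<close> is not at hand. Boundedness
    of \<open>S\<close> makes it finite.\<close>
  define M where "M = measure lebesgue ` {T \<in> lmeasurable. S \<subseteq> T}"
  define m where "m = Inf M"
  have bdd: "bdd_below M"
    by (auto simp: M_def intro: bdd_belowI[of _ 0])
  obtain R where "S \<subseteq> ball 0 R"
    using bounded_subset_ballD[OF S, of 0] by blast
  then have "measure lebesgue (ball (0::real) R) \<in> M"
    unfolding M_def using lmeasurable_ball by (intro imageI) simp
  then have "M \<noteq> {}"
    by blast
  \<comment> \<open>Half of \<open>e\<close> pays for a nearly optimal measurable superset, the
    other half for enlarging it to an open set to which \<open>shrink\<close> applies.\<close>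
  have *: "m \<le> (p / q) * (m + e)" if e: "e > 0" for e
  proof -
    obtain T where T: "T \<in> lmeasurable" "S \<subseteq> T" "measure lebesgue T < m + e / 2"
      using cInf_lessD[OF \<open>M \<noteq> {}\<close>, of "m + e / 2"] e by (auto simp: m_def M_def)
    obtain O' where O': "open O'" "T \<subseteq> O'" "O' \<in> lmeasurable" "measure lebesgue O' < measure lebesgue T + e / 2"
    proof -
      obtain O' where O': "open O'" "T \<subseteq> O'" "O' - T \<in> lmeasurable" "emeasure lebesgue (O' - T) < ennreal (e / 2)"
        using sets_lebesgue_outer_open[of T "e / 2"] T(1) e by (auto simp: fmeasurable_def)
      have "measure lebesgue (O' - T) < e / 2"
        using O'(4) emeasure_eq_measure2[OF O'(3)] e by (simp add: ennreal_less_iff)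
      moreover have "T \<union> (O' - T) = O'" using O'(2) by blast
      ultimately show ?thesis
        using that[OF O'(1,2)] measure_Un_le[of T lebesgue "O' - T"] fmeasurable.Un[OF T(1) O'(3)] T(1) O'(3)
        by (auto simp: fmeasurable_def)
    qed
    obtain T' where T': "S \<subseteq> T'" "T' \<in> lmeasurable" "measure lebesgue T' \<le> (p / q) * measure lebesgue O'"
      using shrink[OF O'(1) _ O'(3)] O'(2) T(2) by auto
    have "measure lebesgue T' \<in> M"
      unfolding M_def using T' by blast
    then have "m \<le> measure lebesgue T'"
      unfolding m_def using bdd by (rule cInf_lower)
    also have "\<dots> \<le> (p / q) * (m + e)"
      using T' O'(4) T(3) pq by (intro order.trans[OF T'(3)] mult_left_mono) auto
    finally show ?thesis .
  qed
  have "m \<le> (p / q) * m"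
  proof (rule field_le_epsilon)
    fix e :: real assume "e > 0"
    have "(p / q) * e \<le> 1 * e" using pq \<open>e > 0\<close> by (intro mult_right_mono) auto
    then show "m \<le> p / q * m + e"
      using *[OF \<open>e > 0\<close>] unfolding distrib_left by linarith
  qed
  then have "m * (1 - p / q) \<le> 0"
    by (simp add: algebra_simps)
  moreover have "1 - p / q > 0" using pq by simp
  ultimately have "m \<le> 0"
    by (simp add: mult_le_0_iff)
  show ?thesis
    unfolding negligible_outer_le
  proof (intro allI impI)
    fix e :: real assume "e > 0"
    then obtain T where T: "T \<in> lmeasurable" "S \<subseteq> T" "measure lebesgue T < e"
      using cInf_lessD[OF \<open>M \<noteq> {}\<close>, of "e"] \<open>m \<le> 0\<close> by (auto simp: m_def M_def)
    then show "\<exists>T. S \<subseteq> T \<and> T \<in> lmeasurable \<and> measure lebesgue T \<le> e"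
      by (auto intro: less_imp_le)
  qed
qed

lemma slope_frequently_interval:
  fixes f :: "real \<Rightarrow> real"
  assumes "frequently (\<lambda>h. P ((f (x + h) - f x) / h)) (at 0)" "0 < d"
  shows "\<exists>c r. x \<in> cball c r \<and> 0 < r \<and> r < d \<and> P ((f (c + r) - f (c - r)) / (2 * r))"
proof -
  have "eventually (\<lambda>h. h \<noteq> 0 \<and> \<bar>h\<bar> < d) (at 0)"
    using assms(2) by (auto simp: eventually_at dist_real_def intro: exI[of _ d])
  then obtain h where h: "P ((f (x + h) - f x) / h)" "h \<noteq> 0" "\<bar>h\<bar> < d"
    using frequently_eventually_frequently[OF assms(1)] frequently_ex by (smt (verit, best))
  \<comment> \<open>Midpoint and half length of the interval between \<open>x\<close> and
    \<open>x + h\<close>. Since \<open>h\<close> may have either sign, the point \<open>x\<close> is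
    the left or the right end of it.\<close>
  define c r where "c = x + h / 2" and "r = \<bar>h\<bar> / 2"
  have "(f (c + r) - f (c - r)) / (2 * r) = (f (x + h) - f x) / h"
  proof (cases "h > 0")
    case True
    then have "c + r = x + h" "c - r = x" "2 * r = h"
      by (auto simp: c_def r_def field_simps)
    then show ?thesis by metis
  next
    case False
    then have "c + r = x" "c - r = x + h" "2 * r = - h"
      by (auto simp: c_def r_def field_simps)
    then show ?thesis by (metis minus_diff_eq minus_divide_divide)
  qed
  moreover have "x \<in> cball c r" "0 < r" "r < d"
    using h by (auto simp: c_def r_def dist_real_def)
  ultimately show ?thesis using h(1) by metis
qed

text \<open>A bounded function that does not converge has an upper limit above its lower limit, and
  two rationals fit in between. The bound \<open>l < p\<close> is what later makes the smaller slope
  positive.\<close>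

lemma slope_not_convergent:
  fixes s :: "real \<Rightarrow> real"
  assumes bdd: "\<And>h. h \<noteq> 0 \<Longrightarrow> l \<le> s h \<and> s h \<le> u" and nc: "\<nexists>D. (s \<longlongrightarrow> D) (at 0)"
  obtains p q where "p \<in> \<rat>" "q \<in> \<rat>" "l < p" "p < q" "frequently (\<lambda>h. s h < p) (at 0)" "frequently (\<lambda>h. q < s h) (at 0)"
proof -
  have ev: "eventually (\<lambda>h::real. h \<noteq> 0) (at 0)"
    by (auto simp: eventually_at intro: exI[of _ 1])
  define A where "A = {a. eventually (\<lambda>h. a < s h) (at 0)}"
  have A1: "l - 1 \<in> A"
    unfolding A_def using ev by simp (rule eventually_mono[OF ev], use bdd in force)
  have A2: "a \<le> u" if "a \<in> A" for a
  proof -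
    have "eventually (\<lambda>h. a < s h \<and> h \<noteq> 0) (at (0::real))"
      using that ev by (auto simp: A_def intro: eventually_conj)
    then obtain h where "a < s h" "h \<noteq> 0"
      using eventually_happens' trivial_limit_at by blast
    then show ?thesis using bdd[of h] by simp
  qed
  \<comment> \<open>\<open>A\<close> collects the eventual strict lower bounds, so \<open>D\<close>
    is the lower limit of \<open>s\<close> at 0.\<close>
  define D where "D = Sup A"
  have bA: "bdd_above A" by (rule bdd_aboveI[OF A2])
  have lD: "eventually (\<lambda>h. a < s h) (at 0)" if "a < D" for a
  proof -
    have "\<exists>b\<in>A. a < b"
      using A1 that unfolding D_def by (intro less_cSupD) auto
    then obtain b where "b \<in> A" "a < b" by blast
    then show ?thesis
      by (auto simp: A_def elim: eventually_mono)
  qed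
  have "\<not> (s \<longlongrightarrow> D) (at 0)" using nc by blast
  then obtain b where b: "D < b" "\<not> eventually (\<lambda>h. s h < b) (at 0)"
    unfolding order_tendsto_iff using lD by blast
  obtain q where q: "q \<in> \<rat>" "D < q" "q < b" using Rats_dense_in_real[OF b(1)] by blast
  obtain p where p: "p \<in> \<rat>" "D < p" "p < q" using Rats_dense_in_real[OF q(2)] by blast
  \<comment> \<open>Failure of an eventual lower bound only yields a weak inequality; the room
    between \<open>p'\<close> and \<open>p\<close> makes it strict.\<close>
  obtain p' where p': "D < p'" "p' < p" using dense[OF p(2)] by blast
  have f1: "frequently (\<lambda>h. q < s h) (at 0)"
    unfolding frequently_def
  proof
    assume "eventually (\<lambda>h. \<not> q < s h) (at 0)"
    then have "eventually (\<lambda>h. s h < b) (at 0)"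
      by (rule eventually_mono) (use q(3) in auto)
    with b(2) show False ..
  qed
  have "p' \<notin> A"
    using cSup_upper[OF _ bA, of p'] p'(1) by (auto simp: D_def)
  then have "frequently (\<lambda>h. s h \<le> p') (at 0)"
    unfolding A_def frequently_def by (simp add: not_le)
  then have f2: "frequently (\<lambda>h. s h < p) (at 0)"
    by (rule frequently_mono[rotated]) (use p' in auto)
  have "l < p"
  proof -
    obtain h where "s h \<le> p'" "h \<noteq> 0"
      using frequently_eventually_frequently[OF \<open>frequently (\<lambda>h. s h \<le> p') (at 0)\<close> ev] frequently_ex
      by (smt (verit, best))
    then show ?thesis using bdd[of h] p' by simp
  qed
  show ?thesis
    by (rule that[OF p(1) q(1) \<open>l < p\<close> p(3) f2 f1])
qed

text \<open>A point without derivative is a point where the difference quotients oscillate across a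
  rational interval, and for each such interval these points form a null set.\<close>

theorem lipschitz_differentiable_ae_real:
  fixes f :: "real \<Rightarrow> real"
  assumes "L-lipschitz_on UNIV f"
  shows "negligible {x. \<not> f differentiable (at x)}"
proof -
  \<comment> \<open>Adding a linear function does not affect differentiability and puts all slopes
    between 1 and \<open>2 * L + 1\<close>, so the new function is strictly increasing.\<close>
  define g where "g x = f x + (L + 1) * x" for x
  have L: "0 \<le> L" using assms by (rule lipschitz_on_nonneg)
  have fL: "\<bar>f y - f x\<bar> \<le> L * \<bar>y - x\<bar>" for x y
    using lipschitz_onD[OF assms, of y x] by (simp add: dist_real_def)
  have slope: "1 \<le> (g (x + h) - g x) / h \<and> (g (x + h) - g x) / h \<le> 2 * L + 1" if "h \<noteq> 0" for x h
  proof -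
    have "\<bar>(f (x + h) - f x) / h\<bar> \<le> L"
      using fL[of "x + h" x] that by (simp add: abs_divide divide_le_eq)
    moreover have "(g (x + h) - g x) / h = (f (x + h) - f x) / h + (L + 1)"
      using that by (simp add: g_def field_simps)
    ultimately show ?thesis unfolding abs_le_iff by linarith
  qed
  have mono: "strict_mono g"
  proof (rule strict_monoI)
    fix x y :: real assume "x < y"
    then have "1 \<le> (g y - g x) / (y - x)" using slope[of "y - x" x] by simp
    then show "g x < g y" using \<open>x < y\<close> by (simp add: le_divide_eq)
  qed
  have cont: "continuous_on UNIV g"
    unfolding g_def by (intro continuous_intros lipschitz_on_continuous_on[OF assms])
  \<comment> \<open>The cut-off by \<open>n\<close> serves boundedness; two rationals and a natural
    number leave a countable union.\<close>
  define E where "E p q n = {x \<in> ball 0 (real n). frequently (\<lambda>h. (g (x + h) - g x) / h < p) (at 0) \<and>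
      frequently (\<lambda>h. q < (g (x + h) - g x) / h) (at 0)}" for p q n
  have neg: "negligible (E p q n)" if "1 < p" "p < q" for p q n
  proof (rule negligible_oscillating_slopes[OF mono cont _ that(2)])
    show "0 < p" using that by simp
    show "bounded (E p q n)"
      by (rule bounded_subset[OF bounded_ball[of 0 "real n"]]) (auto simp: E_def)
    show "\<forall>x\<in>E p q n. \<forall>d>0. \<exists>c r. x \<in> cball c r \<and> 0 < r \<and> r < d \<and> g (c + r) - g (c - r) \<le> p * (2 * r)"
    proof (intro ballI allI impI)
      fix x and d :: real assume "x \<in> E p q n" "0 < d"
      then obtain c r where "x \<in> cball c r" "0 < r" "r < d" "(g (c + r) - g (c - r)) / (2 * r) < p"
        using slope_frequently_interval[of "\<lambda>s. s < p" g x d] by (auto simp: E_def)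
      then show "\<exists>c r. x \<in> cball c r \<and> 0 < r \<and> r < d \<and> g (c + r) - g (c - r) \<le> p * (2 * r)"
        by (intro exI[of _ c] exI[of _ r]) (auto simp: field_simps)
    qed
    show "\<forall>x\<in>E p q n. \<forall>d>0. \<exists>c r. x \<in> cball c r \<and> 0 < r \<and> r < d \<and> q * (2 * r) \<le> g (c + r) - g (c - r)"
    proof (intro ballI allI impI)
      fix x and d :: real assume "x \<in> E p q n" "0 < d"
      then obtain c r where "x \<in> cball c r" "0 < r" "r < d" "q < (g (c + r) - g (c - r)) / (2 * r)"
        using slope_frequently_interval[of "\<lambda>s. q < s" g x d] by (auto simp: E_def)
      then show "\<exists>c r. x \<in> cball c r \<and> 0 < r \<and> r < d \<and> q * (2 * r) \<le> g (c + r) - g (c - r)"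
        by (intro exI[of _ c] exI[of _ r]) (auto simp: field_simps)
    qed
  qed
  have "countable {(p, q, n). p \<in> \<rat> \<and> q \<in> \<rat> \<and> 1 < p \<and> p < q \<and> (n::nat) \<in> UNIV}"
    by (rule countable_subset[OF _ countable_SIGMA[OF countable_rat countable_SIGMA[OF countable_rat countableI_type]]])
      (auto simp: Sigma_def)
  then have "negligible (\<Union>i\<in>{(p, q, n). p \<in> \<rat> \<and> q \<in> \<rat> \<and> 1 < p \<and> p < q \<and> (n::nat) \<in> UNIV}. (case i of (p, q, n) \<Rightarrow> E p q n))"
    by (intro negligible_countable_Union) (use neg in auto)
  then show ?thesis
  proof (rule negligible_subset, intro subsetI)
    fix x assume "x \<in> {x. \<not> f differentiable (at x)}"
    then have nf: "\<not> f differentiable (at x)" by simp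
    have nc: "\<nexists>D. ((\<lambda>h. (g (x + h) - g x) / h) \<longlongrightarrow> D) (at 0)"
    proof
      assume "\<exists>D. ((\<lambda>h. (g (x + h) - g x) / h) \<longlongrightarrow> D) (at 0)"
      then obtain D where "(g has_real_derivative D) (at x)"
        by (auto simp: DERIV_def)
      then have "((\<lambda>x. g x - (L + 1) * x) has_real_derivative D - (L + 1)) (at x)"
        by (auto intro!: derivative_eq_intros)
      then show False using nf by (auto simp: g_def real_differentiable_def)
    qed
    obtain p q where pq: "p \<in> \<rat>" "q \<in> \<rat>" "1 < p" "p < q"
      "frequently (\<lambda>h. (g (x + h) - g x) / h < p) (at 0)" "frequently (\<lambda>h. q < (g (x + h) - g x) / h) (at 0)"
      by (rule slope_not_convergent[of 1 "\<lambda>h. (g (x + h) - g x) / h" "2 * L + 1"], erule slope, rule nc, rule that)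
    obtain n :: nat where "\<bar>x\<bar> < real n" using reals_Archimedean2 by blast
    then have "x \<in> E p q n" using pq by (simp add: E_def)
    then show "x \<in> (\<Union>i\<in>{(p, q, n). p \<in> \<rat> \<and> q \<in> \<rat> \<and> 1 < p \<and> p < q \<and> (n::nat) \<in> UNIV}. (case i of (p, q, n) \<Rightarrow> E p q n))"
      using pq by (intro UN_I[of "(p, q, n)"]) auto
  qed
qed

corollary lipschitz_differentiable_ae:
  fixes f :: "real \<Rightarrow> 'e::euclidean_space"
  assumes f: "L-lipschitz_on {a..b} f"
  shows "negligible {x \<in> {a<..<b}. \<not> f differentiable (at x)}"
proof (cases "a < b")
  case True
  \<comment> \<open>The constant continuation beyond both ends is Lipschitz on the whole line with
    the same constant and agrees with \<open>f\<close> inside.\<close>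
  define h where "h x = f (min b (max a x))" for x
  have hL: "L-lipschitz_on UNIV h"
  proof (rule lipschitz_onI)
    fix x y :: real
    have "dist (h x) (h y) \<le> L * dist (min b (max a x)) (min b (max a y))"
      unfolding h_def using True by (intro lipschitz_onD[OF f]) auto
    also have "\<dots> \<le> L * dist x y"
      using lipschitz_on_nonneg[OF f] by (intro mult_left_mono) (auto simp: dist_real_def)
    finally show "dist (h x) (h y) \<le> L * dist x y" .
  qed (rule lipschitz_on_nonneg[OF f])
  have "negligible {x. \<not> (\<lambda>x. h x \<bullet> i) differentiable (at x)}" if "i \<in> Basis" for i
  proof (rule lipschitz_differentiable_ae_real)
    show "L-lipschitz_on UNIV (\<lambda>x. h x \<bullet> i)"
    proof (rule lipschitz_onI)
      fix x y
      have "\<bar>(h x - h y) \<bullet> i\<bar> \<le> norm (h x - h y)"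
        using that by (rule Basis_le_norm)
      also have "\<dots> \<le> L * dist x y"
        using lipschitz_onD[OF hL, of x y] by (simp add: dist_norm)
      finally show "dist (h x \<bullet> i) (h y \<bullet> i) \<le> L * dist x y"
        by (simp add: dist_real_def inner_diff_left)
    qed (rule lipschitz_on_nonneg[OF f])
  qed
  then have "negligible (\<Union>i\<in>Basis. {x. \<not> (\<lambda>x. h x \<bullet> i) differentiable (at x)})"
    by (intro negligible_Union) auto
  then show ?thesis
  proof (rule negligible_subset, intro subsetI)
    fix x assume x: "x \<in> {x \<in> {a<..<b}. \<not> f differentiable (at x)}"
    have "\<not> h differentiable (at x)"
    proof
      assume "h differentiable (at x)"
      then obtain D where "(h has_derivative D) (at x)" by (auto simp: differentiable_def)
      then have "(f has_derivative D) (at x)"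
        by (rule has_derivative_transform_within_open[of _ _ _ _ "{a<..<b}"]) (use x in \<open>auto simp: h_def\<close>)
      then show False using x by (auto simp: differentiable_def)
    qed
    then show "x \<in> (\<Union>i\<in>Basis. {x. \<not> (\<lambda>x. h x \<bullet> i) differentiable (at x)})"
      using differentiable_componentwise_within[of h x UNIV] by auto
  qed
qed auto

text \<open>If the function decreased, the values in the gap would form a nondegenerate interval,
  while the image of the exceptional set is null. So some value in the gap is attained only at good
  points; the last such point contradicts the sign of the derivative there.\<close>

lemma lipschitz_derivative_nonneg_imp_le:
  fixes f :: "real \<Rightarrow> real"
  assumes ab: "a \<le> b" and f: "L-lipschitz_on {a..b} f" and N: "negligible N"
    and D: "\<And>t. t \<in> {a<..<b} - N \<Longrightarrow> \<exists>D\<ge>0. (f has_real_derivative D) (at t)"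
  shows "f a \<le> f b"
proof (rule ccontr)
  assume "\<not> f a \<le> f b"
  then have fab: "f b < f a" and "a < b" using ab by (cases "a = b"; simp)+
  \<comment> \<open>The tilt takes back half of the supposed decrease: \<open>g\<close> still
    decreases from \<open>a\<close> to \<open>b\<close>, but its derivative at good points is now
    strictly positive.\<close>
  define e where "e = (f a - f b) / (2 * (b - a))"
  have e: "e > 0" using fab \<open>a < b\<close> by (simp add: e_def)
  define g where "g x = f x + e * (x - a)" for x
  have gab: "g b < g a"
  proof -
    have "e * (b - a) = (f a - f b) / 2"
      unfolding e_def using \<open>a < b\<close> by (simp add: divide_eq_eq eq_divide_eq)
    then show ?thesis using fab by (simp add: g_def)
  qed
  have gL: "(L + e)-lipschitz_on {a..b} g"
    unfolding g_def by (rule lipschitz_on_add[OF f]) (use e in \<open>auto intro!: lipschitz_onI simp: dist_real_def abs_mult simp flip: right_diff_distrib\<close>)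
  then have cont: "continuous_on {a..b} g" by (rule lipschitz_on_continuous_on)
  have "negligible (g ` (N \<inter> {a..b}))"
  proof (rule negligible_locally_Lipschitz_image)
    show "negligible (N \<inter> {a..b})" using N by (rule negligible_subset) auto 
    fix x assume "x \<in> N \<inter> {a..b}"
    then show "\<exists>T B. open T \<and> x \<in> T \<and> (\<forall>y\<in>N \<inter> {a..b} \<inter> T. norm (g y - g x) \<le> B * norm (y - x))"
      using lipschitz_on_normD[OF gL] by (intro exI[of _ UNIV] exI[of _ "L + e"]) auto
  qed auto
  moreover have "\<not> negligible {g b<..<g a}"
    using gab by (simp add: open_not_negligible)
  ultimately obtain y where y: "g b < y" "y < g a" "y \<notin> g ` (N \<inter> {a..b})"
    by (metis greaterThanLessThan_iff negligible_subset subsetI)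
  define T where "T = {t \<in> {a..b}. y \<le> g t}"
  have T: "closed T" "T \<noteq> {}" "bdd_above T"
  proof -
    show "closed T"
      unfolding T_def by (intro continuous_on_closed_Collect_le continuous_on_const cont) auto
    show "T \<noteq> {}" using y(2) \<open>a < b\<close> by (auto simp: T_def intro!: exI[of _ a])
    show "bdd_above T" by (rule bdd_aboveI[of _ b]) (auto simp: T_def)
  qed
  \<comment> \<open>The last time at which \<open>g\<close> is at least \<open>y\<close>. There
    \<open>g\<close> equals \<open>y\<close>, so the point is not in \<open>N\<close>; by the
    positive derivative \<open>g\<close> exceeds \<open>y\<close> just afterwards.\<close>
  define t where "t = Sup T"
  have tT: "t \<in> T" unfolding t_def using closed_contains_Sup[OF T(2,3,1)] .
  have after: "g s < y" if "t < s" "s \<le> b" for s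
  proof (rule ccontr)
    assume "\<not> g s < y"
    then have "s \<in> T" using that tT by (auto simp: T_def)
    then have "s \<le> t" unfolding t_def using T(3) by (rule cSup_upper)
    then show False using that by simp
  qed
  have "t < b" using tT y(1) by (cases "t = b") (auto simp: T_def)
  obtain s where s: "t \<le> s" "s \<le> b" "g s = y"
    using IVT2'[of g b y t] y(1) tT \<open>t < b\<close> continuous_on_subset[OF cont, of "{t..b}"]
    by (auto simp: T_def)
  then have gt: "g t = y" using after[of s] by (cases "t = s") auto
  then have t: "t \<in> {a<..<b} - N"
    using tT y \<open>t < b\<close> by (auto simp: T_def less_le)
  then obtain D where "D \<ge> 0" "(f has_real_derivative D) (at t)"
    using D by blast
  then have "(g has_real_derivative D + e) (at t)"
    unfolding g_def by (auto intro!: derivative_eq_intros)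
  then obtain d where d: "d > 0" "\<And>h. 0 < h \<Longrightarrow> h < d \<Longrightarrow> g t < g (t + h)"
    using DERIV_pos_inc_right[of g "D + e" t] e \<open>D \<ge> 0\<close> by auto
  have "g t < g (t + min (d / 2) (b - t))"
    using d(1) \<open>t < b\<close> by (intro d(2)) (auto simp: min_def)
  moreover have "g (t + min (d / 2) (b - t)) < y"
    using d(1) \<open>t < b\<close> by (intro after) auto
  ultimately show False using gt by simp
qed

section \<open>Geodesics in coordinates\<close>

lemma linear_real_expand:
  fixes f :: "'e::euclidean_space \<Rightarrow> real"
  assumes "linear f"
  shows "f x = (\<Sum>i\<in>Basis. (x \<bullet> i) * f i)"
proof -
  have "f x = f (\<Sum>i\<in>Basis. (x \<bullet> i) *\<^sub>R i)"
    by (simp add: euclidean_representation)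
  also have "\<dots> = (\<Sum>i\<in>Basis. (x \<bullet> i) * f i)"
    using assms by (simp add: linear_sum linear_scale)
  finally show ?thesis .
qed

lemma linear_real_bound:
  fixes f :: "'e::euclidean_space \<Rightarrow> real"
  assumes "linear f"
  shows "\<bar>f x\<bar> \<le> (\<Sum>i\<in>Basis. \<bar>f i\<bar>) * norm x"
proof -
  have "\<bar>f x\<bar> \<le> (\<Sum>i\<in>Basis. \<bar>(x \<bullet> i) * f i\<bar>)"
    unfolding linear_real_expand[OF assms, of x] by (rule sum_abs)
  also have "\<dots> \<le> (\<Sum>i\<in>Basis. norm x * \<bar>f i\<bar>)"
    by (intro sum_mono) (auto simp: abs_mult intro!: mult_right_mono Basis_le_norm)
  finally show ?thesis by (simp add: sum_distrib_left mult.commute)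
qed

lemma bilinear_real_bound:
  fixes f :: "'e::euclidean_space \<Rightarrow> 'e \<Rightarrow> real"
  assumes "\<And>w. linear (\<lambda>u. f u w)" "\<And>u. linear (f u)"
  shows "\<bar>f u w\<bar> \<le> (\<Sum>i\<in>Basis. \<Sum>j\<in>Basis. \<bar>f i j\<bar>) * norm u * norm w"
proof -
  have "\<bar>f u w\<bar> \<le> (\<Sum>i\<in>Basis. \<bar>f i w\<bar>) * norm u"
    by (rule linear_real_bound[OF assms(1)])
  also have "\<dots> \<le> (\<Sum>i\<in>Basis. (\<Sum>j\<in>Basis. \<bar>f i j\<bar>) * norm w) * norm u"
    by (intro mult_right_mono sum_mono linear_real_bound assms) auto
  also have "\<dots> = (\<Sum>i\<in>Basis. \<Sum>j\<in>Basis. \<bar>f i j\<bar>) * norm u * norm w"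
    unfolding sum_distrib_right[symmetric] by (simp only: mult_ac)
  finally show ?thesis .
qed

lemma trilinear_real_bound:
  fixes f :: "'e::euclidean_space \<Rightarrow> 'e \<Rightarrow> 'e \<Rightarrow> real"
  assumes "\<And>u w. linear (\<lambda>z. f z u w)" "\<And>z w. linear (\<lambda>u. f z u w)" "\<And>z u. linear (f z u)"
  shows "\<bar>f z u w\<bar> \<le> (\<Sum>k\<in>Basis. \<Sum>i\<in>Basis. \<Sum>j\<in>Basis. \<bar>f k i j\<bar>) * norm z * norm u * norm w"
proof -
  have "\<bar>f z u w\<bar> \<le> (\<Sum>k\<in>Basis. \<bar>f k u w\<bar>) * norm z"
    by (rule linear_real_bound[OF assms(1)])
  also have "\<dots> \<le> (\<Sum>k\<in>Basis. (\<Sum>i\<in>Basis. \<Sum>j\<in>Basis. \<bar>f k i j\<bar>) * norm u * norm w) * norm z"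
    by (intro mult_right_mono sum_mono bilinear_real_bound assms) auto
  also have "\<dots> = (\<Sum>k\<in>Basis. \<Sum>i\<in>Basis. \<Sum>j\<in>Basis. \<bar>f k i j\<bar>) * norm z * norm u * norm w"
    unfolding sum_distrib_right[symmetric] by (simp only: mult_ac)
  finally show ?thesis .
qed

section \<open>The Christoffel symbols of a nondegenerate metric of class C^{1,1} on an open
  set\<close>

locale C11_form =
  fixes S :: "'e::euclidean_space set" and G :: "'e \<Rightarrow> 'e \<Rightarrow> 'e \<Rightarrow> real"
  assumes open_S: "open S"
    and C11: "\<And>u w. C11_on S (\<lambda>x. G x u w)"
    and G_sym: "\<And>x u w. x \<in> S \<Longrightarrow> G x u w = G x w u"
    and lin: "\<And>x w. x \<in> S \<Longrightarrow> linear (\<lambda>u. G x u w)"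
    and nondeg: "\<And>x u. x \<in> S \<Longrightarrow> (\<forall>w. G x u w = 0) \<Longrightarrow> u = 0"
begin

definition DG :: "'e \<Rightarrow> 'e \<Rightarrow> 'e \<Rightarrow> 'e \<Rightarrow> real" where
  "DG x z u w = frechet_derivative (\<lambda>y. G y u w) (at x) z"

text \<open>The Koszul formula with the index lowered, in the same shape as
  \<open>christoffel\<close>, so that the two notions agree by unfolding.\<close>

definition Chr :: "'e \<Rightarrow> 'e \<Rightarrow> 'e \<Rightarrow> 'e" where
  "Chr x u v = (THE w. \<forall>z. G x w z = (DG x u v z + DG x v u z - DG x z u v) / 2)"

lemma lin2: "x \<in> S \<Longrightarrow> linear (G x u)"
proof -
  assume x: "x \<in> S"
  have eq: "G x u = (\<lambda>w. G x w u)"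
    by (rule ext) (rule G_sym[OF x])
  show ?thesis by (subst eq) (rule lin[OF x])
qed

lemma G_simps:
  assumes "x \<in> S"
  shows "G x (u + v) w = G x u w + G x v w" "G x (u - v) w = G x u w - G x v w"
    "G x w (u + v) = G x w u + G x w v" "G x w (u - v) = G x w u - G x w v"
    "G x (c *\<^sub>R u) w = c * G x u w" "G x w (c *\<^sub>R u) = c * G x w u"
    "G x (- u) w = - G x u w" "G x w (- u) = - G x w u" "G x 0 w = 0" "G x w 0 = 0"
proof -
  show "G x (u + v) w = G x u w + G x v w"
    by (rule linear_add[OF lin[OF assms]])
  show "G x (u - v) w = G x u w - G x v w"
    by (rule linear_diff[OF lin[OF assms]])
  show "G x w (u + v) = G x w u + G x w v"
    by (rule linear_add[OF lin2[OF assms]])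
  show "G x w (u - v) = G x w u - G x w v"
    by (rule linear_diff[OF lin2[OF assms]])
  show "G x (c *\<^sub>R u) w = c * G x u w"
    by (rule linear_scale[OF lin[OF assms], unfolded real_scaleR_def])
  show "G x w (c *\<^sub>R u) = c * G x w u"
    by (rule linear_scale[OF lin2[OF assms], unfolded real_scaleR_def])
  show "G x (- u) w = - G x u w"
    by (rule linear_neg[OF lin[OF assms]])
  show "G x w (- u) = - G x w u"
    by (rule linear_neg[OF lin2[OF assms]])
  show "G x 0 w = 0"
    by (rule linear_0[OF lin[OF assms]])
  show "G x w 0 = 0"
    by (rule linear_0[OF lin2[OF assms]])
qed

lemma G_has_derivative:
  assumes "x \<in> S"
  shows "((\<lambda>y. G y u w) has_derivative (\<lambda>z. DG x z u w)) (at x)"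
proof -
  have "(\<lambda>y. G y u w) differentiable_on S"
    using C11[of u w] by (simp add: C11_on_def)
  then have "(\<lambda>y. G y u w) differentiable (at x within S)"
    using assms by (simp add: differentiable_on_def)
  then have "(\<lambda>y. G y u w) differentiable (at x)"
    by (simp only: at_within_open[OF assms open_S])
  then show ?thesis
    unfolding DG_def by (rule frechet_derivative_works[THEN iffD1])
qed

text \<open>Serves to carry symmetry and linearity of \<open>G\<close> in the vector arguments over
  to its derivative: derivatives are unique.\<close>

lemma DG_unique:
  assumes "x \<in> S" "(f has_derivative f') (at x)" "\<And>y. y \<in> S \<Longrightarrow> f y = G y u w"
  shows "DG x z u w = f' z"
proof -
  have "((\<lambda>y. G y u w) has_derivative f') (at x)"
    by (rule has_derivative_transform_within_open[OF assms(2) open_S assms(1)]) (use assms(3) in auto)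
  then show ?thesis
    using has_derivative_unique[OF G_has_derivative[OF assms(1)]] by metis
qed

lemma DG_lin1: "x \<in> S \<Longrightarrow> linear (\<lambda>z. DG x z u w)"
  by (rule has_derivative_linear[OF G_has_derivative])

lemma DG_sym: "x \<in> S \<Longrightarrow> DG x z u w = DG x z w u"
proof -
  assume x: "x \<in> S"
  show ?thesis
    by (rule DG_unique[OF x G_has_derivative[OF x]]) (rule G_sym)
qed

lemma DG_lin2: "x \<in> S \<Longrightarrow> linear (\<lambda>u. DG x z u w)"
proof (rule linearI)
  assume x: "x \<in> S"
  show "DG x z (a + b) w = DG x z a w + DG x z b w" for a b
    by (rule DG_unique[OF x has_derivative_add[OF G_has_derivative[OF x] G_has_derivative[OF x]]])
      (simp add: G_simps)
  show "DG x z (r *\<^sub>R b) w = r *\<^sub>R DG x z b w" for r b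
    by (rule DG_unique[OF x has_derivative_scaleR_right[OF G_has_derivative[OF x]]])
      (simp add: G_simps)
qed

lemma DG_lin3: "x \<in> S \<Longrightarrow> linear (DG x z u)"
proof -
  assume x: "x \<in> S"
  have eq: "DG x z u = (\<lambda>w. DG x z w u)"
    by (rule ext) (rule DG_sym[OF x])
  show ?thesis by (subst eq) (rule DG_lin2[OF x])
qed

lemma DG_simps:
  assumes "x \<in> S"
  shows "DG x (a + b) u w = DG x a u w + DG x b u w" "DG x (a - b) u w = DG x a u w - DG x b u w"
    "DG x z (a + b) w = DG x z a w + DG x z b w" "DG x z (a - b) w = DG x z a w - DG x z b w"
    "DG x z u (a + b) = DG x z u a + DG x z u b" "DG x z u (a - b) = DG x z u a - DG x z u b"
    "DG x (c *\<^sub>R a) u w = c * DG x a u w" "DG x z (c *\<^sub>R a) w = c * DG x z a w"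
    "DG x z u (c *\<^sub>R a) = c * DG x z u a"
    "DG x 0 u w = 0" "DG x z 0 w = 0" "DG x z u 0 = 0"
proof -
  show "DG x (a + b) u w = DG x a u w + DG x b u w"
    by (rule linear_add[OF DG_lin1[OF assms]])
  show "DG x (a - b) u w = DG x a u w - DG x b u w"
    by (rule linear_diff[OF DG_lin1[OF assms]])
  show "DG x (c *\<^sub>R a) u w = c * DG x a u w"
    by (rule linear_scale[OF DG_lin1[OF assms], unfolded real_scaleR_def])
  show "DG x 0 u w = 0"
    by (rule linear_0[OF DG_lin1[OF assms]])
  show "DG x z (a + b) w = DG x z a w + DG x z b w"
    by (rule linear_add[OF DG_lin2[OF assms]])
  show "DG x z (a - b) w = DG x z a w - DG x z b w"
    by (rule linear_diff[OF DG_lin2[OF assms]])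
  show "DG x z (c *\<^sub>R a) w = c * DG x z a w"
    by (rule linear_scale[OF DG_lin2[OF assms], unfolded real_scaleR_def])
  show "DG x z 0 w = 0"
    by (rule linear_0[OF DG_lin2[OF assms]])
  show "DG x z u (a + b) = DG x z u a + DG x z u b"
    by (rule linear_add[OF DG_lin3[OF assms]])
  show "DG x z u (a - b) = DG x z u a - DG x z u b"
    by (rule linear_diff[OF DG_lin3[OF assms]])
  show "DG x z u (c *\<^sub>R a) = c * DG x z u a"
    by (rule linear_scale[OF DG_lin3[OF assms], unfolded real_scaleR_def])
  show "DG x z u 0 = 0"
    by (rule linear_0[OF DG_lin3[OF assms]])
qed

lemma DG_locally_lipschitz:
  assumes "x0 \<in> S"
  shows "\<exists>r>0. \<exists>L. L-lipschitz_on (S \<inter> ball x0 r) (\<lambda>x. DG x z u w)"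
proof -
  have "locally_lipschitz_on S (\<lambda>x. DG x z u w)"
    using C11[of u w] by (simp add: C11_on_def DG_def)
  then show ?thesis
    using assms by (simp add: locally_lipschitz_on_def)
qed

text \<open>The hypothesis gives a radius and a Lipschitz constant for each choice of vectors
  separately. By trilinearity the finitely many triples of basis vectors decide, so a common radius
  and a common constant exist.\<close>

lemma DG_uniformly_lipschitz:
  assumes x0: "x0 \<in> S"
  obtains r C where "0 < r" "0 \<le> C" "cball x0 r \<subseteq> S"
    "\<And>x y z u w. x \<in> cball x0 r \<Longrightarrow> y \<in> cball x0 r \<Longrightarrow>
      \<bar>DG x z u w - DG y z u w\<bar> \<le> C * norm (x - y) * norm z * norm u * norm w"
proof -
  define ok where "ok r = (\<lambda>(z, u, w). \<exists>L. L-lipschitz_on (S \<inter> ball x0 r) (\<lambda>x. DG x z u w))" for r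
  have ev: "eventually (\<lambda>r. ok r i) (at_right 0)" for i
  proof (cases i)
    case (fields z u w)
    obtain r L where "r > 0" and L: "L-lipschitz_on (S \<inter> ball x0 r) (\<lambda>x. DG x z u w)"
      using DG_locally_lipschitz[OF x0] by blast
    have "ok r' i" if "0 < r'" "r' < r" for r'
    proof -
      have "S \<inter> ball x0 r' \<subseteq> S \<inter> ball x0 r" using that by auto
      from lipschitz_on_subset[OF L this] show ?thesis by (auto simp: ok_def fields)
    qed
    then show ?thesis
      using \<open>r > 0\<close> by (auto simp: eventually_at_right_field)
  qed
  have "finite (Basis \<times> Basis \<times> Basis :: ('e \<times> 'e \<times> 'e) set)" by simp
  then have "eventually (\<lambda>r. \<forall>i\<in>Basis \<times> Basis \<times> Basis. ok r i) (at_right 0)"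
    using ev by (intro eventually_ball_finite) auto
  then obtain b where b: "b > 0" "\<And>r i. 0 < r \<Longrightarrow> r < b \<Longrightarrow> i \<in> Basis \<times> Basis \<times> Basis \<Longrightarrow> ok r i"
    by (auto simp: eventually_at_right_field)
  obtain e where e: "e > 0" "ball x0 e \<subseteq> S"
    using open_S x0 by (meson openE)
  define r where "r = min b e / 2"
  have r: "0 < r" "r < b" "r < e" using b e by (auto simp: r_def)
  \<comment> \<open>An intermediate radius: the Lipschitz property is available on open balls, the
    conclusion is for the smaller closed ball.\<close>
  define s where "s = min b e * 3 / 4"
  have s: "0 < s" "s < b" "s < e" "r < s" using b e by (auto simp: s_def r_def)
  have sub: "ball x0 s \<subseteq> S" using e(2) subset_ball[of s e x0] s(3) by auto
  have "\<forall>i\<in>Basis \<times> Basis \<times> Basis. \<exists>L. L-lipschitz_on (ball x0 s) (\<lambda>x. DG x (fst i) (fst (snd i)) (snd (snd i)))"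
    using b(2)[of s] s sub by (auto simp: ok_def Int_absorb1)
  then obtain L where L: "\<And>i. i \<in> Basis \<times> Basis \<times> Basis \<Longrightarrow> (L i)-lipschitz_on (ball x0 s) (\<lambda>x. DG x (fst i) (fst (snd i)) (snd (snd i)))"
    by metis
  define C where "C = (\<Sum>k\<in>Basis. \<Sum>i\<in>Basis. \<Sum>j\<in>Basis. L (k, i, j))"
  have L0: "0 \<le> L (k, i, j)" if "k \<in> Basis" "i \<in> Basis" "j \<in> Basis" for k i j
    using L[of "(k, i, j)"] that lipschitz_on_nonneg by auto
  have C: "0 \<le> C" unfolding C_def by (intro sum_nonneg L0)
  have cb: "cball x0 r \<subseteq> ball x0 s" using s by auto
  show ?thesis
  proof (rule that[OF r(1) C])
    show "cball x0 r \<subseteq> S" using cb sub by blast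
    fix x y z u w assume "x \<in> cball x0 r" "y \<in> cball x0 r"
    then have xy: "x \<in> ball x0 s" "y \<in> ball x0 s" "x \<in> S" "y \<in> S" using cb sub by auto
    have "\<bar>DG x z u w - DG y z u w\<bar>
        \<le> (\<Sum>k\<in>Basis. \<Sum>i\<in>Basis. \<Sum>j\<in>Basis. \<bar>DG x k i j - DG y k i j\<bar>) * norm z * norm u * norm w"
      by (intro trilinear_real_bound[of "\<lambda>z u w. DG x z u w - DG y z u w"] linear_compose_sub DG_lin1 DG_lin2 DG_lin3 xy)
    also have "\<dots> \<le> (\<Sum>k\<in>Basis. \<Sum>i\<in>Basis. \<Sum>j\<in>Basis. L (k, i, j) * norm (x - y)) * norm z * norm u * norm w"
      using lipschitz_onD[OF L xy(1,2)]
      by (intro mult_right_mono sum_mono) (auto simp: dist_norm)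
    also have "\<dots> = C * norm (x - y) * norm z * norm u * norm w"
      by (simp add: C_def sum_distrib_right)
    finally show "\<bar>DG x z u w - DG y z u w\<bar> \<le> C * norm (x - y) * norm z * norm u * norm w" .
  qed
qed

text \<open>This map lists the components of the covector \<open>G x u\<close>. Its injectivity is
  nondegeneracy, and in finite dimension it gives solvability of the equation that defines
  \<open>Chr\<close>.\<close>

lemma G_basis_injective:
  assumes "x \<in> S"
  shows "linear (\<lambda>u. \<Sum>j\<in>Basis. G x u j *\<^sub>R j)" "inj (\<lambda>u. \<Sum>j\<in>Basis. G x u j *\<^sub>R j)"
proof -
  show l: "linear (\<lambda>u. \<Sum>j\<in>Basis. G x u j *\<^sub>R j)"
    by (rule linearI) (simp_all add: G_simps[OF assms] scaleR_add_left sum.distrib scaleR_sum_right)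
  show "inj (\<lambda>u. \<Sum>j\<in>Basis. G x u j *\<^sub>R j)"
    unfolding linear_injective_0[OF l]
  proof (intro allI impI)
    fix u assume 0: "(\<Sum>j\<in>Basis. G x u j *\<^sub>R j) = 0"
    have "G x u i = 0" if "i \<in> Basis" for i
      using arg_cong[OF 0, of "\<lambda>v. v \<bullet> i"] that by (simp add: inner_sum_left inner_Basis if_distrib sum.delta cong: if_cong)
    then have "G x u w = 0" for w
      by (subst linear_real_expand[OF lin2[OF assms]]) simp
    then have "\<forall>w. G x u w = 0" ..
    then show "u = 0" by (rule nondeg[OF assms])
  qed
qed

lemma Chr_eq:
  assumes "x \<in> S"
  shows "G x (Chr x u v) z = (DG x u v z + DG x v u z - DG x z u v) / 2"
proof -
  define K where "K z = (DG x u v z + DG x v u z - DG x z u v) / 2" for z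
  have linK: "linear K"
    unfolding K_def by (rule linearI) (simp_all add: DG_simps[OF assms] field_simps)
  have "surj (\<lambda>u. \<Sum>j\<in>Basis. G x u j *\<^sub>R j)"
    using G_basis_injective[OF assms] linear_injective_imp_surjective by blast
  from surjD[OF this, of "\<Sum>j\<in>Basis. K j *\<^sub>R j"]
  obtain w where w: "(\<Sum>j\<in>Basis. K j *\<^sub>R j) = (\<Sum>j\<in>Basis. G x w j *\<^sub>R j)" ..
  have "K i = G x w i" if "i \<in> Basis" for i
    using arg_cong[OF w, of "\<lambda>v. v \<bullet> i"] that by (simp add: inner_sum_left inner_Basis if_distrib sum.delta cong: if_cong)
  then have wz: "G x w z = K z" for z
    by (subst linear_real_expand[OF lin2[OF assms]], subst linear_real_expand[OF linK]) simp
  have "\<exists>!w. \<forall>z. G x w z = K z"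
  proof (intro ex1I[of _ w] allI wz)
    fix w' assume "\<forall>z. G x w' z = K z"
    then have "\<forall>z. G x (w' - w) z = 0" by (simp add: wz G_simps[OF assms])
    then show "w' = w" using nondeg[OF assms, of "w' - w"] by simp
  qed
  then have "\<forall>z. G x (Chr x u v) z = K z"
    unfolding Chr_def K_def[symmetric] by (rule theI')
  then show ?thesis by (simp add: K_def)
qed

end

lemma bilinear_real_expand:
  fixes f :: "'e::euclidean_space \<Rightarrow> 'e \<Rightarrow> real"
  assumes "\<And>w. linear (\<lambda>u. f u w)" "\<And>u. linear (f u)"
  shows "f u w = (\<Sum>i\<in>Basis. \<Sum>j\<in>Basis. (u \<bullet> i) * (w \<bullet> j) * f i j)"
proof -
  have "f u w = (\<Sum>i\<in>Basis. (u \<bullet> i) * f i w)"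
    by (rule linear_real_expand[OF assms(1)])
  also have "\<dots> = (\<Sum>i\<in>Basis. \<Sum>j\<in>Basis. (u \<bullet> i) * (w \<bullet> j) * f i j)"
  proof (rule sum.cong[OF refl])
    fix i :: 'e
    have "f i w = (\<Sum>j\<in>Basis. (w \<bullet> j) * f i j)"
      by (rule linear_real_expand[OF assms(2)])
    then show "(u \<bullet> i) * f i w = (\<Sum>j\<in>Basis. (u \<bullet> i) * (w \<bullet> j) * f i j)"
      by (simp only: sum_distrib_left mult.assoc)
  qed
  finally show ?thesis .
qed

lemma abs_half_sum4_le:
  fixes a b c d :: real
  assumes "\<bar>a\<bar> \<le> A" "\<bar>b\<bar> \<le> B" "\<bar>c\<bar> \<le> C" "\<bar>d\<bar> \<le> D"
  shows "\<bar>- (a + b + c + d) / 2\<bar> \<le> (A + B + C + D) / 2"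
proof -
  have "\<bar>a + b + c + d\<bar> \<le> A + B + C + D"
    using assms[THEN abs_le_D1] assms[THEN abs_le_D2] by (intro abs_leI) linarith+
  moreover have "\<bar>- (a + b + c + d) / 2\<bar> = \<bar>a + b + c + d\<bar> / 2"
    by (simp only: abs_divide abs_minus_cancel abs_numeral)
  ultimately show ?thesis by simp
qed

lemma abs_diff3_le:
  fixes a b c :: real
  assumes "\<bar>a\<bar> \<le> A" "\<bar>b\<bar> \<le> A" "\<bar>c\<bar> \<le> C"
  shows "\<bar>a - b / 2 - c\<bar> \<le> 2 * A + C"
  using assms[THEN abs_le_D1] assms[THEN abs_le_D2] by (intro abs_leI) linarith+

section \<open>Uniform bounds for the metric and its Christoffel symbols on small balls\<close>

context C11_form
begin

text \<open>One radius and one constant for all later estimates. The first bound is quantitative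
  nondegeneracy and turns bounds for a covector into bounds for the vector; the last one is a Taylor
  remainder, quadratic because \<open>DG\<close> is Lipschitz.\<close>

definition good_ball :: "'e \<Rightarrow> real \<Rightarrow> real \<Rightarrow> bool" where
  "good_ball x0 r C \<longleftrightarrow> 0 < r \<and> 0 \<le> C \<and> cball x0 r \<subseteq> S \<and>
     (\<forall>x\<in>cball x0 r. \<forall>u. norm u \<le> C * (\<Sum>j\<in>Basis. \<bar>G x u j\<bar>)) \<and>
     (\<forall>x\<in>cball x0 r. \<forall>u w. \<bar>G x u w\<bar> \<le> C * norm u * norm w) \<and>
     (\<forall>x\<in>cball x0 r. \<forall>z u w. \<bar>DG x z u w\<bar> \<le> C * norm z * norm u * norm w) \<and>
     (\<forall>x\<in>cball x0 r. \<forall>y\<in>cball x0 r. \<forall>z u w.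
        \<bar>DG x z u w - DG y z u w\<bar> \<le> C * norm (x - y) * norm z * norm u * norm w) \<and>
     (\<forall>x\<in>cball x0 r. \<forall>y\<in>cball x0 r. \<forall>u w. \<bar>G y u w - G x u w\<bar> \<le> C * norm (y - x) * norm u * norm w) \<and>
     (\<forall>x\<in>cball x0 r. \<forall>y\<in>cball x0 r. \<forall>u w.
        \<bar>G y u w - G x u w - DG x (y - x) u w\<bar> \<le> C * (norm (y - x))\<^sup>2 * norm u * norm w)"

lemma good_ballD:
  assumes "good_ball x0 r C"
  shows "0 < r" "0 \<le> C" "cball x0 r \<subseteq> S"
    "x \<in> cball x0 r \<Longrightarrow> norm u \<le> C * (\<Sum>j\<in>Basis. \<bar>G x u j\<bar>)"
    "x \<in> cball x0 r \<Longrightarrow> \<bar>G x u w\<bar> \<le> C * norm u * norm w"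
    "x \<in> cball x0 r \<Longrightarrow> \<bar>DG x z u w\<bar> \<le> C * norm z * norm u * norm w"
    "x \<in> cball x0 r \<Longrightarrow> y \<in> cball x0 r \<Longrightarrow>
        \<bar>DG x z u w - DG y z u w\<bar> \<le> C * norm (x - y) * norm z * norm u * norm w"
    "x \<in> cball x0 r \<Longrightarrow> y \<in> cball x0 r \<Longrightarrow> \<bar>G y u w - G x u w\<bar> \<le> C * norm (y - x) * norm u * norm w"
    "x \<in> cball x0 r \<Longrightarrow> y \<in> cball x0 r \<Longrightarrow>
        \<bar>G y u w - G x u w - DG x (y - x) u w\<bar> \<le> C * (norm (y - x))\<^sup>2 * norm u * norm w"
    "x \<in> cball x0 r \<Longrightarrow> x \<in> S"
proof -
  have c1: "0 < r"
    using assms unfolding good_ball_def by (elim conjE)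
  have c2: "0 \<le> C"
    using assms unfolding good_ball_def by (elim conjE)
  have c3: "cball x0 r \<subseteq> S"
    using assms unfolding good_ball_def by (elim conjE)
  have c4: "\<forall>x\<in>cball x0 r. \<forall>u. norm u \<le> C * (\<Sum>j\<in>Basis. \<bar>G x u j\<bar>)"
    using assms unfolding good_ball_def by (elim conjE)
  have c5: "\<forall>x\<in>cball x0 r. \<forall>u w. \<bar>G x u w\<bar> \<le> C * norm u * norm w"
    using assms unfolding good_ball_def by (elim conjE)
  have c6: "\<forall>x\<in>cball x0 r. \<forall>z u w. \<bar>DG x z u w\<bar> \<le> C * norm z * norm u * norm w"
    using assms unfolding good_ball_def by (elim conjE)
  have c7: "\<forall>x\<in>cball x0 r. \<forall>y\<in>cball x0 r. \<forall>z u w. \<bar>DG x z u w - DG y z u w\<bar> \<le> C * norm (x - y) * norm z * norm u * norm w"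
    using assms unfolding good_ball_def by (elim conjE)
  have c8: "\<forall>x\<in>cball x0 r. \<forall>y\<in>cball x0 r. \<forall>u w. \<bar>G y u w - G x u w\<bar> \<le> C * norm (y - x) * norm u * norm w"
    using assms unfolding good_ball_def by (elim conjE)
  have c9: "\<forall>x\<in>cball x0 r. \<forall>y\<in>cball x0 r. \<forall>u w. \<bar>G y u w - G x u w - DG x (y - x) u w\<bar> \<le> C * (norm (y - x))\<^sup>2 * norm u * norm w"
    using assms unfolding good_ball_def by (elim conjE)
  show "0 < r"
    by (rule c1)
  show "0 \<le> C"
    by (rule c2)
  show "cball x0 r \<subseteq> S"
    by (rule c3)
  show "x \<in> cball x0 r \<Longrightarrow> norm u \<le> C * (\<Sum>j\<in>Basis. \<bar>G x u j\<bar>)"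
    by (rule c4[rule_format])
  show "x \<in> cball x0 r \<Longrightarrow> \<bar>G x u w\<bar> \<le> C * norm u * norm w"
    by (rule c5[rule_format])
  show "x \<in> cball x0 r \<Longrightarrow> \<bar>DG x z u w\<bar> \<le> C * norm z * norm u * norm w"
    by (rule c6[rule_format])
  show "x \<in> cball x0 r \<Longrightarrow> y \<in> cball x0 r \<Longrightarrow>
        \<bar>DG x z u w - DG y z u w\<bar> \<le> C * norm (x - y) * norm z * norm u * norm w"
    by (rule c7[rule_format])
  show "x \<in> cball x0 r \<Longrightarrow> y \<in> cball x0 r \<Longrightarrow> \<bar>G y u w - G x u w\<bar> \<le> C * norm (y - x) * norm u * norm w"
    by (rule c8[rule_format])
  show "x \<in> cball x0 r \<Longrightarrow> y \<in> cball x0 r \<Longrightarrow>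
        \<bar>G y u w - G x u w - DG x (y - x) u w\<bar> \<le> C * (norm (y - x))\<^sup>2 * norm u * norm w"
    by (rule c9[rule_format])
  show "x \<in> cball x0 r \<Longrightarrow> x \<in> S"
    using c3 by blast
qed

lemma good_ball_exists:
  assumes x0: "x0 \<in> S"
  obtains r C where "good_ball x0 r C"
proof -
  obtain r0 C0 where r0: "0 < r0" "0 \<le> C0" "cball x0 r0 \<subseteq> S"
    and C0: "\<And>x y z u w. x \<in> cball x0 r0 \<Longrightarrow> y \<in> cball x0 r0 \<Longrightarrow>
      \<bar>DG x z u w - DG y z u w\<bar> \<le> C0 * norm (x - y) * norm z * norm u * norm w"
    using DG_uniformly_lipschitz[OF x0] by metis
  \<comment> \<open>The bound at the centre plus the Lipschitz constant times the radius.\<close>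
  define C1 where "C1 = (\<Sum>k\<in>Basis. \<Sum>i\<in>Basis. \<Sum>j\<in>Basis. \<bar>DG x0 k i j\<bar>) + C0 * r0"
  have x0c: "x0 \<in> cball x0 r0" using r0 by simp
  have C1: "0 \<le> C1" unfolding C1_def using r0 by (intro add_nonneg_nonneg sum_nonneg mult_nonneg_nonneg) auto
  have DGb: "\<bar>DG x z u w\<bar> \<le> C1 * norm z * norm u * norm w" if x: "x \<in> cball x0 r0" for x z u w
  proof -
    have "\<bar>DG x z u w - DG x0 z u w\<bar> \<le> C0 * norm (x - x0) * norm z * norm u * norm w"
      by (rule C0[OF x x0c])
    also have "\<dots> \<le> C0 * r0 * norm z * norm u * norm w"
      using x r0 by (intro mult_right_mono mult_left_mono) (auto simp: dist_norm norm_minus_commute)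
    finally have "\<bar>DG x z u w - DG x0 z u w\<bar> \<le> C0 * r0 * norm z * norm u * norm w" .
    moreover have "\<bar>DG x0 z u w\<bar> \<le> (\<Sum>k\<in>Basis. \<Sum>i\<in>Basis. \<Sum>j\<in>Basis. \<bar>DG x0 k i j\<bar>) * norm z * norm u * norm w"
      by (rule trilinear_real_bound[of "DG x0"]) (rule DG_lin1 DG_lin2 DG_lin3, rule x0)+
    ultimately show ?thesis
      unfolding C1_def distrib_right by linarith
  qed
  have Gl: "\<bar>G y u w - G x u w\<bar> \<le> C1 * norm (y - x) * norm u * norm w"
    if x: "x \<in> cball x0 r0" and y: "y \<in> cball x0 r0" for x y u w
  proof -
    have "norm (G y u w - G x u w) \<le> (C1 * norm u * norm w) * norm (y - x)"
    proof (rule differentiable_bound[of "cball x0 r0" "\<lambda>y. G y u w" "\<lambda>y z. DG y z u w"])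
      fix a assume a: "a \<in> cball x0 r0"
      then show "((\<lambda>y. G y u w) has_derivative (\<lambda>z. DG a z u w)) (at a within cball x0 r0)"
        using r0 by (intro has_derivative_at_withinI[OF G_has_derivative]) auto
      show "onorm (\<lambda>z. DG a z u w) \<le> C1 * norm u * norm w"
      proof (rule onorm_bound)
        show "norm (DG a z u w) \<le> C1 * norm u * norm w * norm z" for z
          using DGb[OF a, of z u w] by (simp add: mult_ac)
      qed (use C1 in auto)
    qed (use x y in auto)
    then show ?thesis by (simp add: mult_ac)
  qed
  have Taylor: "\<bar>G y u w - G x u w - DG x (y - x) u w\<bar> \<le> C0 * (norm (y - x))\<^sup>2 * norm u * norm w"
    if x: "x \<in> cball x0 r0" and y: "y \<in> cball x0 r0" for x y u w
  proof -
    have seg: "closed_segment x y \<subseteq> cball x0 r0"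
      using x y by (intro closed_segment_subset) auto
    have "norm (G y u w - G x u w - DG x (y - x) u w) \<le> norm (y - x) * (C0 * norm (y - x) * norm u * norm w)"
    proof (rule differentiable_bound_linearization[of x y "closed_segment x y" "\<lambda>y. G y u w" "\<lambda>y z. DG y z u w"])
      show "x + t *\<^sub>R (y - x) \<in> closed_segment x y" if "t \<in> {0..1}" for t
        using that by (auto simp: in_segment algebra_simps intro!: exI[of _ t])
      show "((\<lambda>y. G y u w) has_derivative (\<lambda>z. DG a z u w)) (at a within closed_segment x y)"
        if "a \<in> closed_segment x y" for a
        using that seg r0 by (intro has_derivative_at_withinI[OF G_has_derivative]) auto
      show "onorm ((\<lambda>z. DG a z u w) - (\<lambda>z. DG x z u w)) \<le> C0 * norm (y - x) * norm u * norm w"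
        if a: "a \<in> closed_segment x y" for a
      proof (rule onorm_bound)
        fix z
        have "norm (a - x) \<le> norm (y - x)"
          using segment_bound1[OF a] by simp
        have "\<bar>DG a z u w - DG x z u w\<bar> \<le> C0 * norm (a - x) * norm z * norm u * norm w"
          using a seg x by (intro C0) auto
        also have "\<dots> \<le> C0 * norm (y - x) * norm z * norm u * norm w"
          using \<open>norm (a - x) \<le> norm (y - x)\<close> r0 by (intro mult_right_mono mult_left_mono) auto
        finally show "norm (((\<lambda>z. DG a z u w) - (\<lambda>z. DG x z u w)) z) \<le> C0 * norm (y - x) * norm u * norm w * norm z"
          by (simp add: mult_ac)
      qed (use r0 in auto)
    qed auto
    then show ?thesis by (simp add: power2_eq_square mult_ac)
  qed
  define C2 where "C2 = (\<Sum>i\<in>Basis. \<Sum>j\<in>Basis. \<bar>G x0 i j\<bar>) + C1 * r0"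
  have Gb: "\<bar>G x u w\<bar> \<le> C2 * norm u * norm w" if x: "x \<in> cball x0 r0" for x u w
  proof -
    have "\<bar>G x u w - G x0 u w\<bar> \<le> C1 * norm (x - x0) * norm u * norm w"
      by (rule Gl[OF x0c x])
    also have "\<dots> \<le> C1 * r0 * norm u * norm w"
      using x C1 by (intro mult_right_mono mult_left_mono) (auto simp: dist_norm norm_minus_commute)
    finally have "\<bar>G x u w - G x0 u w\<bar> \<le> C1 * r0 * norm u * norm w" .
    moreover have "\<bar>G x0 u w\<bar> \<le> (\<Sum>i\<in>Basis. \<Sum>j\<in>Basis. \<bar>G x0 i j\<bar>) * norm u * norm w"
      by (rule bilinear_real_bound[of "G x0"]) (rule lin lin2, rule x0)+
    ultimately show ?thesis
      unfolding C2_def distrib_right by linarith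
  qed
  obtain B where B: "B > 0" "\<And>u. B * norm u \<le> norm (\<Sum>j\<in>Basis. G x0 u j *\<^sub>R j)"
    using linear_inj_bounded_below_pos[OF G_basis_injective[OF x0]] by metis
  define D where "D = real DIM('e)"
  \<comment> \<open>\<open>B\<close> bounds the map of \<open>G_basis_injective\<close> from below
    at the centre. The radius is so small that moving to another point changes this map by at most
    \<open>B / 2\<close>, so half of the lower bound survives.\<close>
  define r where "r = min r0 (B / (2 * (D * C1 + 1)))"
  have D: "D \<ge> 0" by (simp add: D_def)
  have DC: "D * C1 + 1 > 0" using D C1 by (simp add: add_nonneg_pos)
  have r: "0 < r" "r \<le> r0" "D * C1 * r \<le> B / 2"
  proof -
    show "0 < r" "r \<le> r0" using r0 B DC by (auto simp: r_def)
    have "D * C1 * r \<le> (D * C1 + 1) * (B / (2 * (D * C1 + 1)))"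
      using D C1 \<open>0 < r\<close> by (intro mult_mono) (auto simp: r_def)
    also have "\<dots> = B / 2"
      using nonzero_mult_divide_mult_cancel_left[of "D * C1 + 1" B 2] DC by (simp add: mult.commute[of 2])
    finally show "D * C1 * r \<le> B / 2" .
  qed
  have nd: "norm u \<le> (2 / B) * (\<Sum>j\<in>Basis. \<bar>G x u j\<bar>)" if x: "x \<in> cball x0 r" for x u
  proof -
    have xr: "x \<in> cball x0 r0" "norm (x - x0) \<le> r" using x r by (auto simp: dist_norm norm_minus_commute)
    have "B * norm u \<le> (\<Sum>j\<in>Basis. norm (G x0 u j *\<^sub>R j))"
      using B(2)[of u] norm_sum[of "\<lambda>j. G x0 u j *\<^sub>R j" Basis] by linarith
    also have "\<dots> \<le> (\<Sum>j\<in>Basis. \<bar>G x u j\<bar> + C1 * r * norm u)"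
    proof (rule sum_mono)
      fix j :: 'e assume j: "j \<in> Basis"
      have "\<bar>G x u j - G x0 u j\<bar> \<le> C1 * norm (x - x0) * norm u * norm j"
        by (rule Gl[OF x0c xr(1)])
      also have "\<dots> \<le> C1 * r * norm u * norm j"
        using xr C1 by (intro mult_right_mono mult_left_mono) auto
      finally show "norm (G x0 u j *\<^sub>R j) \<le> \<bar>G x u j\<bar> + C1 * r * norm u"
        using j by simp
    qed
    also have "\<dots> = (\<Sum>j\<in>Basis. \<bar>G x u j\<bar>) + (D * C1 * r) * norm u"
      by (simp add: sum.distrib D_def)
    also have "\<dots> \<le> (\<Sum>j\<in>Basis. \<bar>G x u j\<bar>) + (B / 2) * norm u"
      using r(3) by (intro add_left_mono mult_right_mono) auto
    finally have "(B / 2) * norm u \<le> (\<Sum>j\<in>Basis. \<bar>G x u j\<bar>)" by linarith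
    then have "(2 / B) * ((B / 2) * norm u) \<le> (2 / B) * (\<Sum>j\<in>Basis. \<bar>G x u j\<bar>)"
      using B(1) by (intro mult_left_mono) auto
    then show ?thesis using B(1) by simp
  qed
  define C where "C = max (2 / B) (max C0 (max C1 C2))"
  have CC: "2 / B \<le> C" "C0 \<le> C" "C1 \<le> C" "C2 \<le> C" by (auto simp: C_def)
  have up: "a \<le> C * b" if "a \<le> K * b" "K \<le> C" "0 \<le> b" for a b K :: real
    using mult_right_mono[OF that(2,3)] that(1) by linarith
  have sub: "x \<in> cball x0 r0" if "x \<in> cball x0 r" for x using that r by auto
  have "good_ball x0 r C"
    unfolding good_ball_def
  proof (intro conjI ballI allI)
    show "0 < r" by (rule r)
    show "0 \<le> C" using CC(2) r0(2) by linarith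
    show "cball x0 r \<subseteq> S" using r0(3) sub by blast
    fix x u assume x: "x \<in> cball x0 r"
    show "norm u \<le> C * (\<Sum>j\<in>Basis. \<bar>G x u j\<bar>)"
      by (rule up[OF nd[OF x] CC(1)]) (simp add: sum_nonneg)
    fix w
    show "\<bar>G x u w\<bar> \<le> C * norm u * norm w"
      using up[OF _ CC(4), of _ "norm u * norm w"] Gb[OF sub[OF x], of u w] by (simp add: mult_ac)
  next
    fix x z u w assume x: "x \<in> cball x0 r"
    show "\<bar>DG x z u w\<bar> \<le> C * norm z * norm u * norm w"
      using up[OF _ CC(3), of _ "norm z * norm u * norm w"] DGb[OF sub[OF x], of z u w] by (simp add: mult_ac)
  next
    fix x y z u w assume x: "x \<in> cball x0 r" and y: "y \<in> cball x0 r"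
    show "\<bar>DG x z u w - DG y z u w\<bar> \<le> C * norm (x - y) * norm z * norm u * norm w"
      using up[OF _ CC(2), of _ "norm (x - y) * norm z * norm u * norm w"] C0[OF sub[OF x] sub[OF y], of z u w] by (simp add: mult_ac)
  next
    fix x y u w assume x: "x \<in> cball x0 r" and y: "y \<in> cball x0 r"
    show "\<bar>G y u w - G x u w\<bar> \<le> C * norm (y - x) * norm u * norm w"
      using up[OF _ CC(3), of _ "norm (y - x) * norm u * norm w"] Gl[OF sub[OF x] sub[OF y], of u w] by (simp add: mult_ac)
    show "\<bar>G y u w - G x u w - DG x (y - x) u w\<bar> \<le> C * (norm (y - x))\<^sup>2 * norm u * norm w"
      using up[OF _ CC(2), of _ "(norm (y - x))\<^sup>2 * norm u * norm w"] Taylor[OF sub[OF x] sub[OF y], of u w] by (simp add: mult_ac)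
  qed
  then show ?thesis by (rule that)
qed

lemma Chr_diag: "x \<in> S \<Longrightarrow> G x (Chr x u u) z = DG x u u z - DG x z u u / 2"
  by (simp add: Chr_eq)

lemma Chr_bound:
  assumes gb: "good_ball x0 r C" and x: "x \<in> cball x0 r"
  shows "norm (Chr x u u) \<le> C * (real DIM('e) * (2 * C)) * (norm u)\<^sup>2"
proof -
  have C: "0 \<le> C" using good_ballD(2)[OF gb] .
  have xS: "x \<in> S" using good_ballD(10)[OF gb x] .
  have 1: "norm (Chr x u u) \<le> C * (\<Sum>j\<in>Basis. \<bar>G x (Chr x u u) j\<bar>)"
    by (rule good_ballD(4)[OF gb x])
  have 2: "(\<Sum>j\<in>Basis. \<bar>G x (Chr x u u) j\<bar>) \<le> (\<Sum>j\<in>(Basis::'e set). 2 * C * (norm u)\<^sup>2)"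
  proof (rule sum_mono)
    fix j :: 'e assume j: "j \<in> Basis"
    have "\<bar>DG x u u j\<bar> \<le> C * norm u * norm u * norm j" "\<bar>DG x j u u\<bar> \<le> C * norm j * norm u * norm u"
      by (rule good_ballD(6)[OF gb x])+
    then have "\<bar>DG x u u j\<bar> \<le> C * (norm u)\<^sup>2" "\<bar>DG x j u u\<bar> \<le> C * (norm u)\<^sup>2"
      using j by (simp_all add: power2_eq_square mult.assoc)
    then show "\<bar>G x (Chr x u u) j\<bar> \<le> 2 * C * (norm u)\<^sup>2"
      unfolding Chr_diag[OF xS] by linarith
  qed
  show ?thesis using order.trans[OF 1 mult_left_mono[OF 2 C]] by (simp add: mult_ac)
qed

text \<open>The base point and the three vectors are exchanged one at a time.\<close>

lemma DG_difference:
  assumes gb: "good_ball x0 r C" and xy: "x \<in> cball x0 r" "y \<in> cball x0 r"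
    and M: "norm a \<le> M" "norm b \<le> M" "norm c \<le> M" "norm a' \<le> M" "norm b' \<le> M" "norm c' \<le> M"
  shows "\<bar>DG x a b c - DG y a' b' c'\<bar> \<le> C * M^3 * norm (x - y)
     + C * M\<^sup>2 * (norm (a - a') + norm (b - b') + norm (c - c'))"
proof -
  have C: "0 \<le> C" using good_ballD(2)[OF gb] .
  have M0: "0 \<le> M" using M(1) norm_ge_zero[of a] by linarith
  have yS: "y \<in> S" using good_ballD(10)[OF gb xy(2)] .
  have "DG x a b c - DG y a' b' c'
      = (DG x a b c - DG y a b c) + DG y (a - a') b c + DG y a' (b - b') c + DG y a' b' (c - c')"
    by (simp add: DG_simps[OF yS])
  moreover have "\<bar>DG x a b c - DG y a b c\<bar> \<le> C * M^3 * norm (x - y)"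
  proof -
    have "\<bar>DG x a b c - DG y a b c\<bar> \<le> C * norm (x - y) * norm a * norm b * norm c"
      by (rule good_ballD(7)[OF gb xy])
    also have "\<dots> \<le> C * norm (x - y) * M * M * M"
      using C M M0 by (intro mult_mono mult_nonneg_nonneg) auto
    finally show ?thesis by (simp add: power3_eq_cube mult_ac)
  qed
  moreover have "\<bar>DG y (a - a') b c\<bar> \<le> C * M\<^sup>2 * norm (a - a')"
  proof -
    have "\<bar>DG y (a - a') b c\<bar> \<le> C * norm (a - a') * norm b * norm c"
      by (rule good_ballD(6)[OF gb xy(2)])
    also have "\<dots> \<le> C * norm (a - a') * M * M"
      using C M M0 by (intro mult_mono mult_nonneg_nonneg) auto
    finally show ?thesis by (simp add: power2_eq_square mult_ac)
  qed
  moreover have "\<bar>DG y a' (b - b') c\<bar> \<le> C * M\<^sup>2 * norm (b - b')"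
  proof -
    have "\<bar>DG y a' (b - b') c\<bar> \<le> C * norm a' * norm (b - b') * norm c"
      by (rule good_ballD(6)[OF gb xy(2)])
    also have "\<dots> \<le> C * M * norm (b - b') * M"
      using C M M0 by (intro mult_mono mult_nonneg_nonneg) auto
    finally show ?thesis by (simp add: power2_eq_square mult_ac)
  qed
  moreover have "\<bar>DG y a' b' (c - c')\<bar> \<le> C * M\<^sup>2 * norm (c - c')"
  proof -
    have "\<bar>DG y a' b' (c - c')\<bar> \<le> C * norm a' * norm b' * norm (c - c')"
      by (rule good_ballD(6)[OF gb xy(2)])
    also have "\<dots> \<le> C * M * M * norm (c - c')"
      using C M M0 by (intro mult_mono mult_nonneg_nonneg) auto
    finally show ?thesis by (simp add: power2_eq_square mult_ac)
  qed
  ultimately show ?thesis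
    unfolding distrib_left by linarith
qed

text \<open>Makes the right side of the geodesic equation Lipschitz in position and velocity for
  bounded velocities. By nondegeneracy it is enough to estimate the difference with its index
  lowered at \<open>x\<close>.\<close>

lemma Chr_lipschitz:
  assumes gb: "good_ball x0 r C"
  obtains L where "0 \<le> L"
    "\<And>x y u v :: 'e. x \<in> cball x0 r \<Longrightarrow> y \<in> cball x0 r \<Longrightarrow> norm u \<le> M \<Longrightarrow> norm v \<le> M \<Longrightarrow>
      norm (Chr x u u - Chr y v v) \<le> L * (norm (x - y) + norm (u - v))"
proof -
  have C: "0 \<le> C" using good_ballD(2)[OF gb] .
  \<comment> \<open>The basis vectors that are used as test vectors have norm 1 and should obey the
    same bound as \<open>u\<close> and \<open>v\<close>.\<close>
  define M' where "M' = max M 1"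
  define D where "D = real DIM('e)"
  define A where "A = 2 * (C * M'^3 + 2 * (C * M'\<^sup>2)) + C * (C * (D * (2 * C)) * M'\<^sup>2)"
  have M': "M \<le> M'" "1 \<le> M'" by (auto simp: M'_def)
  have D: "0 \<le> D" by (simp add: D_def)
  have A: "0 \<le> A" unfolding A_def using C M' D by (intro add_nonneg_nonneg mult_nonneg_nonneg zero_le_power) auto
  show ?thesis
  proof (rule that[of "C * (D * A)"])
    show "0 \<le> C * (D * A)" using C D A by simp
    fix x y u v :: 'e assume x: "x \<in> cball x0 r" and y: "y \<in> cball x0 r" and u: "norm u \<le> M" and v: "norm v \<le> M"
    define e where "e = norm (x - y) + norm (u - v)"
    have e: "norm (x - y) \<le> e" "norm (u - v) \<le> e" "0 \<le> e" by (auto simp: e_def)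
    have xS: "x \<in> S" and yS: "y \<in> S" using good_ballD(10)[OF gb] x y by auto
    have 1: "norm (Chr x u u - Chr y v v) \<le> C * (\<Sum>j\<in>Basis. \<bar>G x (Chr x u u - Chr y v v) j\<bar>)"
      by (rule good_ballD(4)[OF gb x])
    have 2: "(\<Sum>j\<in>Basis. \<bar>G x (Chr x u u - Chr y v v) j\<bar>) \<le> (\<Sum>j\<in>(Basis::'e set). A * e)"
    proof (rule sum_mono)
      fix j :: 'e assume j: "j \<in> Basis"
      have nj: "norm j \<le> M'" "norm u \<le> M'" "norm v \<le> M'" "norm j = 1" using j M' u v by auto
      have k: "C * M'^3 * norm (x - y) + C * M'\<^sup>2 * s \<le> (C * M'^3 + 2 * (C * M'\<^sup>2)) * e"
        if "s \<le> 2 * e" for s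
      proof -
        have "C * M'^3 * norm (x - y) \<le> C * M'^3 * e"
          using C M' e by (intro mult_left_mono mult_nonneg_nonneg) auto
        moreover have "C * M'\<^sup>2 * s \<le> C * M'\<^sup>2 * (2 * e)"
          using C that by (intro mult_left_mono mult_nonneg_nonneg) auto
        ultimately show ?thesis by (simp add: algebra_simps)
      qed
      have 1: "\<bar>DG x u u j - DG y v v j\<bar> \<le> (C * M'^3 + 2 * (C * M'\<^sup>2)) * e"
        by (rule order.trans[OF DG_difference[OF gb x y, of u M' u j v v j] k]) (use nj e in auto)
      have 2: "\<bar>DG x j u u - DG y j v v\<bar> \<le> (C * M'^3 + 2 * (C * M'\<^sup>2)) * e"
        by (rule order.trans[OF DG_difference[OF gb x y, of j M' u u j v v] k]) (use nj e in auto)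
      \<comment> \<open>\<open>Chr y v v\<close> is characterised through the metric at
        \<open>y\<close>; this term is the cost of lowering its index with the metric at
        \<open>x\<close>.\<close>
      have "\<bar>G x (Chr y v v) j - G y (Chr y v v) j\<bar> \<le> C * norm (x - y) * norm (Chr y v v) * norm j"
        by (rule good_ballD(8)[OF gb y x])
      also have "\<dots> \<le> C * e * (C * (D * (2 * C)) * M'\<^sup>2) * 1"
      proof (intro mult_mono mult_nonneg_nonneg)
        have "norm (Chr y v v) \<le> C * (D * (2 * C)) * (norm v)\<^sup>2"
          unfolding D_def by (rule Chr_bound[OF gb y])
        also have "\<dots> \<le> C * (D * (2 * C)) * M'\<^sup>2"
          using C D nj by (intro mult_left_mono power_mono mult_nonneg_nonneg) auto
        finally show "norm (Chr y v v) \<le> C * (D * (2 * C)) * M'\<^sup>2" .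
      qed (use C D e nj in auto)
      finally have 3: "\<bar>G x (Chr y v v) j - G y (Chr y v v) j\<bar> \<le> (C * (C * (D * (2 * C)) * M'\<^sup>2)) * e"
        by (simp add: mult_ac)
      have "G x (Chr x u u - Chr y v v) j = (DG x u u j - DG y v v j) - (DG x j u u - DG y j v v) / 2
          - (G x (Chr y v v) j - G y (Chr y v v) j)"
        unfolding G_simps(2)[OF xS] Chr_diag[OF xS] Chr_diag[OF yS] by (simp add: field_simps)
      then have "\<bar>G x (Chr x u u - Chr y v v) j\<bar> \<le> 2 * ((C * M'^3 + 2 * (C * M'\<^sup>2)) * e) + (C * (C * (D * (2 * C)) * M'\<^sup>2)) * e"
        using abs_diff3_le[OF 1 2 3] by (simp only:)
      then show "\<bar>G x (Chr x u u - Chr y v v) j\<bar> \<le> A * e"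
        by (simp only: A_def distrib_right mult.assoc)
    qed
    show "norm (Chr x u u - Chr y v v) \<le> C * (D * A) * (norm (x - y) + norm (u - v))"
      using order.trans[OF 1 mult_left_mono[OF 2 C]] by (simp add: e_def D_def mult_ac)
  qed
qed

section \<open>The geodesic equation in coordinates: energy and first variation\<close>

lemma G_curve_derivative:
  assumes t: "t \<in> J" and xS: "\<And>s. s \<in> J \<Longrightarrow> x s \<in> S"
    and x: "(x has_vector_derivative x') (at t within J)"
    and u: "(u has_vector_derivative u') (at t within J)"
    and w: "(w has_vector_derivative w') (at t within J)"
  shows "((\<lambda>s. G (x s) (u s) (w s)) has_real_derivative
     DG (x t) x' (u t) (w t) + G (x t) u' (w t) + G (x t) (u t) w') (at t within J)"
proof -
  have S: "x t \<in> S" by (rule xS[OF t])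
  have du: "((\<lambda>s. u s \<bullet> i) has_real_derivative u' \<bullet> i) (at t within J)" for i
    using bounded_linear.has_vector_derivative[OF bounded_linear_inner_left u]
    by (simp add: has_real_derivative_iff_has_vector_derivative)
  have dw: "((\<lambda>s. w s \<bullet> i) has_real_derivative w' \<bullet> i) (at t within J)" for i
    using bounded_linear.has_vector_derivative[OF bounded_linear_inner_left w]
    by (simp add: has_real_derivative_iff_has_vector_derivative)
  have dG: "((\<lambda>s. G (x s) i j) has_real_derivative DG (x t) x' i j) (at t within J)" for i j
  proof -
    have "((\<lambda>s. G (x s) i j) has_derivative (\<lambda>h. DG (x t) (h *\<^sub>R x') i j)) (at t within J)"
      using x unfolding has_vector_derivative_def
      by (rule has_derivative_compose[where f = x and g = "\<lambda>y. G y i j", OF _ G_has_derivative[OF S, of i j]])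
    then show ?thesis
      unfolding has_field_derivative_def by (simp add: DG_simps[OF S] mult_commute_abs)
  qed
  \<comment> \<open>Expansion in the basis reduces the claim to the product rule for real functions,
    where the metric occurs only through coefficients with fixed vectors.\<close>
  have summand: "((\<lambda>s. (u s \<bullet> i) * (w s \<bullet> j) * G (x s) i j) has_real_derivative
      (u t \<bullet> i) * (w t \<bullet> j) * DG (x t) x' i j + (u' \<bullet> i) * (w t \<bullet> j) * G (x t) i j
        + (u t \<bullet> i) * (w' \<bullet> j) * G (x t) i j) (at t within J)" for i j
    by (rule DERIV_cong[OF DERIV_mult[OF DERIV_mult[OF du dw] dG]]) (simp add: algebra_simps)
  have "((\<lambda>s. \<Sum>i\<in>Basis. \<Sum>j\<in>Basis. (u s \<bullet> i) * (w s \<bullet> j) * G (x s) i j) has_real_derivative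
      (\<Sum>i\<in>Basis. \<Sum>j\<in>Basis. (u t \<bullet> i) * (w t \<bullet> j) * DG (x t) x' i j + (u' \<bullet> i) * (w t \<bullet> j) * G (x t) i j
        + (u t \<bullet> i) * (w' \<bullet> j) * G (x t) i j)) (at t within J)"
    by (intro DERIV_sum summand)
  moreover have "(\<Sum>i\<in>Basis. \<Sum>j\<in>Basis. (u t \<bullet> i) * (w t \<bullet> j) * DG (x t) x' i j + (u' \<bullet> i) * (w t \<bullet> j) * G (x t) i j
        + (u t \<bullet> i) * (w' \<bullet> j) * G (x t) i j)
      = DG (x t) x' (u t) (w t) + G (x t) u' (w t) + G (x t) (u t) w'"
    unfolding sum.distrib
    by (simp only: bilinear_real_expand[of "DG (x t) x'", OF DG_lin2[OF S] DG_lin3[OF S], symmetric]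
        bilinear_real_expand[of "G (x t)", OF lin[OF S] lin2[OF S], symmetric])
  ultimately have D: "((\<lambda>s. \<Sum>i\<in>Basis. \<Sum>j\<in>Basis. (u s \<bullet> i) * (w s \<bullet> j) * G (x s) i j) has_real_derivative
      DG (x t) x' (u t) (w t) + G (x t) u' (w t) + G (x t) (u t) w') (at t within J)"
    by simp
  have eq: "(\<Sum>i\<in>Basis. \<Sum>j\<in>Basis. (u s \<bullet> i) * (w s \<bullet> j) * G (x s) i j) = G (x s) (u s) (w s)" if "s \<in> J" for s
    by (rule bilinear_real_expand[of "G (x s)", OF lin[OF xS[OF that]] lin2[OF xS[OF that]], symmetric])
  show ?thesis
    by (rule has_field_derivative_transform_within[OF D zero_less_one t]) (rule eq)
qed

definition geodesic_coords :: "real set \<Rightarrow> (real \<Rightarrow> 'e) \<Rightarrow> (real \<Rightarrow> 'e) \<Rightarrow> bool" where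
  "geodesic_coords J x u \<longleftrightarrow> (\<forall>t\<in>J. x t \<in> S \<and> (x has_vector_derivative u t) (at t within J) \<and>
     (u has_vector_derivative - Chr (x t) (u t) (u t)) (at t within J))"

text \<open>Differentiating gives \<open>DG\<close> in the direction of the velocity minus twice the
  Christoffel term, which by the Koszul formula is one half of the same \<open>DG\<close>.\<close>

lemma geodesic_energy_constant:
  assumes "geodesic_coords {a..b} x u" "s \<in> {a..b}" "t \<in> {a..b}"
  shows "G (x s) (u s) (u s) = G (x t) (u t) (u t)"
proof -
  have "((\<lambda>s. G (x s) (u s) (u s)) has_real_derivative 0) (at r within {a..b})" if r: "r \<in> {a..b}" for r
  proof -
    have S: "x r \<in> S" using assms(1) r by (simp add: geodesic_coords_def)
    have "((\<lambda>s. G (x s) (u s) (u s)) has_real_derivative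
       DG (x r) (u r) (u r) (u r) + G (x r) (- Chr (x r) (u r) (u r)) (u r) + G (x r) (u r) (- Chr (x r) (u r) (u r))) (at r within {a..b})"
      using assms(1) r by (intro G_curve_derivative) (auto simp: geodesic_coords_def)
    then show ?thesis
      by (rule DERIV_cong) (simp add: G_simps[OF S] G_sym[OF S, of "u r" "Chr (x r) (u r) (u r)"] Chr_diag[OF S])
  qed
  then have "\<exists>c. \<forall>r\<in>{a..b}. G (x r) (u r) (u r) = c"
    by (intro has_field_derivative_zero_constant) auto
  with assms show ?thesis by metis
qed

text \<open>The first two terms are the derivative of \<open>G x u (y - x)\<close> along a geodesic
  with velocity \<open>u\<close>, the rest is half the difference of the energies. Expanding around
  \<open>(x, u)\<close> cancels everything linear in \<open>y - x\<close> and \<open>v - u\<close>;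
  what remains is the Taylor remainder of the metric and products of two differences.\<close>

lemma first_variation_algebra:
  assumes gb: "good_ball x0 r C" and x: "x \<in> cball x0 r" and y: "y \<in> cball x0 r" and M: "norm u \<le> M" "norm v \<le> M"
  shows "\<bar>DG x (y - x) u u / 2 + G x u (v - u) - (G y v v - G x u u) / 2\<bar> \<le> C / 2 * (M * norm (y - x) + norm (v - u))\<^sup>2"
proof -
  define d e where "d = y - x" and "e = v - u"
  have C: "0 \<le> C" using good_ballD(2)[OF gb] .
  have M0: "0 \<le> M" using M(1) norm_ge_zero[of u] by linarith
  have S: "x \<in> S" using good_ballD(10)[OF gb x] .
  have v: "v = u + e" by (simp add: e_def)
  have "\<bar>G y v v - G x v v - DG x d v v\<bar> \<le> C * (norm d)\<^sup>2 * norm v * norm v"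
    unfolding d_def by (rule good_ballD(9)[OF gb x y])
  also have "\<dots> \<le> C * (norm d)\<^sup>2 * M * M"
    using C M M0 by (intro mult_mono mult_nonneg_nonneg) auto
  finally have R: "\<bar>G y v v - G x v v - DG x d v v\<bar> \<le> C * (norm d)\<^sup>2 * M * M" .
  have "\<bar>DG x d e u\<bar> \<le> C * norm d * norm e * norm u" by (rule good_ballD(6)[OF gb x])
  also have "\<dots> \<le> C * norm d * norm e * M" using C M by (intro mult_left_mono mult_nonneg_nonneg) auto
  finally have R2: "\<bar>DG x d e u\<bar> \<le> C * norm d * norm e * M" .
  have "\<bar>DG x d v e\<bar> \<le> C * norm d * norm v * norm e" by (rule good_ballD(6)[OF gb x])
  also have "\<dots> \<le> C * norm d * M * norm e" using C M by (intro mult_left_mono mult_right_mono mult_nonneg_nonneg) auto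
  finally have R3: "\<bar>DG x d v e\<bar> \<le> C * norm d * M * norm e" .
  have R4: "\<bar>G x e e\<bar> \<le> C * norm e * norm e" by (rule good_ballD(5)[OF gb x])
  have "G x v v - G x u u = 2 * G x u e + G x e e"
    unfolding v by (simp add: G_simps[OF S] G_sym[OF S, of e u])
  moreover have "DG x d v v = DG x d u u + DG x d e u + DG x d v e"
    unfolding v by (simp add: DG_simps[OF S])
  ultimately have eq: "DG x d u u / 2 + G x u e - (G y v v - G x u u) / 2
      = - ((G y v v - G x v v - DG x d v v) + DG x d e u + DG x d v e + G x e e) / 2"
    by (simp add: field_simps)
  have "\<bar>DG x d u u / 2 + G x u e - (G y v v - G x u u) / 2\<bar>
      \<le> (C * (norm d)\<^sup>2 * M * M + C * norm d * norm e * M + C * norm d * M * norm e + C * norm e * norm e) / 2"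
    unfolding eq by (rule abs_half_sum4_le[OF R R2 R3 R4])
  also have "\<dots> = C / 2 * (M * norm d + norm e)\<^sup>2"
    by (simp add: power2_eq_square field_simps)
  finally show ?thesis by (simp add: d_def e_def)
qed

end

lemma vector_derivative_norm_bound:
  fixes f :: "real \<Rightarrow> 'b::real_normed_vector"
  assumes f: "\<And>t. t \<in> {a..b} \<Longrightarrow> (f has_vector_derivative f' t) (at t within {a..b})"
    and B: "\<And>t. t \<in> {a..b} \<Longrightarrow> norm (f' t) \<le> B" and st: "s \<in> {a..b}" "t \<in> {a..b}"
  shows "norm (f t - f s) \<le> B * \<bar>t - s\<bar>"
proof -
  have "norm (f t - f s) \<le> B * norm (t - s)"
  proof (rule differentiable_bound[of "{a..b}" f "\<lambda>t h. h *\<^sub>R f' t"])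
    show "(f has_derivative (\<lambda>h. h *\<^sub>R f' t)) (at t within {a..b})" if "t \<in> {a..b}" for t
      using f[OF that] by (simp add: has_vector_derivative_def)
    show "onorm (\<lambda>h. h *\<^sub>R f' t) \<le> B" if t: "t \<in> {a..b}" for t
    proof (rule onorm_bound)
      show "0 \<le> B" using B[OF t] norm_ge_zero[of "f' t"] by linarith
      show "norm (h *\<^sub>R f' t) \<le> B * norm h" for h
        using mult_right_mono[OF B[OF t], of "\<bar>h\<bar>"] by (simp add: mult.commute)
    qed
  qed (use st in auto)
  then show ?thesis by simp
qed

lemma norm_triangle_le_diff3:
  fixes p q z :: "'b::real_normed_vector"
  shows "norm z \<le> norm (p - q - z) + norm p + norm q"
proof -
  have "norm (p - q - (p - q - z)) \<le> norm (p - q) + norm (p - q - z)"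
    by (rule norm_triangle_ineq4)
  moreover have "norm (p - q) \<le> norm p + norm q"
    by (rule norm_triangle_ineq4)
  ultimately show ?thesis by simp
qed

section \<open>Comparison of neighbouring geodesics\<close>

context C11_form
begin

text \<open>Confines position and velocity to a region where the right side of the geodesic equation
  is Lipschitz.\<close>

definition slow_geodesic :: "real set \<Rightarrow> 'e \<Rightarrow> real \<Rightarrow> real \<Rightarrow> (real \<Rightarrow> 'e) \<Rightarrow> (real \<Rightarrow> 'e) \<Rightarrow> bool" where
  "slow_geodesic J x0 r M x u \<longleftrightarrow> geodesic_coords J x u \<and> (\<forall>t\<in>J. x t \<in> cball x0 r \<and> norm (u t) \<le> M)"

lemma slow_geodesicD:
  assumes "slow_geodesic J x0 r M x u" "t \<in> J"
  shows "x t \<in> S" "(x has_vector_derivative u t) (at t within J)"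
    "(u has_vector_derivative - Chr (x t) (u t) (u t)) (at t within J)" "x t \<in> cball x0 r" "norm (u t) \<le> M"
  using assms unfolding slow_geodesic_def geodesic_coords_def by blast+

lemma slow_geodesic_velocity_max:
  assumes xu: "slow_geodesic {a..b} x0 r M x u" and yv: "slow_geodesic {a..b} x0 r M y v" and "a \<le> b"
  shows "\<exists>t\<in>{a..b}. \<forall>s\<in>{a..b}. norm (u s - v s) \<le> norm (u t - v t)"
proof (rule continuous_attains_sup)
  have "continuous_on {a..b} u" "continuous_on {a..b} v"
    by (rule continuous_on_vector_derivative, rule slow_geodesicD(3)[OF xu], assumption)
      (rule continuous_on_vector_derivative, rule slow_geodesicD(3)[OF yv], assumption)
  then show "continuous_on {a..b} (\<lambda>s. norm (u s - v s))"
    by (intro continuous_intros)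
qed (use \<open>a \<le> b\<close> in auto)

lemma slow_geodesic_acceleration:
  assumes L: "0 \<le> L" "\<And>x y u v :: 'e. x \<in> cball x0 r \<Longrightarrow> y \<in> cball x0 r \<Longrightarrow> norm u \<le> M \<Longrightarrow> norm v \<le> M \<Longrightarrow>
      norm (Chr x u u - Chr y v v) \<le> L * (norm (x - y) + norm (u - v))"
    and xu: "slow_geodesic {a..b} x0 r M x u" and yv: "slow_geodesic {a..b} x0 r M y v"
    and e: "\<And>t. t \<in> {a..b} \<Longrightarrow> norm (x t - y t) \<le> e" and m: "\<And>t. t \<in> {a..b} \<Longrightarrow> norm (u t - v t) \<le> m"
    and st: "s \<in> {a..b}" "t \<in> {a..b}"
  shows "norm ((u t - v t) - (u s - v s)) \<le> (L * (e + m)) * \<bar>t - s\<bar>"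
proof (rule vector_derivative_norm_bound[of a b "\<lambda>t. u t - v t" "\<lambda>t. - Chr (x t) (u t) (u t) - - Chr (y t) (v t) (v t)"])
  fix t assume t: "t \<in> {a..b}"
  show "((\<lambda>t. u t - v t) has_vector_derivative - Chr (x t) (u t) (u t) - - Chr (y t) (v t) (v t)) (at t within {a..b})"
    by (intro has_vector_derivative_diff slow_geodesicD(3)[OF xu t] slow_geodesicD(3)[OF yv t])
  have "norm (- Chr (x t) (u t) (u t) - - Chr (y t) (v t) (v t)) = norm (Chr (x t) (u t) (u t) - Chr (y t) (v t) (v t))"
    by (simp add: norm_minus_commute)
  also have "\<dots> \<le> L * (norm (x t - y t) + norm (u t - v t))"
    by (intro L slow_geodesicD[OF xu t] slow_geodesicD[OF yv t])
  also have "\<dots> \<le> L * (e + m)"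
    using e[OF t] m[OF t] L(1) by (intro mult_left_mono add_mono) auto
  finally show "norm (- Chr (x t) (u t) (u t) - - Chr (y t) (v t) (v t)) \<le> L * (e + m)" .
qed (use st in auto)

text \<open>On a short interval the geodesic equation contracts differences: if \<open>m\<close> is
  the largest difference of velocities, the positions differ by at most \<open>m\<close>, and then
  the velocities by at most \<open>m / 2\<close>. Hence \<open>m\<close> is 0. The admissible length
  does not depend on the geodesics.\<close>

lemma geodesic_coords_unique:
  assumes gb: "good_ball x0 r C"
  obtains h where "0 < h"
    "\<And>a b x u y v s t. b - a \<le> h \<Longrightarrow> slow_geodesic {a..b} x0 r M x u \<Longrightarrow> slow_geodesic {a..b} x0 r M y v \<Longrightarrow>
      s \<in> {a..b} \<Longrightarrow> x s = y s \<Longrightarrow> u s = v s \<Longrightarrow> t \<in> {a..b} \<Longrightarrow> x t = y t \<and> u t = v t"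
proof -
  obtain L where L: "0 \<le> L"
    "\<And>x y u v :: 'e. x \<in> cball x0 r \<Longrightarrow> y \<in> cball x0 r \<Longrightarrow> norm u \<le> M \<Longrightarrow> norm v \<le> M \<Longrightarrow>
      norm (Chr x u u - Chr y v v) \<le> L * (norm (x - y) + norm (u - v))"
    using Chr_lipschitz[OF gb, of M] by metis
  \<comment> \<open>Small enough for two uses: \<open>h\<close> at most 1 bounds positions by
    \<open>m\<close>, and \<open>L * h\<close> at most 1/4 halves the difference of
    velocities.\<close>
  define h where "h = 1 / (4 * (L + 1))"
  have h: "0 < h" "h \<le> 1" "L * h \<le> 1 / 4"
    using L(1) by (auto simp: h_def field_simps)
  show ?thesis
  proof (rule that[OF h(1)])
    fix a b s t :: real and x u y v :: "real \<Rightarrow> 'e"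
    assume ab: "b - a \<le> h" and xu: "slow_geodesic {a..b} x0 r M x u" and yv: "slow_geodesic {a..b} x0 r M y v"
      and s: "s \<in> {a..b}" and eq: "x s = y s" "u s = v s" and t: "t \<in> {a..b}"
    have "a \<le> b" using s by simp
    from slow_geodesic_velocity_max[OF xu yv this]
    obtain t0 where t0: "t0 \<in> {a..b}" "\<And>s. s \<in> {a..b} \<Longrightarrow> norm (u s - v s) \<le> norm (u t0 - v t0)"
      by blast
    define m where "m = norm (u t0 - v t0)"
    have m: "0 \<le> m" by (simp add: m_def)
    have pos: "norm (x \<tau> - y \<tau>) \<le> m" if \<tau>: "\<tau> \<in> {a..b}" for \<tau>
    proof -
      have "norm ((x \<tau> - y \<tau>) - (x s - y s)) \<le> m * \<bar>\<tau> - s\<bar>"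
        by (rule vector_derivative_norm_bound[of a b "\<lambda>t. x t - y t" "\<lambda>t. u t - v t"])
          (use slow_geodesicD(2)[OF xu] slow_geodesicD(2)[OF yv] t0(2) \<tau> s in \<open>auto simp: m_def intro!: has_vector_derivative_diff\<close>)
      also have "\<dots> \<le> m * 1"
        using \<tau> s ab h m by (intro mult_left_mono) auto
      finally show ?thesis using eq by simp
    qed
    have vel: "norm (u \<tau> - v \<tau>) \<le> m / 2" if \<tau>: "\<tau> \<in> {a..b}" for \<tau>
    proof -
      have "norm ((u \<tau> - v \<tau>) - (u s - v s)) \<le> (L * (m + m)) * \<bar>\<tau> - s\<bar>"
        by (rule slow_geodesic_acceleration[OF L xu yv pos _ s \<tau>]) (use t0(2) in \<open>auto simp: m_def\<close>)
      also have "\<dots> \<le> (L * (m + m)) * h"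
        using \<tau> s ab L(1) m by (intro mult_left_mono) auto
      also have "\<dots> = 2 * m * (L * h)" by simp
      also have "\<dots> \<le> 2 * m * (1 / 4)" using h m by (intro mult_left_mono) auto
      finally show ?thesis using eq by simp
    qed
    from vel[OF t0(1)] have "m = 0" using m by (simp add: m_def[symmetric])
    with pos[OF t] vel[OF t] show "x t = y t \<and> u t = v t" by simp
  qed
qed

text \<open>Interpolation: positions close on a whole interval and a bound for the second derivative force
  the velocities to be close.\<close>

lemma geodesic_velocity_estimate:
  assumes gb: "good_ball x0 r C"
  obtains h where "0 < h"
    "\<And>a b x u y v e t. a < b \<Longrightarrow> b - a \<le> h \<Longrightarrow> slow_geodesic {a..b} x0 r M x u \<Longrightarrow> slow_geodesic {a..b} x0 r M y v \<Longrightarrow>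
      (\<And>s. s \<in> {a..b} \<Longrightarrow> norm (x s - y s) \<le> e) \<Longrightarrow> t \<in> {a..b} \<Longrightarrow> norm (u t - v t) \<le> (4 / (b - a) + 1) * e"
proof -
  obtain L where L: "0 \<le> L"
    "\<And>x y u v :: 'e. x \<in> cball x0 r \<Longrightarrow> y \<in> cball x0 r \<Longrightarrow> norm u \<le> M \<Longrightarrow> norm v \<le> M \<Longrightarrow>
      norm (Chr x u u - Chr y v v) \<le> L * (norm (x - y) + norm (u - v))"
    using Chr_lipschitz[OF gb, of M] by metis
  define h where "h = 1 / (2 * (L + 1))"
  have h: "0 < h" "L * h \<le> 1 / 2"
    using L(1) by (auto simp: h_def field_simps)
  show ?thesis
  proof (rule that[OF h(1)])
    fix a b e t :: real and x u y v :: "real \<Rightarrow> 'e"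
    assume ab: "a < b" "b - a \<le> h" and xu: "slow_geodesic {a..b} x0 r M x u" and yv: "slow_geodesic {a..b} x0 r M y v"
      and e: "\<And>s. s \<in> {a..b} \<Longrightarrow> norm (x s - y s) \<le> e" and t: "t \<in> {a..b}"
    have e0: "0 \<le> e" using e[OF t] norm_ge_zero[of "x t - y t"] by linarith
    from slow_geodesic_velocity_max[OF xu yv less_imp_le[OF ab(1)]]
    obtain t0 where t0: "t0 \<in> {a..b}" "\<And>s. s \<in> {a..b} \<Longrightarrow> norm (u s - v s) \<le> norm (u t0 - v t0)"
      by blast
    define m where "m = norm (u t0 - v t0)"
    have m: "0 \<le> m" by (simp add: m_def)
    have acc: "norm ((u \<tau> - v \<tau>) - (u t0 - v t0)) \<le> (L * (e + m)) * (b - a)" if \<tau>: "\<tau> \<in> {a..b}" for \<tau>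
    proof -
      have "norm ((u \<tau> - v \<tau>) - (u t0 - v t0)) \<le> (L * (e + m)) * \<bar>\<tau> - t0\<bar>"
        by (rule slow_geodesic_acceleration[OF L xu yv e _ t0(1) \<tau>]) (use t0(2) in \<open>auto simp: m_def\<close>)
      also have "\<dots> \<le> (L * (e + m)) * (b - a)"
        using \<tau> t0(1) L(1) m e0 by (intro mult_left_mono) auto
      finally show ?thesis .
    qed
    \<comment> \<open>Over the whole interval the difference of positions changes by
      \<open>(b - a) *\<^sub>R w\<close> up to the accumulated difference of accelerations. As it
      also changes by at most \<open>2 * e\<close>, this bounds the largest difference of
      velocities.\<close>
    define w where "w = u t0 - v t0"
    have "norm ((x b - y b - b *\<^sub>R w) - (x a - y a - a *\<^sub>R w)) \<le> ((L * (e + m)) * (b - a)) * \<bar>b - a\<bar>"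
    proof (rule vector_derivative_norm_bound[of a b "\<lambda>t. x t - y t - t *\<^sub>R w" "\<lambda>t. u t - v t - w"])
      fix t assume t: "t \<in> {a..b}"
      have "((\<lambda>t. t *\<^sub>R w) has_vector_derivative w) (at t within {a..b})"
        using has_vector_derivative_scaleR[of "\<lambda>t. t" 1 t "{a..b}" "\<lambda>_. w" 0] by simp
      then show "((\<lambda>t. x t - y t - t *\<^sub>R w) has_vector_derivative u t - v t - w) (at t within {a..b})"
        by (intro has_vector_derivative_diff slow_geodesicD(2)[OF xu t] slow_geodesicD(2)[OF yv t])
      show "norm (u t - v t - w) \<le> (L * (e + m)) * (b - a)"
        unfolding w_def by (rule acc[OF t])
    qed (use ab in auto)
    moreover have "(x b - y b - b *\<^sub>R w) - (x a - y a - a *\<^sub>R w) = (x b - y b) - (x a - y a) - (b - a) *\<^sub>R w"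
      by (simp add: algebra_simps)
    ultimately have 1: "norm ((x b - y b) - (x a - y a) - (b - a) *\<^sub>R w) \<le> L * (b - a) * (e + m) * (b - a)"
      using ab by (simp add: mult_ac)
    \<comment> \<open>The length of the interval is limited so that the term with \<open>m\<close>
      on the right is at most half of the left side and can be absorbed.\<close>
    have "L * (b - a) \<le> 1 / 2"
      using mult_left_mono[OF ab(2) L(1)] h(2) by linarith
    then have "L * (b - a) * (e + m) * (b - a) \<le> (1 / 2) * (e + m) * (b - a)"
      using ab e0 m by (intro mult_right_mono) auto
    with 1 have 2: "norm ((x b - y b) - (x a - y a) - (b - a) *\<^sub>R w) \<le> (1 / 2) * (e + m) * (b - a)" by linarith
    have "(b - a) * m = norm ((b - a) *\<^sub>R w)" using ab by (simp add: m_def w_def)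
    also have "\<dots> \<le> norm ((x b - y b) - (x a - y a) - (b - a) *\<^sub>R w) + norm (x b - y b) + norm (x a - y a)"
      using norm_triangle_le_diff3 by blast
    also have "\<dots> \<le> (1 / 2) * (e + m) * (b - a) + e + e"
      using 2 e[of a] e[of b] ab by (intro add_mono) auto
    finally have "(b - a) * m \<le> (b - a) * (e + m) / 2 + 2 * e" by (simp add: mult_ac)
    then have "(b - a) * m \<le> (b - a) * e + 4 * e" by (simp add: field_simps)
    also have "\<dots> = (b - a) * ((4 / (b - a) + 1) * e)" using ab by (simp add: field_simps)
    finally have "m \<le> (4 / (b - a) + 1) * e" using ab by (simp add: mult_le_cancel_left)
    then show "norm (u t - v t) \<le> (4 / (b - a) + 1) * e" using t0(2)[OF t] by (simp add: m_def)
  qed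
qed

text \<open>The first variation formula with an error quadratic in the uniform distance
  \<open>e\<close>. Half the difference of the energies enters with the factor \<open>t - s\<close>,
  since energies are constant along geodesics and may be evaluated at \<open>a\<close>. The constant
  \<open>K\<close> is the same for all pairs of slow geodesics, which is what allows one of them to
  converge to the other.\<close>

definition variation_bound :: "real \<Rightarrow> real \<Rightarrow> 'e \<Rightarrow> real \<Rightarrow> real \<Rightarrow> real \<Rightarrow> bool" where
  "variation_bound a b x0 r M K \<longleftrightarrow>
     (\<forall>x u y v e s t. slow_geodesic {a..b} x0 r M x u \<longrightarrow> slow_geodesic {a..b} x0 r M y v \<longrightarrow>
      (\<forall>s\<in>{a..b}. norm (x s - y s) \<le> e) \<longrightarrow> s \<in> {a..b} \<longrightarrow> t \<in> {a..b} \<longrightarrow>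
      \<bar>G (x t) (u t) (y t - x t) - G (x s) (u s) (y s - x s) - (t - s) * ((G (y a) (v a) (v a) - G (x a) (u a) (u a)) / 2)\<bar> \<le> K * e\<^sup>2)"

text \<open>By \<open>first_variation_algebra\<close> the derivative of the left side is quadratic
  in the differences of positions and velocities, and \<open>geodesic_velocity_estimate\<close>
  bounds the latter by the former. Integration over the interval gives the claim.\<close>

lemma first_variation:
  assumes gb: "good_ball x0 r C" and M: "0 \<le> M"
  obtains h where "0 < h"
    "\<And>a b. a < b \<Longrightarrow> b - a \<le> h \<Longrightarrow> \<exists>K\<ge>0. variation_bound a b x0 r M K"
proof -
  obtain h where h: "0 < h"
    "\<And>a b x u y v e t. a < b \<Longrightarrow> b - a \<le> h \<Longrightarrow> slow_geodesic {a..b} x0 r M x u \<Longrightarrow> slow_geodesic {a..b} x0 r M y v \<Longrightarrow>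
      (\<And>s. s \<in> {a..b} \<Longrightarrow> norm (x s - y s) \<le> e) \<Longrightarrow> t \<in> {a..b} \<Longrightarrow> norm (u t - v t) \<le> (4 / (b - a) + 1) * e"
    using geodesic_velocity_estimate[OF gb, of M] by metis
  have C: "0 \<le> C" using good_ballD(2)[OF gb] .
  show ?thesis
  proof (rule that[OF h(1)])
    fix a b :: real assume ab: "a < b" "b - a \<le> h"
    \<comment> \<open>The factor \<open>M\<close> comes with the difference of positions, the other
      summand is the constant of the velocity estimate.\<close>
    define k where "k = M + (4 / (b - a) + 1)"
    have k: "0 \<le> k" using ab M by (simp add: k_def)
    show "\<exists>K\<ge>0. variation_bound a b x0 r M K"
      unfolding variation_bound_def
    proof (intro exI[of _ "C / 2 * k\<^sup>2 * (b - a)"] conjI allI impI)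
      show "0 \<le> C / 2 * k\<^sup>2 * (b - a)" using C ab by simp
      fix x u y v e s t
      assume xu: "slow_geodesic {a..b} x0 r M x u" and yv: "slow_geodesic {a..b} x0 r M y v"
        and e: "\<forall>s\<in>{a..b}. norm (x s - y s) \<le> e" and s: "s \<in> {a..b}" and t: "t \<in> {a..b}"
      define F where "F t = (G (y t) (v t) (v t) - G (x t) (u t) (u t)) / 2" for t
      have Fc: "F t = F a" if "t \<in> {a..b}" for t
        using geodesic_energy_constant[of a b x u t a] geodesic_energy_constant[of a b y v t a] xu yv that ab
        by (auto simp: F_def slow_geodesic_def)
      define f where "f t = G (x t) (u t) (y t - x t) - t * F a" for t
      have "norm (f t - f s) \<le> (C / 2 * (k * e)\<^sup>2) * \<bar>t - s\<bar>"
      proof (rule vector_derivative_norm_bound[of a b f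
          "\<lambda>t. DG (x t) (y t - x t) (u t) (u t) / 2 + G (x t) (u t) (v t - u t) - F a"])
        fix t assume t: "t \<in> {a..b}"
        have xS: "x t \<in> S" by (rule slow_geodesicD(1)[OF xu t])
        have "((\<lambda>s. G (x s) (u s) (y s - x s)) has_real_derivative
            DG (x t) (u t) (u t) (y t - x t) + G (x t) (- Chr (x t) (u t) (u t)) (y t - x t) + G (x t) (u t) (v t - u t)) (at t within {a..b})"
          by (rule G_curve_derivative[OF t slow_geodesicD(1)[OF xu] slow_geodesicD(2)[OF xu t] slow_geodesicD(3)[OF xu t]], assumption)
            (intro has_vector_derivative_diff slow_geodesicD(2)[OF xu t] slow_geodesicD(2)[OF yv t])
        then have "((\<lambda>s. G (x s) (u s) (y s - x s)) has_real_derivative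
            DG (x t) (y t - x t) (u t) (u t) / 2 + G (x t) (u t) (v t - u t)) (at t within {a..b})"
          by (rule DERIV_cong) (simp add: G_simps(7)[OF xS] Chr_diag[OF xS])
        then have "(f has_real_derivative DG (x t) (y t - x t) (u t) (u t) / 2 + G (x t) (u t) (v t - u t) - F a) (at t within {a..b})"
          unfolding f_def by (rule DERIV_cong[OF DERIV_diff[OF _ DERIV_cmult_right[OF DERIV_ident]]]) simp
        then show "(f has_vector_derivative DG (x t) (y t - x t) (u t) (u t) / 2 + G (x t) (u t) (v t - u t) - F a) (at t within {a..b})"
          by (simp add: has_real_derivative_iff_has_vector_derivative)
        have "\<bar>DG (x t) (y t - x t) (u t) (u t) / 2 + G (x t) (u t) (v t - u t) - F t\<bar>
            \<le> C / 2 * (M * norm (y t - x t) + norm (v t - u t))\<^sup>2"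
          unfolding F_def
          by (rule first_variation_algebra[OF gb]) (use slow_geodesicD[OF xu t] slow_geodesicD[OF yv t] in auto)
        also have "\<dots> \<le> C / 2 * (k * e)\<^sup>2"
        proof (intro mult_left_mono power_mono)
          have "norm (u t - v t) \<le> (4 / (b - a) + 1) * e"
            by (rule h(2)[OF ab xu yv _ t]) (use e in auto)
          moreover have "M * norm (y t - x t) \<le> M * e"
            using e t M by (intro mult_left_mono) (auto simp: norm_minus_commute)
          ultimately show "M * norm (y t - x t) + norm (v t - u t) \<le> k * e"
            unfolding k_def distrib_right[of M] norm_minus_commute[of "v t"] by linarith
          show "0 \<le> M * norm (y t - x t) + norm (v t - u t)" using M by simp
        qed (use C in auto)
        finally show "norm (DG (x t) (y t - x t) (u t) (u t) / 2 + G (x t) (u t) (v t - u t) - F a) \<le> C / 2 * (k * e)\<^sup>2"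
          by (simp add: Fc[OF t])
      qed (use s t in auto)
      also have "\<dots> \<le> (C / 2 * (k * e)\<^sup>2) * (b - a)"
        using s t C by (intro mult_left_mono) auto
      finally have "\<bar>f t - f s\<bar> \<le> C / 2 * k\<^sup>2 * (b - a) * e\<^sup>2"
        by (simp add: power_mult_distrib mult_ac)
      moreover have "f t - f s = G (x t) (u t) (y t - x t) - G (x s) (u s) (y s - x s) - (t - s) * F a"
        by (simp add: f_def algebra_simps)
      ultimately show "\<bar>G (x t) (u t) (y t - x t) - G (x s) (u s) (y s - x s) - (t - s) * ((G (y a) (v a) (v a) - G (x a) (u a) (u a)) / 2)\<bar>
          \<le> C / 2 * k\<^sup>2 * (b - a) * e\<^sup>2"
        by (simp add: F_def)
    qed
  qed
qed

end

section \<open>Lorentzian forms\<close>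

locale lorentz =
  fixes h :: "'e::euclidean_space \<Rightarrow> 'e \<Rightarrow> real"
  assumes lin: "\<And>w. linear (\<lambda>u. h u w)"
    and sym: "\<And>u w. h u w = h w u"
    and onb: "\<exists>b :: 'e \<Rightarrow> 'e. \<exists>i0\<in>Basis. \<forall>i\<in>Basis. \<forall>j\<in>Basis. h (b i) (b j) = (if i \<noteq> j then 0 else if i = i0 then - 1 else 1)"
begin

lemma h_lin2: "linear (h u)"
proof -
  have eq: "h u = (\<lambda>w. h w u)" by (rule ext) (rule sym)
  show ?thesis by (subst eq) (rule lin)
qed

lemma h_add: "h (u + v) w = h u w + h v w" "h w (u + v) = h w u + h w v"
  by (fact linear_add[OF lin], fact linear_add[OF h_lin2])

lemma h_diff: "h (u - v) w = h u w - h v w" "h w (u - v) = h w u - h w v"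
  by (rule linear_diff[OF lin], rule linear_diff[OF h_lin2])

lemma h_scale: "h (c *\<^sub>R u) w = c * h u w" "h w (c *\<^sub>R u) = c * h w u"
  using linear_scale[OF lin[of w], of c u] linear_scale[OF h_lin2[of w], of c u] by simp_all

lemma h_0: "h 0 w = 0" "h w 0 = 0"
  by (rule linear_0[OF lin], rule linear_0[OF h_lin2])

text \<open>The orthonormal family supplies linear coordinates in which the form is the Minkowski
  product. They are all of the space because vanishing products with the family force vanishing
  coordinates.\<close>

lemma standard_coordinates:
  "\<exists>(F :: 'e \<Rightarrow> 'e) i0. linear F \<and> bij F \<and> i0 \<in> Basis \<and>
    (\<forall>y z. h (F y) (F z) = y \<bullet> z - 2 * (y \<bullet> i0) * (z \<bullet> i0))"
proof -
  obtain b :: "'e \<Rightarrow> 'e" and i0 where i0: "i0 \<in> Basis"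
    and b: "\<And>i j. i \<in> Basis \<Longrightarrow> j \<in> Basis \<Longrightarrow> h (b i) (b j) = (if i \<noteq> j then 0 else if i = i0 then - 1 else 1)"
    using onb by blast
  define F where "F y = (\<Sum>i\<in>Basis. (y \<bullet> i) *\<^sub>R b i)" for y
  have F: "linear F"
    by (rule linearI) (simp_all add: F_def inner_add_left scaleR_add_left sum.distrib scaleR_sum_right)
  have hb: "h (F y) (b j) = (y \<bullet> j) * (if j = i0 then - 1 else 1)" if j: "j \<in> Basis" for y j
  proof -
    have "h (F y) (b j) = (\<Sum>i\<in>Basis. (y \<bullet> i) * h (b i) (b j))"
      unfolding F_def linear_sum[OF lin] by (simp add: h_scale)
    also have "\<dots> = (\<Sum>i\<in>Basis. if i = j then (y \<bullet> j) * (if j = i0 then - 1 else 1) else 0)"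
      by (rule sum.cong[OF refl]) (use b j in auto)
    also have "\<dots> = (y \<bullet> j) * (if j = i0 then - 1 else 1)"
      using j by (subst sum.delta) auto
    finally show ?thesis .
  qed
  have "inj F"
    unfolding linear_injective_0[OF F]
  proof (intro allI impI)
    fix y assume "F y = 0"
    then have "y \<bullet> j = 0" if "j \<in> Basis" for j
      using hb[OF that, of y] by (auto simp: h_0 split: if_splits)
    then show "y = 0" by (auto intro: euclidean_eqI)
  qed
  then have "bij F"
    using linear_injective_imp_surjective[OF F] by (simp add: bij_def)
  moreover have "h (F y) (F z) = y \<bullet> z - 2 * (y \<bullet> i0) * (z \<bullet> i0)" for y z
  proof -
    have "h (F y) (F z) = (\<Sum>j\<in>Basis. (z \<bullet> j) * h (F y) (b j))"
      unfolding F_def[of z] linear_sum[OF h_lin2] by (simp add: h_scale)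
    also have "\<dots> = (\<Sum>j\<in>Basis. (y \<bullet> j) * (z \<bullet> j) + (if j = i0 then - 2 * (y \<bullet> i0) * (z \<bullet> i0) else 0))"
      by (rule sum.cong[OF refl]) (auto simp: hb)
    also have "\<dots> = y \<bullet> z - 2 * (y \<bullet> i0) * (z \<bullet> i0)"
      unfolding sum.distrib using i0 by (subst sum.delta) (auto simp: euclidean_inner[of y z])
    finally show ?thesis .
  qed
  ultimately show ?thesis using F i0 by blast
qed

lemma h_nondegenerate: "(\<forall>w. h u w = 0) \<Longrightarrow> u = 0"
proof -
  assume u: "\<forall>w. h u w = 0"
  obtain F :: "'e \<Rightarrow> 'e" and i0 :: 'e where F: "linear F" "bij F" "i0 \<in> Basis"
    "\<forall>y z. h (F y) (F z) = y \<bullet> z - 2 * (y \<bullet> i0) * (z \<bullet> i0)"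
    using standard_coordinates by blast
  obtain y where y: "u = F y" using surjD[OF bij_is_surj[OF F(2)], of u] by blast
  have "y \<bullet> j = 0" if "j \<in> Basis" for j
  proof -
    have "h (F y) (F j) = 0" using u y by simp
    then show ?thesis using F(3) that by (cases "j = i0") (auto simp: F(4)[rule_format] inner_Basis)
  qed
  then have "y = 0" by (auto intro: euclidean_eqI)
  then show "u = 0" using y linear_0[OF F(1)] by simp
qed

text \<open>In standard coordinates let \<open>a0\<close>, \<open>c0\<close> be the time components
  and \<open>a'\<close>, \<open>c'\<close> the space components. Orthogonality says that
  \<open>a' \<bullet> c'\<close> equals \<open>a0 * c0\<close>, and \<open>a'\<close> is shorter
  than the absolute value of \<open>a0\<close>; the Cauchy-Schwarz inequality then makes
  \<open>c'\<close> longer than that of \<open>c0\<close> unless \<open>c'\<close> is 0, and in that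
  case \<open>z\<close> vanishes.\<close>

lemma orthogonal_to_timelike:
  assumes X: "h x x < 0" and z: "h x z = 0"
  shows "0 \<le> h z z" "h z z = 0 \<Longrightarrow> z = 0"
proof -
  obtain F :: "'e \<Rightarrow> 'e" and i0 :: 'e where F: "linear F" "bij F" "i0 \<in> Basis"
    "\<forall>y z. h (F y) (F z) = y \<bullet> z - 2 * (y \<bullet> i0) * (z \<bullet> i0)"
    using standard_coordinates by blast
  obtain a where a: "x = F a" using surjD[OF bij_is_surj[OF F(2)], of x] by blast
  obtain c where c: "z = F c" using surjD[OF bij_is_surj[OF F(2)], of z] by blast
  define a0 c0 where "a0 = a \<bullet> i0" and "c0 = c \<bullet> i0"
  define a' c' where "a' = a - a0 *\<^sub>R i0" and "c' = c - c0 *\<^sub>R i0"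
  have i0: "i0 \<bullet> i0 = 1" using F(3) by simp
  have aa: "a' \<bullet> a' = a \<bullet> a - a0\<^sup>2" and cc: "c' \<bullet> c' = c \<bullet> c - c0\<^sup>2" and ac: "a' \<bullet> c' = a \<bullet> c - a0 * c0"
    by (simp_all add: a'_def c'_def a0_def c0_def inner_diff_left inner_diff_right i0 inner_commute[of i0 a] inner_commute[of i0 c] power2_eq_square)
  have hx: "h x x = a \<bullet> a - 2 * a0\<^sup>2" "h x z = a \<bullet> c - 2 * a0 * c0" "h z z = c \<bullet> c - 2 * c0\<^sup>2"
    by (simp_all add: a c F(4)[rule_format] a0_def c0_def power2_eq_square)
  have hz: "h z z = c' \<bullet> c' - c0\<^sup>2" using cc hx by simp
  have a_lt: "a' \<bullet> a' < a0\<^sup>2" using X aa hx by simp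
  then have a0: "0 < a0\<^sup>2" using inner_ge_zero[of a'] by linarith
  have eq: "a' \<bullet> c' = a0 * c0" using z ac hx by simp
  have CS: "(a0 * c0)\<^sup>2 \<le> (a' \<bullet> a') * (c' \<bullet> c')"
    using Cauchy_Schwarz_ineq[of a' c'] eq by simp
  have zero: "z = 0" if "c' = 0"
  proof -
    have "a0 * c0 = 0" using eq that by simp
    then have "c0 = 0" using a0 by auto
    then have "c = 0" using that by (simp add: c'_def)
    then show ?thesis using c linear_0[OF F(1)] by simp
  qed
  have strict: "0 < h z z" if "c' \<noteq> 0"
  proof -
    have pos: "0 < c' \<bullet> c'" using that by simp
    have "a0\<^sup>2 * c0\<^sup>2 < a0\<^sup>2 * (c' \<bullet> c')"
      using CS mult_strict_right_mono[OF a_lt pos] by (simp add: power_mult_distrib)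
    then have "c0\<^sup>2 < c' \<bullet> c'" using a0 by (simp add: mult_less_cancel_left_pos)
    then show ?thesis using hz by simp
  qed
  show "0 \<le> h z z" using zero strict by (cases "c' = 0") (auto simp: h_0)
  show "z = 0" if "h z z = 0" using zero strict that by (cases "c' = 0") auto
qed

lemma causal_not_orthogonal:
  assumes "h x x < 0" "h w w \<le> 0" "w \<noteq> 0"
  shows "h x w \<noteq> 0"
proof
  assume "h x w = 0"
  note this[THEN orthogonal_to_timelike(1)[OF assms(1)]] this[THEN orthogonal_to_timelike(2)[OF assms(1)]]
  with assms(2,3) show False by auto
qed

text \<open>The combination \<open>z\<close> of \<open>w\<close> and \<open>p\<close> that is
  orthogonal to the timelike \<open>x\<close> has nonnegative square. Expanding the square, both
  outer terms are nonpositive, which leaves the sign of \<open>h p w\<close>. If this product is 0,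
  the square of \<open>z\<close> is 0, so \<open>z\<close> vanishes and the two vectors are
  proportional, with a positive factor because \<open>x\<close> has negative product with
  both.\<close>

lemma reverse_Cauchy_Schwarz:
  assumes x: "h x x < 0" and p: "h p p \<le> 0" "h x p < 0" and w: "h w w \<le> 0" "h x w < 0"
  shows "h p w \<le> 0" "h p w = 0 \<Longrightarrow> \<exists>l>0. w = l *\<^sub>R p"
proof -
  define a b where "a = h x w" and "b = h x p"
  have ab: "a < 0" "b < 0" using p w by (auto simp: a_def b_def)
  define z where "z = b *\<^sub>R w - a *\<^sub>R p"
  have xz: "h x z = 0" by (simp add: z_def h_diff h_scale a_def b_def)
  have zz: "h z z = b\<^sup>2 * h w w - 2 * (a * b) * h p w + a\<^sup>2 * h p p"
    by (simp add: z_def h_diff h_scale sym[of w p] power2_eq_square algebra_simps)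
  have 1: "b\<^sup>2 * h w w \<le> 0" "a\<^sup>2 * h p p \<le> 0"
    using p w by (simp_all add: mult_nonneg_nonpos)
  have "0 \<le> h z z" by (rule orthogonal_to_timelike[OF x xz])
  with zz 1 have "(a * b) * h p w \<le> 0" by linarith
  then show "h p w \<le> 0" using ab by (simp add: mult_le_0_iff mult_pos_pos zero_less_mult_iff)
  show "\<exists>l>0. w = l *\<^sub>R p" if "h p w = 0"
  proof -
    have "h z z = b\<^sup>2 * h w w + a\<^sup>2 * h p p" using zz that by simp
    then have "h z z = 0" using 1 \<open>0 \<le> h z z\<close> by linarith
    then have "z = 0" by (rule orthogonal_to_timelike[OF x xz])
    then have "b *\<^sub>R w = a *\<^sub>R p" by (simp add: z_def)
    then have "w = (a / b) *\<^sub>R p" using ab proof -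
      have "b *\<^sub>R w = b *\<^sub>R ((a / b) *\<^sub>R p)" using \<open>b *\<^sub>R w = a *\<^sub>R p\<close> ab by simp
      then show ?thesis using ab by (simp only: scaleR_cancel_left) simp
    qed
    then show ?thesis using ab by (intro exI[of _ "a / b"]) (simp add: divide_neg_neg)
  qed
qed

end

section \<open>Charts and tangent vectors\<close>

locale manifold =
  fixes A :: "('a::{t2_space,second_countable_topology}, 'e::euclidean_space) chart set"
  assumes manifold: "smooth_manifold A"
begin

definition trans :: "('a, 'e) chart \<Rightarrow> ('a, 'e) chart \<Rightarrow> 'e \<Rightarrow> 'e" where
  "trans c d = snd d \<circ> chart_inv c"

definition Dtrans :: "('a, 'e) chart \<Rightarrow> ('a, 'e) chart \<Rightarrow> 'a \<Rightarrow> 'e \<Rightarrow> 'e" where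
  "Dtrans c d p = frechet_derivative (trans c d) (at (snd c p))"

lemma chart_at: obtains c where "c \<in> A" "p \<in> fst c"
proof -
  have "p \<in> (\<Union>c\<in>A. fst c)" using manifold by (simp add: smooth_manifold_def)
  then show ?thesis using that by blast
qed

lemma chart_properties:
  "\<forall>c\<in>A. open (fst c) \<and> open (snd c ` fst c) \<and> homeomorphism (fst c) (snd c ` fst c) (snd c) (chart_inv c)"
  using manifold unfolding smooth_manifold_def by (elim conjE)

lemma transition_smooth:
  "\<forall>c\<in>A. \<forall>d\<in>A. smooth_on (snd c ` (fst c \<inter> fst d)) (snd d \<circ> chart_inv c)"
  using manifold unfolding smooth_manifold_def by (elim conjE)

lemma chart_open:
  assumes "c \<in> A"
  shows "open (fst c)" "open (snd c ` fst c)"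
  using bspec[OF chart_properties assms] by simp_all

lemma chart_homeomorphism: "c \<in> A \<Longrightarrow> homeomorphism (fst c) (snd c ` fst c) (snd c) (chart_inv c)"
  using bspec[OF chart_properties] by simp

lemmas chart_continuous = homeomorphism_cont1[OF chart_homeomorphism]
lemmas chart_inv_continuous = homeomorphism_cont2[OF chart_homeomorphism]
lemmas chart_inv_chart = homeomorphism_apply1[OF chart_homeomorphism]

lemma chart_inj: "c \<in> A \<Longrightarrow> inj_on (snd c) (fst c)"
  by (rule inj_on_inverseI[of _ "chart_inv c"]) (rule chart_inv_chart)

lemma chart_image_open:
  assumes "c \<in> A" "open T"
  shows "open (snd c ` (fst c \<inter> T))"
proof -
  have "snd c ` (fst c \<inter> T) = snd c ` fst c \<inter> chart_inv c -` T"
    using assms(1) by (auto simp: chart_inv_chart image_iff)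
  then show ?thesis
    using continuous_open_preimage[OF chart_inv_continuous[OF assms(1)] chart_open(2)[OF assms(1)] assms(2)] by simp
qed

lemma trans_apply: "c \<in> A \<Longrightarrow> p \<in> fst c \<Longrightarrow> trans c d (snd c p) = snd d p"
  by (simp add: trans_def chart_inv_chart)

lemma trans_has_derivative:
  assumes "c \<in> A" "d \<in> A" "p \<in> fst c" "p \<in> fst d"
  shows "(trans c d has_derivative Dtrans c d p) (at (snd c p))"
proof -
  have sm: "smooth_on (snd c ` (fst c \<inter> fst d)) (snd d \<circ> chart_inv c)"
    using transition_smooth assms by simp
  then have "C_k (Suc 0) (snd c ` (fst c \<inter> fst d)) (trans c d)"
    unfolding smooth_on_def trans_def by blast
  then have "trans c d differentiable_on (snd c ` (fst c \<inter> fst d))"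
    by simp
  then have "trans c d differentiable (at (snd c p) within snd c ` (fst c \<inter> fst d))"
    using assms by (simp add: differentiable_on_def)
  moreover have "open (snd c ` (fst c \<inter> fst d))" "snd c p \<in> snd c ` (fst c \<inter> fst d)"
    using assms chart_image_open chart_open by auto
  ultimately have "trans c d differentiable (at (snd c p))"
    by (simp only: at_within_open[of "snd c p" "snd c ` (fst c \<inter> fst d)"])
  then show ?thesis
    unfolding Dtrans_def by (rule frechet_derivative_works[THEN iffD1])
qed

lemma Dtrans_linear:
  "c \<in> A \<Longrightarrow> d \<in> A \<Longrightarrow> p \<in> fst c \<Longrightarrow> p \<in> fst d \<Longrightarrow> linear (Dtrans c d p)"
  by (rule has_derivative_linear[OF trans_has_derivative])

lemma Dtrans_compose:
  assumes "c \<in> A" "d \<in> A" "e \<in> A" "p \<in> fst c" "p \<in> fst d" "p \<in> fst e"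
  shows "Dtrans d e p (Dtrans c d p u) = Dtrans c e p u"
proof -
  have "(trans d e has_derivative Dtrans d e p) (at (trans c d (snd c p)))"
    using trans_has_derivative[of d e p] assms by (simp add: trans_apply)
  from has_derivative_compose[OF trans_has_derivative[OF assms(1,2,4,5)] this]
  have "((\<lambda>x. trans d e (trans c d x)) has_derivative (\<lambda>u. Dtrans d e p (Dtrans c d p u))) (at (snd c p))" .
  moreover have "open (snd c ` (fst c \<inter> fst d))" "snd c p \<in> snd c ` (fst c \<inter> fst d)"
    using assms chart_image_open chart_open by auto
  moreover have "trans d e (trans c d x) = trans c e x" if "x \<in> snd c ` (fst c \<inter> fst d)" for x
    using that assms by (auto simp: trans_apply)
  ultimately have "(trans c e has_derivative (\<lambda>u. Dtrans d e p (Dtrans c d p u))) (at (snd c p))"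
    by (rule has_derivative_transform_within_open)
  then show ?thesis
    using has_derivative_unique[OF _ trans_has_derivative[OF assms(1,3,4,6)]] by metis
qed

lemma Dtrans_id:
  assumes "c \<in> A" "p \<in> fst c"
  shows "Dtrans c c p u = u"
proof -
  have "((\<lambda>x. x) has_derivative (\<lambda>u. u)) (at (snd c p))" by simp
  then have "(trans c c has_derivative (\<lambda>u. u)) (at (snd c p))"
    by (rule has_derivative_transform_within_open[OF _ chart_open(2)[OF assms(1)]])
      (use assms in \<open>auto simp: trans_apply\<close>)
  then show ?thesis
    using has_derivative_unique[OF _ trans_has_derivative[OF assms(1,1,2,2)]] by metis
qed

lemma coord_vector_apply:
  "coord_vector A c p u d = (if d \<in> A \<and> p \<in> fst d then Dtrans c d p u else 0)"
  by (simp add: coord_vector_def Dtrans_def trans_def)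

lemma tangent_space_iff:
  "v \<in> tangent_space A p \<longleftrightarrow> (\<forall>c\<in>A. \<forall>d\<in>A. p \<in> fst c \<and> p \<in> fst d \<longrightarrow> v d = Dtrans c d p (v c)) \<and>
     (\<forall>c. \<not> (c \<in> A \<and> p \<in> fst c) \<longrightarrow> v c = 0)"
  by (simp add: tangent_space_def Dtrans_def trans_def)

lemma coord_vector_tangent:
  assumes "c \<in> A" "p \<in> fst c"
  shows "coord_vector A c p u \<in> tangent_space A p"
  unfolding tangent_space_iff using assms by (auto simp: coord_vector_apply Dtrans_compose)

lemma coord_vector_self: "c \<in> A \<Longrightarrow> p \<in> fst c \<Longrightarrow> coord_vector A c p u c = u"
  by (simp add: coord_vector_apply Dtrans_id)

lemma coord_vector_of_tangent:
  assumes "v \<in> tangent_space A p" "c \<in> A" "p \<in> fst c"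
  shows "coord_vector A c p (v c) = v"
proof
  fix d show "coord_vector A c p (v c) d = v d"
  proof (cases "d \<in> A \<and> p \<in> fst d")
    case True
    then have "v d = Dtrans c d p (v c)"
      using assms unfolding tangent_space_iff by blast
    with True show ?thesis by (simp add: coord_vector_apply)
  next
    case False
    then have "v d = 0"
      using assms(1) unfolding tangent_space_iff by blast
    with False show ?thesis by (simp only: coord_vector_apply if_False)
  qed
qed

lemma tangent_eqI:
  assumes "v \<in> tangent_space A p" "w \<in> tangent_space A p" "c \<in> A" "p \<in> fst c" "v c = w c"
  shows "v = w"
  using coord_vector_of_tangent[OF assms(1,3,4)] coord_vector_of_tangent[OF assms(2,3,4)] assms(5) by metis

lemma coord_vector_lincomb:
  assumes "c \<in> A" "p \<in> fst c"
  shows "coord_vector A c p (r *\<^sub>R u + s *\<^sub>R w) = (\<lambda>d. r *\<^sub>R coord_vector A c p u d + s *\<^sub>R coord_vector A c p w d)"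
proof
  fix d
  show "coord_vector A c p (r *\<^sub>R u + s *\<^sub>R w) d = r *\<^sub>R coord_vector A c p u d + s *\<^sub>R coord_vector A c p w d"
  proof (cases "d \<in> A \<and> p \<in> fst d")
    case True
    then have "linear (Dtrans c d p)" using Dtrans_linear assms by blast
    then show ?thesis using True by (simp add: coord_vector_apply linear_add linear_scale)
  next
    case False
    then have "coord_vector A c p x d = 0" for x by (auto simp: coord_vector_apply)
    then show ?thesis by simp
  qed
qed

lemma coord_vector_scale:
  assumes "c \<in> A" "p \<in> fst c"
  shows "coord_vector A c p (r *\<^sub>R u) = (\<lambda>d. r *\<^sub>R coord_vector A c p u d)"
  using coord_vector_lincomb[OF assms, of r u 0 0] by simp

lemma coord_vector_0: "c \<in> A \<Longrightarrow> p \<in> fst c \<Longrightarrow> coord_vector A c p 0 = (\<lambda>_. 0)"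
  using coord_vector_scale[of c p 0 0] by simp

lemma coord_vector_eq_0_iff:
  assumes "c \<in> A" "p \<in> fst c"
  shows "coord_vector A c p u = (\<lambda>_. 0) \<longleftrightarrow> u = 0"
  using coord_vector_0[OF assms] coord_vector_self[OF assms, of u] by auto

lemma coord_vector_continuous:
  assumes "c \<in> A" "p \<in> fst c"
  shows "continuous_on UNIV (coord_vector A c p)"
proof (rule continuous_on_coordinatewise_then_product)
  fix d
  show "continuous_on UNIV (\<lambda>u. coord_vector A c p u d)"
  proof (cases "d \<in> A \<and> p \<in> fst d")
    case True
    then have "linear (Dtrans c d p)" using Dtrans_linear assms by blast
    then show ?thesis using True by (simp add: coord_vector_apply linear_continuous_on linear_conv_bounded_linear[symmetric])
  next
    case False
    then have "coord_vector A c p x d = 0" for x by (auto simp: coord_vector_apply)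
    then show ?thesis by simp
  qed
qed

lemma curve_chart_change:
  assumes cd: "c \<in> A" "d \<in> A" and t: "\<gamma> t \<in> fst c" "\<gamma> t \<in> fst d" "t \<in> I" and cont: "continuous_on I \<gamma>"
    and D: "((snd c \<circ> \<gamma>) has_vector_derivative w) (at t within I)"
  shows "((snd d \<circ> \<gamma>) has_vector_derivative Dtrans c d (\<gamma> t) w) (at t within I)"
proof -
  have lin: "linear (Dtrans c d (\<gamma> t))" using Dtrans_linear cd t by blast
  have "((snd c \<circ> \<gamma>) has_derivative (\<lambda>h. h *\<^sub>R w)) (at t within I)"
    using D by (simp add: has_vector_derivative_def)
  moreover have "(trans c d has_derivative Dtrans c d (\<gamma> t)) (at ((snd c \<circ> \<gamma>) t))"
    using trans_has_derivative[OF cd t(1,2)] by simp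
  ultimately have "((\<lambda>s. trans c d ((snd c \<circ> \<gamma>) s)) has_derivative (\<lambda>h. Dtrans c d (\<gamma> t) (h *\<^sub>R w))) (at t within I)"
    by (rule has_derivative_compose)
  then have D': "((\<lambda>s. trans c d ((snd c \<circ> \<gamma>) s)) has_vector_derivative Dtrans c d (\<gamma> t) w) (at t within I)"
    by (simp add: has_vector_derivative_def linear_scale[OF lin])
  \<comment> \<open>Continuity keeps the curve in the domain of \<open>c\<close> for times near
    \<open>t\<close>; only there is the transition map applied to
    \<open>snd c \<circ> \<gamma>\<close> known to be \<open>snd d \<circ> \<gamma>\<close>.\<close>
  have "openin (top_of_set I) (I \<inter> \<gamma> -` fst c)"
    using cont chart_open(1)[OF cd(1)] by (simp add: continuous_openin_preimage_gen)
  then obtain r where r: "r > 0" "\<And>s. s \<in> I \<Longrightarrow> dist s t < r \<Longrightarrow> \<gamma> s \<in> fst c"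
  proof -
    have "t \<in> I \<inter> \<gamma> -` fst c" using t by simp
    then obtain r where "r > 0" "\<forall>s\<in>I. dist s t < r \<longrightarrow> s \<in> I \<inter> \<gamma> -` fst c"
      using \<open>openin (top_of_set I) (I \<inter> \<gamma> -` fst c)\<close> unfolding openin_euclidean_subtopology_iff by blast
    then show ?thesis using that[of r] by blast
  qed
  show ?thesis
    by (rule has_vector_derivative_transform_within[OF D' r(1) t(3)])
      (use r cd in \<open>auto simp: trans_apply\<close>)
qed

end

section \<open>Geodesics of a space-time\<close>

lemma (in C11_form) Chr_scale:
  assumes x: "x \<in> S"
  shows "Chr x (r *\<^sub>R u) (r *\<^sub>R u) = r\<^sup>2 *\<^sub>R Chr x u u"
proof -
  have "\<forall>z. G x (Chr x (r *\<^sub>R u) (r *\<^sub>R u) - r\<^sup>2 *\<^sub>R Chr x u u) z = 0"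
    by (simp add: G_simps[OF x] Chr_diag[OF x] DG_simps[OF x] power2_eq_square algebra_simps)
  then show ?thesis
    using nondeg[OF x] by (metis eq_iff_diff_eq_0)
qed

text \<open>The estimates in a chart are for compact nondegenerate intervals, the induction along
  \<open>{0..1}\<close> is over relatively open ones. The interval \<open>{a..b}\<close> mediates
  and is cut off at the ends of \<open>{0..1}\<close>.\<close>

lemma interval_neighbourhood:
  fixes t0 h :: real
  assumes "t0 \<in> {0..1}" "0 < h"
  obtains a b where "a < b" "{a..b} \<subseteq> {0..1}" "b - a \<le> 2 * h" "{a..b} \<subseteq> cball t0 h"
    "{0..1} \<inter> ball t0 h \<subseteq> {a..b}"
proof (rule that[of "max 0 (t0 - h)" "min 1 (t0 + h)"])
  show "{max 0 (t0 - h)..min 1 (t0 + h)} \<subseteq> cball t0 h" by (auto simp: dist_real_def)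
  show "{0..1} \<inter> ball t0 h \<subseteq> {max 0 (t0 - h)..min 1 (t0 + h)}" by (auto simp: dist_real_def)
qed (use assms in auto)

text \<open>Connectedness of the unit interval. A geodesic may leave every single chart; this rule
  continues along it whatever can be shown in one chart, namely that the property passes between any
  two nearby times.\<close>

lemma interval_connected_induction:
  fixes P :: "real \<Rightarrow> bool"
  assumes loc: "\<And>t0. t0 \<in> {0..1} \<Longrightarrow> \<exists>h>0. \<forall>x\<in>{0..1} \<inter> ball t0 h. \<forall>y\<in>{0..1} \<inter> ball t0 h. P x \<longrightarrow> P y"
    and st: "s \<in> {0..1}" "t \<in> {0..1}" "P s"
  shows "P t"
proof (rule connected_induction_simple[of "{0..1::real}" s t P])
  fix t0 :: real assume t0: "t0 \<in> {0..1}"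
  obtain h where h: "h > 0" "\<forall>x\<in>{0..1} \<inter> ball t0 h. \<forall>y\<in>{0..1} \<inter> ball t0 h. P x \<longrightarrow> P y"
    using loc[OF t0] by blast
  have "openin (top_of_set {0..1}) ({0..1} \<inter> ball t0 h)" "t0 \<in> {0..1} \<inter> ball t0 h"
    using h(1) t0 by auto
  with h(2) show "\<exists>T. openin (top_of_set {0..1}) T \<and> t0 \<in> T \<and> (\<forall>x\<in>T. \<forall>y\<in>T. P x \<longrightarrow> P y)" by blast
qed (use st in auto)

lemma at_within_interval_nonbot: "a < b \<Longrightarrow> t \<in> {a..b} \<Longrightarrow> at t within {a..b::real} \<noteq> bot"
  by (simp add: trivial_limit_within islimpt_Icc)

locale spacetime =
  fixes A :: "('a::{t2_space,second_countable_topology}, 'e::euclidean_space) chart set"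
    and g :: "('a, 'e) metric" and X :: "'a \<Rightarrow> ('a, 'e) tangent"
  assumes spacetime: "C11_spacetime A g X"

sublocale spacetime \<subseteq> manifold A
  by unfold_locales (use spacetime in \<open>simp add: C11_spacetime_def\<close>)

context spacetime
begin

abbreviation "mc \<equiv> metric_coords A g"
abbreviation "vl \<equiv> velocity A {0..1}"

lemma lorentzian: "lorentzian_form (tangent_space A p) (g p)"
  using spacetime unfolding C11_spacetime_def C11_lorentzian_metric_def by blast

lemma X_timelike: "X p \<in> tangent_space A p" "g p (X p) (X p) < 0"
  using spacetime unfolding C11_spacetime_def continuous_vector_field_def timelike_def by blast+

lemma X_continuous: "c \<in> A \<Longrightarrow> continuous_on (fst c) (\<lambda>p. X p c)"
  using spacetime unfolding C11_spacetime_def continuous_vector_field_def by blast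

lemma mc_chart:
  assumes "c \<in> A" "p \<in> fst c"
  shows "mc c (snd c p) u w = g p (coord_vector A c p u) (coord_vector A c p w)"
  by (simp add: metric_coords_def chart_inv_chart assms)

lemma g_tangent:
  assumes "c \<in> A" "p \<in> fst c" "v \<in> tangent_space A p" "w \<in> tangent_space A p"
  shows "g p v w = mc c (snd c p) (v c) (w c)"
  using mc_chart[OF assms(1,2), of "v c" "w c"] coord_vector_of_tangent[OF assms(3,1,2)] coord_vector_of_tangent[OF assms(4,1,2)]
  by simp

lemma mc_lorentz:
  assumes c: "c \<in> A" and x: "x \<in> snd c ` fst c"
  shows "lorentz (mc c x)"
proof (rule lorentz.intro)
  obtain p where p: "p \<in> fst c" "x = snd c p" using x by blast
  note T = coord_vector_tangent[OF c p(1)]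
  note lf = lorentzian[of p, unfolded lorentzian_form_def]
  have s: "\<forall>v\<in>tangent_space A p. \<forall>w\<in>tangent_space A p. g p v w = g p w v"
    using lf by (elim conjE)
  have l: "\<forall>v\<in>tangent_space A p. \<forall>w\<in>tangent_space A p. \<forall>z\<in>tangent_space A p. \<forall>r s. g p (\<lambda>c. r *\<^sub>R v c + s *\<^sub>R w c) z = r * g p v z + s * g p w z"
    using lf by (elim conjE)
  have o: "\<exists>b :: 'e \<Rightarrow> ('a, 'e) tangent. \<exists>i0\<in>Basis. (\<forall>i\<in>Basis. b i \<in> tangent_space A p) \<and>
        (\<forall>i\<in>Basis. \<forall>j\<in>Basis. g p (b i) (b j) = (if i \<noteq> j then 0 else if i = i0 then - 1 else 1))"
    using lf by (elim conjE)
  have lc: "mc c x (r *\<^sub>R u + s *\<^sub>R v) w = r * mc c x u w + s * mc c x v w" for r s u v w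
    unfolding p(2) mc_chart[OF c p(1)] coord_vector_lincomb[OF c p(1)] by (rule l[rule_format]) (rule T)+
  show "linear (\<lambda>u. mc c x u w)" for w
  proof (rule linearI)
    show "mc c x (u + v) w = mc c x u w + mc c x v w" for u v
      using lc[of 1 u 1 v w] by simp
    show "mc c x (r *\<^sub>R u) w = r *\<^sub>R mc c x u w" for r u
      using lc[of r u 0 0 w] by simp
  qed
  show "mc c x u w = mc c x w u" for u w
    unfolding p(2) mc_chart[OF c p(1)] by (rule s[rule_format]) (rule T)+
  obtain b :: "'e \<Rightarrow> ('a, 'e) tangent" and i0 where b: "i0 \<in> Basis" "\<forall>i\<in>Basis. b i \<in> tangent_space A p"
    "\<forall>i\<in>Basis. \<forall>j\<in>Basis. g p (b i) (b j) = (if i \<noteq> j then 0 else if i = i0 then - 1 else 1)"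
    using o by blast
  have "mc c x (b i c) (b j c) = (if i \<noteq> j then 0 else if i = i0 then - 1 else 1)" if "i \<in> Basis" "j \<in> Basis" for i j
    using g_tangent[OF c p(1), of "b i" "b j"] b that p(2) by simp
  then show "\<exists>b :: 'e \<Rightarrow> 'e. \<exists>i0\<in>Basis. \<forall>i\<in>Basis. \<forall>j\<in>Basis. mc c x (b i) (b j) = (if i \<noteq> j then 0 else if i = i0 then - 1 else 1)"
    using b(1) by (intro exI[of _ "\<lambda>i. b i c"] bexI[of _ i0]) auto
qed

lemma mc_form:
  assumes c: "c \<in> A"
  shows "C11_form (snd c ` fst c) (mc c)"
proof (rule C11_form.intro)
  show "open (snd c ` fst c)" by (rule chart_open(2)[OF c])
  show "C11_on (snd c ` fst c) (\<lambda>x. mc c x u w)" for u w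
    using spacetime c unfolding C11_spacetime_def C11_lorentzian_metric_def by blast
  fix x :: 'e assume x: "x \<in> snd c ` fst c"
  interpret lorentz "mc c x" by (rule mc_lorentz[OF c x])
  show "mc c x u w = mc c x w u" for u w by (rule sym)
  show "linear (\<lambda>u. mc c x u w)" for w by (rule lin)
  show "u = 0" if "\<forall>w. mc c x u w = 0" for u using that by (rule h_nondegenerate)
qed

lemma christoffel_Chr:
  assumes "c \<in> A"
  shows "christoffel A g c x u v = C11_form.Chr (mc c) x u v"
  unfolding christoffel_def C11_form.Chr_def[OF mc_form[OF assms]] C11_form.DG_def[OF mc_form[OF assms]] by simp

lemma velocity_eq_coord_vector:
  assumes ab: "a < b" and cont: "continuous_on {a..b} \<gamma>" and t: "t \<in> {a..b}" and c: "c \<in> A" "\<gamma> t \<in> fst c"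
    and D: "((snd c \<circ> \<gamma>) has_vector_derivative w) (at t within {a..b})"
  shows "velocity A {a..b} \<gamma> t = coord_vector A c (\<gamma> t) w"
proof
  fix d
  show "velocity A {a..b} \<gamma> t d = coord_vector A c (\<gamma> t) w d"
  proof (cases "d \<in> A \<and> \<gamma> t \<in> fst d")
    case True
    then have "((snd d \<circ> \<gamma>) has_vector_derivative Dtrans c d (\<gamma> t) w) (at t within {a..b})"
      using curve_chart_change[OF c(1) _ c(2) _ t cont D] by blast
    then have "vector_derivative (snd d \<circ> \<gamma>) (at t within {a..b}) = Dtrans c d (\<gamma> t) w"
      by (rule vector_derivative_within_closed_interval[OF ab t])
    with True show ?thesis by (simp add: velocity_def coord_vector_apply)
  next
    case False
    then show ?thesis by (auto simp: velocity_def coord_vector_apply)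
  qed
qed

text \<open>\<open>curve_differentiable\<close> speaks of one chart; the change of charts supplies
  the derivative in every other chart and the transformation rule of a tangent vector.\<close>

lemma curve_differentiableD:
  assumes ab: "a < b" and cont: "continuous_on {a..b} \<gamma>" and t: "t \<in> {a..b}"
    and D: "curve_differentiable A {a..b} \<gamma> t"
  shows "velocity A {a..b} \<gamma> t \<in> tangent_space A (\<gamma> t)"
    "c \<in> A \<Longrightarrow> \<gamma> t \<in> fst c \<Longrightarrow> ((snd c \<circ> \<gamma>) has_vector_derivative velocity A {a..b} \<gamma> t c) (at t within {a..b})"
proof -
  obtain d where d: "d \<in> A" "\<gamma> t \<in> fst d" "(snd d \<circ> \<gamma>) differentiable (at t within {a..b})"
    using D unfolding curve_differentiable_def by blast
  then obtain w where w: "((snd d \<circ> \<gamma>) has_vector_derivative w) (at t within {a..b})"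
    using vector_derivative_works by blast
  have v: "velocity A {a..b} \<gamma> t = coord_vector A d (\<gamma> t) w"
    by (rule velocity_eq_coord_vector[OF ab cont t d(1,2) w])
  show "velocity A {a..b} \<gamma> t \<in> tangent_space A (\<gamma> t)"
    unfolding v by (rule coord_vector_tangent[OF d(1,2)])
  assume c: "c \<in> A" "\<gamma> t \<in> fst c"
  show "((snd c \<circ> \<gamma>) has_vector_derivative velocity A {a..b} \<gamma> t c) (at t within {a..b})"
    unfolding v using curve_chart_change[OF d(1) c(1) d(2) c(2) t cont w] c by (simp add: coord_vector_apply)
qed

lemma geodesicD:
  assumes "geodesic A g I \<gamma>"
  shows "continuous_on I \<gamma>"
    "t \<in> I \<Longrightarrow> c \<in> A \<Longrightarrow> \<gamma> t \<in> fst c \<Longrightarrow> ((snd c \<circ> \<gamma>) has_vector_derivative velocity A I \<gamma> t c) (at t within I)"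
    "t \<in> I \<Longrightarrow> c \<in> A \<Longrightarrow> \<gamma> t \<in> fst c \<Longrightarrow> ((\<lambda>s. velocity A I \<gamma> s c) has_vector_derivative
       - C11_form.Chr (mc c) (snd c (\<gamma> t)) (velocity A I \<gamma> t c) (velocity A I \<gamma> t c)) (at t within I)"
proof -
  show "continuous_on I \<gamma>" using assms by (simp add: geodesic_def)
  assume tc: "t \<in> I" "c \<in> A" "\<gamma> t \<in> fst c"
  then have "((snd c \<circ> \<gamma>) has_vector_derivative velocity A I \<gamma> t c) (at t within I) \<and>
        ((\<lambda>s. velocity A I \<gamma> s c) has_vector_derivative
           - christoffel A g c (snd c (\<gamma> t)) (velocity A I \<gamma> t c) (velocity A I \<gamma> t c)) (at t within I)"
    using assms unfolding geodesic_def by blast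
  then show "((snd c \<circ> \<gamma>) has_vector_derivative velocity A I \<gamma> t c) (at t within I)"
    "((\<lambda>s. velocity A I \<gamma> s c) has_vector_derivative
       - C11_form.Chr (mc c) (snd c (\<gamma> t)) (velocity A I \<gamma> t c) (velocity A I \<gamma> t c)) (at t within I)"
    by (simp_all add: christoffel_Chr[OF tc(2)])
qed

lemma geodesic_velocity_tangent:
  assumes "geodesic A g {a..b} \<gamma>" "a < b" "t \<in> {a..b}"
  shows "velocity A {a..b} \<gamma> t \<in> tangent_space A (\<gamma> t)"
proof -
  obtain c where c: "c \<in> A" "\<gamma> t \<in> fst c" by (rule chart_at)
  have "curve_differentiable A {a..b} \<gamma> t"
    unfolding curve_differentiable_def
    using c geodesicD(2)[OF assms(1,3) c] by (auto intro: differentiableI_vector)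
  then show ?thesis
    by (rule curve_differentiableD(1)[OF assms(2) geodesicD(1)[OF assms(1)] assms(3)])
qed

lemma geodesic_in_chart:
  assumes geo: "geodesic A g {0..1} \<gamma>" and c: "c \<in> A" and ab: "{a..b} \<subseteq> {0..1}" and im: "\<gamma> ` {a..b} \<subseteq> fst c"
  shows "C11_form.geodesic_coords (snd c ` fst c) (mc c) {a..b} (snd c \<circ> \<gamma>) (\<lambda>t. vl \<gamma> t c)"
  unfolding C11_form.geodesic_coords_def[OF mc_form[OF c]]
proof (intro ballI conjI)
  fix t assume t: "t \<in> {a..b}"
  then have t': "t \<in> {0..1}" "\<gamma> t \<in> fst c" using ab im by auto
  show "(snd c \<circ> \<gamma>) t \<in> snd c ` fst c" using t' by simp
  show "((snd c \<circ> \<gamma>) has_vector_derivative vl \<gamma> t c) (at t within {a..b})"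
    by (rule has_vector_derivative_within_subset[OF geodesicD(2)[OF geo t'(1) c t'(2)] ab])
  have "((\<lambda>t. vl \<gamma> t c) has_vector_derivative
     - C11_form.Chr (mc c) (snd c (\<gamma> t)) (vl \<gamma> t c) (vl \<gamma> t c)) (at t within {a..b})"
    by (rule has_vector_derivative_within_subset[OF geodesicD(3)[OF geo t'(1) c t'(2)] ab])
  then show "((\<lambda>t. vl \<gamma> t c) has_vector_derivative
     - C11_form.Chr (mc c) ((snd c \<circ> \<gamma>) t) (vl \<gamma> t c) (vl \<gamma> t c)) (at t within {a..b})"
    by simp
qed

lemma curve_locally_in_open:
  assumes "continuous_on {0..1::real} \<gamma>" "t0 \<in> {0..1}" "open T" "\<gamma> t0 \<in> T"
  obtains h where "0 < h" "\<And>t. t \<in> {0..1} \<Longrightarrow> \<bar>t - t0\<bar> \<le> h \<Longrightarrow> \<gamma> t \<in> T"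
proof -
  have op: "openin (top_of_set {0..1}) ({0..1} \<inter> \<gamma> -` T)"
    using assms by (simp add: continuous_openin_preimage_gen)
  have mem: "t0 \<in> {0..1} \<inter> \<gamma> -` T" using assms by simp
  obtain r where r: "r > 0" "\<forall>s\<in>{0..1}. dist s t0 < r \<longrightarrow> s \<in> {0..1} \<inter> \<gamma> -` T"
    using op mem unfolding openin_euclidean_subtopology_iff by blast
  show ?thesis
  proof (rule that[of "r / 2"])
    show "\<gamma> t \<in> T" if "t \<in> {0..1}" "\<bar>t - t0\<bar> \<le> r / 2" for t
    proof -
      have "dist t t0 < r" using that(2) r(1) by (simp add: dist_real_def)
      then show ?thesis using r(2) that(1) by blast
    qed
  qed (use r in simp)
qed

text \<open>Continuity of position and velocity; the strict bound at \<open>t0\<close> leaves room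
  for nearby times.\<close>

lemma geodesic_locally_slow:
  assumes geo: "geodesic A g {0..1} \<gamma>" and t0: "t0 \<in> {0..1}" and c: "c \<in> A" "\<gamma> t0 \<in> fst c"
    and r: "0 < r" and M: "norm (vl \<gamma> t0 c) < M"
  obtains h where "0 < h" "\<And>t. t \<in> {0..1} \<Longrightarrow> \<bar>t - t0\<bar> \<le> h \<Longrightarrow> \<gamma> t \<in> fst c"
    "\<And>a b. {a..b} \<subseteq> {0..1} \<Longrightarrow> {a..b} \<subseteq> cball t0 h \<Longrightarrow>
      C11_form.slow_geodesic (snd c ` fst c) (mc c) {a..b} (snd c (\<gamma> t0)) r M (snd c \<circ> \<gamma>) (\<lambda>t. vl \<gamma> t c)"
proof -
  have cont: "continuous_on {0..1} \<gamma>" by (rule geodesicD(1)[OF geo])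
  obtain h1 where h1: "0 < h1" "\<And>t. t \<in> {0..1} \<Longrightarrow> \<bar>t - t0\<bar> \<le> h1 \<Longrightarrow> \<gamma> t \<in> fst c"
    using curve_locally_in_open[OF cont t0 chart_open(1)[OF c(1)] c(2)] by metis
  have "continuous (at t0 within {0..1}) (snd c \<circ> \<gamma>)"
    by (rule has_vector_derivative_continuous[OF geodesicD(2)[OF geo t0 c]])
  then obtain h2 where h2: "0 < h2" "\<forall>t\<in>{0..1}. dist t t0 < h2 \<longrightarrow> dist ((snd c \<circ> \<gamma>) t) ((snd c \<circ> \<gamma>) t0) < r"
    using r unfolding continuous_within_eps_delta by blast
  have "continuous (at t0 within {0..1}) (\<lambda>t. vl \<gamma> t c)"
    by (rule has_vector_derivative_continuous[OF geodesicD(3)[OF geo t0 c]])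
  moreover have "0 < M - norm (vl \<gamma> t0 c)" using M by simp
  ultimately obtain h3 where h3: "0 < h3" "\<forall>t\<in>{0..1}. dist t t0 < h3 \<longrightarrow>
      dist (vl \<gamma> t c) (vl \<gamma> t0 c) < M - norm (vl \<gamma> t0 c)"
    unfolding continuous_within_eps_delta by blast
  define h where "h = min h1 (min (h2 / 2) (h3 / 2))"
  have h: "0 < h" "h \<le> h1" "h < h2" "h < h3" using h1 h2 h3 by (auto simp: h_def min_def)
  show ?thesis
  proof (rule that[OF h(1)])
    show "\<gamma> t \<in> fst c" if "t \<in> {0..1}" "\<bar>t - t0\<bar> \<le> h" for t
      using h1(2)[OF that(1)] that(2) h(2) by simp
    fix a b assume ab: "{a..b} \<subseteq> {0..1}" "{a..b} \<subseteq> cball t0 h"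
    have near: "t \<in> {0..1}" "\<bar>t - t0\<bar> \<le> h" if "t \<in> {a..b}" for t
      using ab that by (auto simp: dist_real_def subset_iff)
    have im: "\<gamma> ` {a..b} \<subseteq> fst c"
      using h1(2) near h(2) by force
    have "snd c (\<gamma> t) \<in> cball (snd c (\<gamma> t0)) r \<and> norm (vl \<gamma> t c) \<le> M" if t: "t \<in> {a..b}" for t
    proof -
      have d: "dist t t0 < h2" "dist t t0 < h3" using near[OF t] h by (auto simp: dist_real_def)
      have "dist (snd c (\<gamma> t)) (snd c (\<gamma> t0)) < r" using h2(2) near(1)[OF t] d by simp
      moreover have "dist (vl \<gamma> t c) (vl \<gamma> t0 c) < M - norm (vl \<gamma> t0 c)"
        using h3(2) near(1)[OF t] d by simp
      moreover have "norm (vl \<gamma> t c) \<le> dist (vl \<gamma> t c) (vl \<gamma> t0 c) + norm (vl \<gamma> t0 c)"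
        unfolding dist_norm using norm_triangle_sub[of "vl \<gamma> t c" "vl \<gamma> t0 c"] by simp
      ultimately show ?thesis by (simp add: dist_commute)
    qed
    then show "C11_form.slow_geodesic (snd c ` fst c) (mc c) {a..b} (snd c (\<gamma> t0)) r M (snd c \<circ> \<gamma>) (\<lambda>t. vl \<gamma> t c)"
      unfolding C11_form.slow_geodesic_def[OF mc_form[OF c(1)]]
      using geodesic_in_chart[OF geo c(1) ab(1) im] by simp
  qed
qed

text \<open>Local uniqueness in a chart, continued along \<open>{0..1}\<close>. Position and
  velocity are propagated together, since only both determine a geodesic.\<close>

theorem geodesic_unique:
  assumes g1: "geodesic A g {0..1} \<gamma>1" and g2: "geodesic A g {0..1} \<gamma>2"
    and s: "s \<in> {0..1}" "\<gamma>1 s = \<gamma>2 s" "vl \<gamma>1 s = vl \<gamma>2 s" and t: "t \<in> {0..1}"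
  shows "\<gamma>1 t = \<gamma>2 t \<and> vl \<gamma>1 t = vl \<gamma>2 t"
proof (rule interval_connected_induction[of "\<lambda>t. \<gamma>1 t = \<gamma>2 t \<and> vl \<gamma>1 t = vl \<gamma>2 t" s t])
  show "\<gamma>1 s = \<gamma>2 s \<and> vl \<gamma>1 s = vl \<gamma>2 s" using s by simp
  fix t0 :: real assume t0: "t0 \<in> {0..1}"
  show "\<exists>h>0. \<forall>x\<in>{0..1} \<inter> ball t0 h. \<forall>y\<in>{0..1} \<inter> ball t0 h.
     \<gamma>1 x = \<gamma>2 x \<and> vl \<gamma>1 x = vl \<gamma>2 x \<longrightarrow>
     \<gamma>1 y = \<gamma>2 y \<and> vl \<gamma>1 y = vl \<gamma>2 y"
  proof (cases "\<gamma>1 t0 = \<gamma>2 t0")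
    case False
    \<comment> \<open>If the curves are apart at \<open>t0\<close>, they stay apart nearby by the
      Hausdorff property, and the implication holds vacuously.\<close>
    from hausdorff[OF this]
    obtain T1 T2 where T: "open T1" "open T2" "\<gamma>1 t0 \<in> T1" "\<gamma>2 t0 \<in> T2" "T1 \<inter> T2 = {}" by blast
    obtain h1 where h1: "0 < h1" "\<And>t. t \<in> {0..1} \<Longrightarrow> \<bar>t - t0\<bar> \<le> h1 \<Longrightarrow> \<gamma>1 t \<in> T1"
      using curve_locally_in_open[OF geodesicD(1)[OF g1] t0 T(1,3)] by blast
    obtain h2 where h2: "0 < h2" "\<And>t. t \<in> {0..1} \<Longrightarrow> \<bar>t - t0\<bar> \<le> h2 \<Longrightarrow> \<gamma>2 t \<in> T2"
      using curve_locally_in_open[OF geodesicD(1)[OF g2] t0 T(2,4)] by blast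
    have "\<gamma>1 x \<noteq> \<gamma>2 x" if "x \<in> {0..1} \<inter> ball t0 (min h1 h2)" for x
    proof -
      have "x \<in> {0..1}" "\<bar>x - t0\<bar> \<le> h1" "\<bar>x - t0\<bar> \<le> h2"
        using that by (auto simp: dist_real_def)
      then have "\<gamma>1 x \<in> T1" "\<gamma>2 x \<in> T2" using h1(2) h2(2) by blast+
      then show ?thesis using T(5) by auto
    qed
    then show ?thesis using h1(1) h2(1) by (intro exI[of _ "min h1 h2"]) auto
  next
    case True
    obtain c where c: "c \<in> A" "\<gamma>1 t0 \<in> fst c" by (rule chart_at)
    have c2: "\<gamma>2 t0 \<in> fst c" using c(2) True by simp
    interpret C11_form "snd c ` fst c" "mc c" by (rule mc_form[OF c(1)])
    have "snd c (\<gamma>1 t0) \<in> snd c ` fst c" using c(2) by simp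
    then obtain r C where gb: "good_ball (snd c (\<gamma>1 t0)) r C" by (rule good_ball_exists)
    define M where "M = max (norm (vl \<gamma>1 t0 c)) (norm (vl \<gamma>2 t0 c)) + 1"
    have M: "norm (vl \<gamma>1 t0 c) < M" "norm (vl \<gamma>2 t0 c) < M" by (auto simp: M_def)
    obtain h0 where h0: "0 < h0"
      "\<And>a b x u y v s t. b - a \<le> h0 \<Longrightarrow> slow_geodesic {a..b} (snd c (\<gamma>1 t0)) r M x u \<Longrightarrow> slow_geodesic {a..b} (snd c (\<gamma>1 t0)) r M y v \<Longrightarrow>
        s \<in> {a..b} \<Longrightarrow> x s = y s \<Longrightarrow> u s = v s \<Longrightarrow> t \<in> {a..b} \<Longrightarrow> x t = y t \<and> u t = v t"
      using geodesic_coords_unique[OF gb, of M] by blast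
    obtain h1 where h1: "0 < h1" "\<And>t. t \<in> {0..1} \<Longrightarrow> \<bar>t - t0\<bar> \<le> h1 \<Longrightarrow> \<gamma>1 t \<in> fst c"
      "\<And>a b. {a..b} \<subseteq> {0..1} \<Longrightarrow> {a..b} \<subseteq> cball t0 h1 \<Longrightarrow> slow_geodesic {a..b} (snd c (\<gamma>1 t0)) r M (snd c \<circ> \<gamma>1) (\<lambda>t. vl \<gamma>1 t c)"
      using geodesic_locally_slow[OF g1 t0 c good_ballD(1)[OF gb] M(1)] by blast
    obtain h2 where h2: "0 < h2" "\<And>t. t \<in> {0..1} \<Longrightarrow> \<bar>t - t0\<bar> \<le> h2 \<Longrightarrow> \<gamma>2 t \<in> fst c"
      "\<And>a b. {a..b} \<subseteq> {0..1} \<Longrightarrow> {a..b} \<subseteq> cball t0 h2 \<Longrightarrow> slow_geodesic {a..b} (snd c (\<gamma>2 t0)) r M (snd c \<circ> \<gamma>2) (\<lambda>t. vl \<gamma>2 t c)"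
      using geodesic_locally_slow[OF g2 t0 c(1) c2 good_ballD(1)[OF gb] M(2)] by blast
    define h where "h = min (h0 / 2) (min h1 h2)"
    have h: "0 < h" "2 * h \<le> h0" "h \<le> h1" "h \<le> h2" using h0 h1 h2 by (auto simp: h_def)
    obtain a b where ab: "a < b" "{a..b} \<subseteq> {0..1}" "b - a \<le> 2 * h" "{a..b} \<subseteq> cball t0 h" "{0..1} \<inter> ball t0 h \<subseteq> {a..b}"
      using interval_neighbourhood[OF t0 h(1)] by blast
    have cb: "{a..b} \<subseteq> cball t0 h1" "{a..b} \<subseteq> cball t0 h2"
      using ab(4) h(3,4) by (meson order.trans subset_cball)+
    have 1: "slow_geodesic {a..b} (snd c (\<gamma>1 t0)) r M (snd c \<circ> \<gamma>1) (\<lambda>t. vl \<gamma>1 t c)"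
      by (rule h1(3)[OF ab(2) cb(1)])
    have 2: "slow_geodesic {a..b} (snd c (\<gamma>1 t0)) r M (snd c \<circ> \<gamma>2) (\<lambda>t. vl \<gamma>2 t c)"
      unfolding True by (rule h2(3)[OF ab(2) cb(2)])
    have "\<gamma>1 y = \<gamma>2 y \<and> vl \<gamma>1 y = vl \<gamma>2 y"
      if x: "x \<in> {0..1} \<inter> ball t0 h" and y: "y \<in> {0..1} \<inter> ball t0 h"
        and eq: "\<gamma>1 x = \<gamma>2 x" "vl \<gamma>1 x = vl \<gamma>2 x" for x y
    proof -
      have xy: "x \<in> {a..b}" "y \<in> {a..b}" using x y ab(5) by auto
      have y1: "y \<in> {0..1}" and yh: "\<bar>y - t0\<bar> \<le> h" using y by (auto simp: dist_real_def)
      have yc: "\<gamma>1 y \<in> fst c" "\<gamma>2 y \<in> fst c" using h1(2)[OF y1] h2(2)[OF y1] yh h by auto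
      have "(snd c \<circ> \<gamma>1) y = (snd c \<circ> \<gamma>2) y \<and> vl \<gamma>1 y c = vl \<gamma>2 y c"
        by (rule h0(2)[OF order.trans[OF ab(3) h(2)] 1 2 xy(1) _ _ xy(2)]) (use eq in simp_all)
      then have pos: "\<gamma>1 y = \<gamma>2 y" and vel: "vl \<gamma>1 y c = vl \<gamma>2 y c"
        using inj_onD[OF chart_inj[OF c(1)] _ yc] by auto
      have "vl \<gamma>1 y = vl \<gamma>2 y"
        by (rule tangent_eqI[where v = "vl \<gamma>1 y" and w = "vl \<gamma>2 y" and c = c, OF _ _ c(1) yc(1) vel])
          (use geodesic_velocity_tangent[OF g1 zero_less_one y1] geodesic_velocity_tangent[OF g2 zero_less_one y1] pos in auto)
      with pos show ?thesis by simp
    qed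
    then show ?thesis using h(1) by blast
  qed
qed (use s t in auto)

lemma velocity_zero_of_constant:
  assumes t: "t \<in> {0..1}"
  shows "vl (\<lambda>_. q) t = (\<lambda>_. 0)"
proof
  fix c :: "('a, 'e) chart"
  have "vector_derivative (snd c \<circ> (\<lambda>_. q)) (at t within {0..1}) = 0"
    by (rule vector_derivative_within_closed_interval[OF zero_less_one t]) (simp add: comp_def)
  then show "vl (\<lambda>_. q) t c = 0" by (simp add: velocity_def)
qed

text \<open>Serves as the comparison geodesic for zero velocity.\<close>

lemma geodesic_constant: "geodesic A g {0..1} (\<lambda>_. q)"
  unfolding geodesic_def
proof (intro conjI ballI impI)
  fix t :: real and c assume t: "t \<in> {0..1}" and c: "c \<in> A" "q \<in> fst c"
  interpret C11_form "snd c ` fst c" "mc c" by (rule mc_form[OF c(1)])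
  have "Chr (snd c q) 0 0 = 0"
    using Chr_scale[of "snd c q" 0 0] c by simp
  then have "((\<lambda>s. 0) has_vector_derivative
     - christoffel A g c (snd c q) (vl (\<lambda>_. q) t c) (vl (\<lambda>_. q) t c)) (at t within {0..1})"
    by (simp add: velocity_zero_of_constant[OF t] christoffel_Chr[OF c(1)])
  then show "((\<lambda>s. vl (\<lambda>_. q) s c) has_vector_derivative
     - christoffel A g c (snd c q) (vl (\<lambda>_. q) t c) (vl (\<lambda>_. q) t c)) (at t within {0..1})"
    by (rule has_vector_derivative_transform_within[OF _ zero_less_one t]) (simp add: velocity_zero_of_constant)
  show "((snd c \<circ> (\<lambda>_. q)) has_vector_derivative vl (\<lambda>_. q) t c) (at t within {0..1})"
    by (simp add: velocity_zero_of_constant[OF t] comp_def)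
qed simp

text \<open>Slowing down by \<open>r\<close> multiplies velocities by \<open>r\<close> and
  accelerations by \<open>r\<close> squared, and the Christoffel term is quadratic in the velocity.
  This identifies rays in the tangent space with geodesics.\<close>

lemma geodesic_rescale:
  assumes geo: "geodesic A g {0..1} \<gamma>" and r: "0 \<le> r" "r \<le> 1"
  shows "geodesic A g {0..1} (\<lambda>t. \<gamma> (r * t))"
    "t \<in> {0..1} \<Longrightarrow> vl (\<lambda>t. \<gamma> (r * t)) t = (\<lambda>c. r *\<^sub>R vl \<gamma> (r * t) c)"
proof -
  have rt: "r * t \<in> {0..1}" if "t \<in> {0..1}" for t
    using that r mult_mono[of r 1 t 1] by auto
  then have sub: "(\<lambda>t. r * t) ` {0..1} \<subseteq> {0..1}" by blast
  have D: "((f \<circ> (\<lambda>t. r * t)) has_vector_derivative r *\<^sub>R f') (at t within {0..1})"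
    if "t \<in> {0..1}" "(f has_vector_derivative f') (at (r * t) within {0..1})" for f :: "real \<Rightarrow> 'e" and f' t
  proof (rule vector_diff_chain_within)
    show "((\<lambda>t. r * t) has_vector_derivative r) (at t within {0..1})"
      by (auto simp flip: has_real_derivative_iff_has_vector_derivative intro!: derivative_eq_intros)
    show "(f has_vector_derivative f') (at (r * t) within (\<lambda>t. r * t) ` {0..1})"
      by (rule has_vector_derivative_within_subset[OF that(2) sub])
  qed
  have cont: "continuous_on {0..1} (\<lambda>t. \<gamma> (r * t))"
    by (rule continuous_on_compose2[OF geodesicD(1)[OF geo]]) (use sub in \<open>auto intro!: continuous_intros\<close>)
  have D1: "((snd c \<circ> (\<lambda>t. \<gamma> (r * t))) has_vector_derivative r *\<^sub>R vl \<gamma> (r * t) c) (at t within {0..1})"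
    if t: "t \<in> {0..1}" and c: "c \<in> A" "\<gamma> (r * t) \<in> fst c" for t c
    using D[OF t geodesicD(2)[OF geo rt[OF t] c]] by (simp add: comp_def)
  have vel: "vl (\<lambda>t. \<gamma> (r * t)) t = (\<lambda>c. r *\<^sub>R vl \<gamma> (r * t) c)" if t: "t \<in> {0..1}" for t
  proof
    fix c
    show "vl (\<lambda>t. \<gamma> (r * t)) t c = r *\<^sub>R vl \<gamma> (r * t) c"
    proof (cases "c \<in> A \<and> \<gamma> (r * t) \<in> fst c")
      case True
      then show ?thesis
        using vector_derivative_within_closed_interval[OF zero_less_one t D1[OF t, of c]]
        by (simp add: velocity_def[of A "{0..1}" "\<lambda>t. \<gamma> (r * t)"])
    qed (auto simp: velocity_def)
  qed
  then show "t \<in> {0..1} \<Longrightarrow> vl (\<lambda>t. \<gamma> (r * t)) t = (\<lambda>c. r *\<^sub>R vl \<gamma> (r * t) c)" .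
  show "geodesic A g {0..1} (\<lambda>t. \<gamma> (r * t))"
    unfolding geodesic_def
  proof (intro conjI ballI impI cont)
    fix t :: real and c assume t: "t \<in> {0..1}" and c: "c \<in> A" "\<gamma> (r * t) \<in> fst c"
    interpret C11_form "snd c ` fst c" "mc c" by (rule mc_form[OF c(1)])
    let ?v = "vl \<gamma> (r * t) c"
    show "((snd c \<circ> (\<lambda>t. \<gamma> (r * t))) has_vector_derivative vl (\<lambda>t. \<gamma> (r * t)) t c) (at t within {0..1})"
      unfolding vel[OF t] by (rule D1[OF t c])
    have "((\<lambda>s. vl \<gamma> (r * s) c) has_vector_derivative r *\<^sub>R (- Chr (snd c (\<gamma> (r * t))) ?v ?v)) (at t within {0..1})"
      using D[OF t geodesicD(3)[OF geo rt[OF t] c]] by (simp add: comp_def)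
    then have "((\<lambda>s. r *\<^sub>R vl \<gamma> (r * s) c) has_vector_derivative r *\<^sub>R (r *\<^sub>R (- Chr (snd c (\<gamma> (r * t))) ?v ?v))) (at t within {0..1})"
      by (rule bounded_linear.has_vector_derivative[OF bounded_linear_scaleR_right])
    then have "((\<lambda>s. vl (\<lambda>t. \<gamma> (r * t)) s c) has_vector_derivative r *\<^sub>R (r *\<^sub>R (- Chr (snd c (\<gamma> (r * t))) ?v ?v))) (at t within {0..1})"
      by (rule has_vector_derivative_transform_within[OF _ zero_less_one t]) (simp add: vel)
    moreover have "r *\<^sub>R (r *\<^sub>R (- Chr (snd c (\<gamma> (r * t))) ?v ?v)) = - Chr (snd c (\<gamma> (r * t))) (r *\<^sub>R ?v) (r *\<^sub>R ?v)"
      using c by (simp add: Chr_scale power2_eq_square)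
    ultimately show "((\<lambda>s. vl (\<lambda>t. \<gamma> (r * t)) s c) has_vector_derivative
       - christoffel A g c (snd c (\<gamma> (r * t))) (vl (\<lambda>t. \<gamma> (r * t)) t c) (vl (\<lambda>t. \<gamma> (r * t)) t c)) (at t within {0..1})"
      by (simp only: vel[OF t] christoffel_Chr[OF c(1)])
  qed
qed

lemma geodesic_energy:
  assumes geo: "geodesic A g {0..1} \<gamma>" and st: "s \<in> {0..1}" "t \<in> {0..1}"
  shows "g (\<gamma> t) (vl \<gamma> t) (vl \<gamma> t) = g (\<gamma> s) (vl \<gamma> s) (vl \<gamma> s)"
proof (rule interval_connected_induction[of
    "\<lambda>t. g (\<gamma> t) (vl \<gamma> t) (vl \<gamma> t) = g (\<gamma> s) (vl \<gamma> s) (vl \<gamma> s)" s t])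
  fix t0 :: real assume t0: "t0 \<in> {0..1}"
  obtain c where c: "c \<in> A" "\<gamma> t0 \<in> fst c" by (rule chart_at)
  interpret C11_form "snd c ` fst c" "mc c" by (rule mc_form[OF c(1)])
  obtain h where h: "0 < h" "\<And>t. t \<in> {0..1} \<Longrightarrow> \<bar>t - t0\<bar> \<le> h \<Longrightarrow> \<gamma> t \<in> fst c"
    using curve_locally_in_open[OF geodesicD(1)[OF geo] t0 chart_open(1)[OF c(1)] c(2)] by blast
  obtain a b where ab: "a < b" "{a..b} \<subseteq> {0..1}" "b - a \<le> 2 * h" "{a..b} \<subseteq> cball t0 h" "{0..1} \<inter> ball t0 h \<subseteq> {a..b}"
    using interval_neighbourhood[OF t0 h(1)] by blast
  have inc: "\<gamma> t \<in> fst c" if "t \<in> {a..b}" for t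
  proof -
    have "t \<in> {0..1}" "t \<in> cball t0 h" using that ab by blast+
    then show ?thesis by (intro h(2)) (auto simp: dist_real_def)
  qed
  have e: "g (\<gamma> t) (vl \<gamma> t) (vl \<gamma> t)
      = mc c ((snd c \<circ> \<gamma>) t) (vl \<gamma> t c) (vl \<gamma> t c)" if t: "t \<in> {a..b}" for t
  proof -
    have "t \<in> {0..1}" using t ab by blast
    from geodesic_velocity_tangent[OF geo zero_less_one this] show ?thesis
      using g_tangent[OF c(1) inc[OF t]] by simp
  qed
  have gc: "geodesic_coords {a..b} (snd c \<circ> \<gamma>) (\<lambda>t. vl \<gamma> t c)"
    by (rule geodesic_in_chart[OF geo c(1) ab(2)]) (use inc in blast)
  have "g (\<gamma> x) (vl \<gamma> x) (vl \<gamma> x) = g (\<gamma> y) (vl \<gamma> y) (vl \<gamma> y)"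
    if "x \<in> {a..b}" "y \<in> {a..b}" for x y
    unfolding e[OF that(1)] e[OF that(2)] by (rule geodesic_energy_constant[OF gc that])
  then have "g (\<gamma> x) (vl \<gamma> x) (vl \<gamma> x) = g (\<gamma> y) (vl \<gamma> y) (vl \<gamma> y)"
    if "x \<in> {0..1} \<inter> ball t0 h" "y \<in> {0..1} \<inter> ball t0 h" for x y
    using that ab(5) by (meson subsetD)
  then show "\<exists>h>0. \<forall>x\<in>{0..1} \<inter> ball t0 h. \<forall>y\<in>{0..1} \<inter> ball t0 h.
     g (\<gamma> x) (vl \<gamma> x) (vl \<gamma> x) = g (\<gamma> s) (vl \<gamma> s) (vl \<gamma> s) \<longrightarrow>
     g (\<gamma> y) (vl \<gamma> y) (vl \<gamma> y) = g (\<gamma> s) (vl \<gamma> s) (vl \<gamma> s)"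
    using h(1) by metis
qed (use st in auto)

text \<open>By uniqueness a geodesic whose velocity vanishes once is constant.\<close>

lemma geodesic_velocity_nonzero:
  assumes geo: "geodesic A g {0..1} \<gamma>" and st: "s \<in> {0..1}" "t \<in> {0..1}"
    and nz: "vl \<gamma> s \<noteq> (\<lambda>_. 0)"
  shows "vl \<gamma> t \<noteq> (\<lambda>_. 0)"
proof
  assume 0: "vl \<gamma> t = (\<lambda>_. 0)"
  have "\<gamma> s = \<gamma> t \<and> vl \<gamma> s = vl (\<lambda>_. \<gamma> t) s"
    by (rule geodesic_unique[OF geo geodesic_constant st(2) _ _ st(1)])
      (use 0 st in \<open>simp_all add: velocity_zero_of_constant\<close>)
  then show False using nz velocity_zero_of_constant[OF st(1)] by metis
qed

text \<open>The reparametrised curve will agree with a geodesic on the interval only, while its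
  values elsewhere are arbitrary; derivatives within the interval do not see the latter.\<close>

lemma geodesic_cong:
  assumes geo: "geodesic A g {a..b} \<gamma>" and eq: "\<And>t. t \<in> {a..b} \<Longrightarrow> \<delta> t = \<gamma> t"
  shows "geodesic A g {a..b} \<delta>" "t \<in> {a..b} \<Longrightarrow> velocity A {a..b} \<delta> t = velocity A {a..b} \<gamma> t"
proof -
  have D: "((snd c \<circ> \<delta>) has_vector_derivative w) (at t within {a..b}) \<longleftrightarrow> ((snd c \<circ> \<gamma>) has_vector_derivative w) (at t within {a..b})"
    if "t \<in> {a..b}" for t w and c :: "('a, 'e) chart"
    by (rule has_vector_derivative_cong_ev) (use that eq in \<open>auto intro: always_eventually\<close>)
  have vel: "velocity A {a..b} \<delta> t = velocity A {a..b} \<gamma> t" if "t \<in> {a..b}" for t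
  proof -
    have "vector_derivative (snd c \<circ> \<delta>) (at t within {a..b}) = vector_derivative (snd c \<circ> \<gamma>) (at t within {a..b})" for c :: "('a, 'e) chart"
      unfolding vector_derivative_def D[OF that] ..
    then show ?thesis by (auto simp: velocity_def eq[OF that])
  qed
  then show "t \<in> {a..b} \<Longrightarrow> velocity A {a..b} \<delta> t = velocity A {a..b} \<gamma> t" .
  show "geodesic A g {a..b} \<delta>"
    unfolding geodesic_def
  proof (intro conjI ballI impI)
    show "continuous_on {a..b} \<delta>"
      by (rule iffD2[OF continuous_on_cong[OF refl eq] geodesicD(1)[OF geo]])
    fix t c assume t: "t \<in> {a..b}" and c: "c \<in> A" "\<delta> t \<in> fst c"
    have c': "\<gamma> t \<in> fst c" using c eq[OF t] by simp
    show "((snd c \<circ> \<delta>) has_vector_derivative velocity A {a..b} \<delta> t c) (at t within {a..b})"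
      unfolding D[OF t] vel[OF t] by (rule geodesicD(2)[OF geo t c(1) c'])
    have "((\<lambda>s. velocity A {a..b} \<delta> s c) has_vector_derivative
       - C11_form.Chr (mc c) (snd c (\<gamma> t)) (velocity A {a..b} \<gamma> t c) (velocity A {a..b} \<gamma> t c)) (at t within {a..b})"
      by (rule has_vector_derivative_transform_within[OF geodesicD(3)[OF geo t c(1) c'] zero_less_one t]) (simp add: vel)
    then show "((\<lambda>s. velocity A {a..b} \<delta> s c) has_vector_derivative
       - christoffel A g c (snd c (\<delta> t)) (velocity A {a..b} \<delta> t c) (velocity A {a..b} \<delta> t c)) (at t within {a..b})"
      by (simp only: vel[OF t] eq[OF t] christoffel_Chr[OF c(1)])
  qed
qed

end

section \<open>Normal neighbourhoods\<close>

lemma half_quotient: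
  fixes k e :: real
  assumes "0 < k"
  shows "k * (e / (2 * k)) = e / 2" "(e / (2 * k)) * k = e / 2"
  using assms by simp_all

lemma vector_derivative_norm_le_lipschitz:
  fixes f :: "real \<Rightarrow> 'b::real_normed_vector"
  assumes D: "(f has_vector_derivative f') (at t within {a..b})" and ab: "a < b" "t \<in> {a..b}"
    and L: "\<And>s. s \<in> {a..b} \<Longrightarrow> norm (f s - f t) \<le> K * \<bar>s - t\<bar>"
  shows "norm f' \<le> K"
proof -
  have "((\<lambda>s. (1 / norm (s - t)) *\<^sub>R (f s - (f t + (s - t) *\<^sub>R f'))) \<longlongrightarrow> 0) (at t within {a..b})"
    using D unfolding has_vector_derivative_def has_derivative_within by (rule conjunct2)
  from tendsto_norm_zero[OF this]
  have "((\<lambda>s. norm (f s - f t - (s - t) *\<^sub>R f') / norm (s - t)) \<longlongrightarrow> 0) (at t within {a..b})"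
    by (simp add: diff_diff_eq)
  then have "((\<lambda>s. K + norm (f s - f t - (s - t) *\<^sub>R f') / norm (s - t)) \<longlongrightarrow> K + 0) (at t within {a..b})"
    by (intro tendsto_intros)
  then have lim: "((\<lambda>s. K + norm (f s - f t - (s - t) *\<^sub>R f') / norm (s - t)) \<longlongrightarrow> K) (at t within {a..b})"
    by simp
  show ?thesis
  proof (rule tendsto_lowerbound[OF lim])
    show "eventually (\<lambda>s. norm f' \<le> K + norm (f s - f t - (s - t) *\<^sub>R f') / norm (s - t)) (at t within {a..b})"
      unfolding eventually_at
    proof (intro exI[of _ 1] conjI ballI impI)
      fix s assume s: "s \<in> {a..b}" "s \<noteq> t \<and> dist s t < 1"
      have "norm ((s - t) *\<^sub>R f') \<le> norm (f s - f t) + norm (f s - f t - (s - t) *\<^sub>R f')"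
        using norm_triangle_ineq4[of "f s - f t" "f s - f t - (s - t) *\<^sub>R f'"] by simp
      then have "\<bar>s - t\<bar> * norm f' \<le> K * \<bar>s - t\<bar> + norm (f s - f t - (s - t) *\<^sub>R f')"
        using L[OF s(1)] by simp
      then show "norm f' \<le> K + norm (f s - f t - (s - t) *\<^sub>R f') / norm (s - t)"
        using s(2) by (simp add: field_simps)
    qed simp
    show "at t within {a..b} \<noteq> bot" by (rule at_within_interval_nonbot[OF ab])
  qed
qed

text \<open>The chart \<open>c0\<close> around \<open>p\<close> identifies the tangent space with
  the model space by \<open>tv\<close>. The exponential map becomes a map \<open>E\<close> on an
  open set \<open>W\<close> of a Euclidean space, where norms are available.\<close>

locale normal_nbhd = spacetime A g X
  for A :: "('a::{t2_space,second_countable_topology}, 'e::euclidean_space) chart set"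
    and g :: "('a, 'e) metric" and X :: "'a \<Rightarrow> ('a, 'e) tangent" +
  fixes p :: 'a and V :: "('a, 'e) tangent set" and U :: "'a set" and c0 :: "('a, 'e) chart"
  assumes normal: "normal_neighbourhood A g p V U" and c0: "c0 \<in> A" "p \<in> fst c0"
begin

abbreviation tv :: "'e \<Rightarrow> ('a, 'e) tangent" where "tv \<equiv> coord_vector A c0 p"

definition W :: "'e set" where "W = {u. tv u \<in> V}"

definition E :: "'e \<Rightarrow> 'a" where "E u = exp_map A g p (tv u)"

text \<open>For \<open>u\<close> in \<open>W\<close> the choice is determined on
  \<open>{0..1}\<close> by \<open>Gam_unique\<close>; outside this interval the values mean
  nothing.\<close>

definition Gam :: "'e \<Rightarrow> real \<Rightarrow> 'a" where
  "Gam u = (SOME \<gamma>. geodesic A g {0..1} \<gamma> \<and> \<gamma> 0 = p \<and> vl \<gamma> 0 = tv u)"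

definition vel :: "'e \<Rightarrow> real \<Rightarrow> ('a, 'e) tangent" where
  "vel u t = vl (Gam u) t"

definition Q :: "'e \<Rightarrow> real" where "Q u = mc c0 (snd c0 p) u u"

text \<open>The logarithm at \<open>p\<close>: the inverse of \<open>E\<close>, read in
  \<open>c0\<close>.\<close>

definition Lg :: "'a \<Rightarrow> 'e" where "Lg q = inv_into V (exp_map A g p) q c0"

lemma normal_parts:
  "open U" "p \<in> U" "openin (top_of_set (tangent_space A p)) V" "(\<lambda>_. 0) \<in> V"
  "\<And>v r. v \<in> V \<Longrightarrow> r \<in> {0..1} \<Longrightarrow> (\<lambda>c. r *\<^sub>R v c) \<in> V" "V \<subseteq> exp_domain A g p"
  "homeomorphism V U (exp_map A g p) (inv_into V (exp_map A g p))"
  "\<And>c d. c \<in> A \<Longrightarrow> d \<in> A \<Longrightarrow> p \<in> fst c \<Longrightarrow>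
     locally_lipschitz_on {u. coord_vector A c p u \<in> V \<and> exp_map A g p (coord_vector A c p u) \<in> fst d}
        (\<lambda>u. snd d (exp_map A g p (coord_vector A c p u)))"
  "\<And>c d. c \<in> A \<Longrightarrow> d \<in> A \<Longrightarrow> p \<in> fst c \<Longrightarrow>
     locally_lipschitz_on (snd d ` (U \<inter> fst d)) (\<lambda>x. inv_into V (exp_map A g p) (chart_inv d x) c)"
  using normal unfolding normal_neighbourhood_def bi_lipschitz_homeomorphism_def by simp_all

lemma Gam_geodesic:
  assumes "u \<in> W"
  shows "geodesic A g {0..1} (Gam u)" "Gam u 0 = p" "vel u 0 = tv u"
proof -
  have "tv u \<in> exp_domain A g p" using assms normal_parts(6) by (auto simp: W_def)
  then have "\<exists>\<gamma>. geodesic A g {0..1} \<gamma> \<and> \<gamma> 0 = p \<and> vl \<gamma> 0 = tv u"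
    by (simp add: exp_domain_def)
  then have "geodesic A g {0..1} (Gam u) \<and> Gam u 0 = p \<and> vl (Gam u) 0 = tv u"
    unfolding Gam_def by (rule someI_ex)
  then show "geodesic A g {0..1} (Gam u)" "Gam u 0 = p" "vel u 0 = tv u" by (auto simp: vel_def)
qed

lemma Gam_unique:
  assumes u: "u \<in> W" and \<gamma>: "geodesic A g {0..1} \<gamma>" "\<gamma> 0 = p" "vl \<gamma> 0 = tv u" and t: "t \<in> {0..1}"
  shows "\<gamma> t = Gam u t" "vl \<gamma> t = vel u t"
proof -
  have "\<gamma> t = Gam u t \<and> vl \<gamma> t = vl (Gam u) t"
    by (rule geodesic_unique[OF \<gamma>(1) Gam_geodesic(1)[OF u], of 0 t])
      (use \<gamma> Gam_geodesic[OF u] t in \<open>auto simp: vel_def\<close>)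
  then show "\<gamma> t = Gam u t" "vl \<gamma> t = vel u t" by (auto simp: vel_def)
qed

lemma E_Gam:
  assumes u: "u \<in> W"
  shows "E u = Gam u 1"
  unfolding E_def exp_map_def
proof (rule the_equality)
  show "\<exists>\<gamma>. geodesic A g {0..1} \<gamma> \<and> \<gamma> 0 = p \<and> vl \<gamma> 0 = tv u \<and> \<gamma> 1 = Gam u 1"
    using Gam_geodesic[OF u] by (intro exI[of _ "Gam u"]) (auto simp: vel_def)
  fix q assume "\<exists>\<gamma>. geodesic A g {0..1} \<gamma> \<and> \<gamma> 0 = p \<and> vl \<gamma> 0 = tv u \<and> \<gamma> 1 = q"
  then obtain \<gamma> where \<gamma>: "geodesic A g {0..1} \<gamma>" "\<gamma> 0 = p" "vl \<gamma> 0 = tv u" "\<gamma> 1 = q" by blast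
  show "q = Gam u 1" using Gam_unique(1)[OF u \<gamma>(1-3), of 1] \<gamma>(4) by simp
qed

lemma W_star: "u \<in> W \<Longrightarrow> r \<in> {0..1} \<Longrightarrow> r *\<^sub>R u \<in> W"
  using normal_parts(5)[of "tv u" r] by (simp add: W_def coord_vector_scale[OF c0])

lemma zero_in_W: "0 \<in> W"
  using normal_parts(4) by (simp add: W_def coord_vector_0[OF c0])

lemma tv_image_open:
  assumes "openin (top_of_set (tangent_space A p)) T"
  shows "open {u. tv u \<in> T}"
proof -
  obtain T' where T': "open T'" "T = tangent_space A p \<inter> T'"
    using assms by (auto simp: openin_open)
  have "{u. tv u \<in> T} = tv -` T'"
    using coord_vector_tangent[OF c0] T'(2) by auto
  moreover have "open (tv -` T')"
    using T'(1) coord_vector_continuous[OF c0] by (rule open_vimage)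
  ultimately show ?thesis by simp
qed

lemma W_open: "open W"
  unfolding W_def by (rule tv_image_open[OF normal_parts(3)])

lemma V_tangent: "V \<subseteq> tangent_space A p"
  using normal_parts(3) openin_imp_subset by auto

lemma E_continuous: "continuous_on W E"
  unfolding E_def
  by (rule continuous_on_compose2[OF homeomorphism_cont1[OF normal_parts(7)]])
    (use coord_vector_continuous[OF c0] in \<open>auto simp: W_def intro: continuous_on_subset\<close>)

lemma E_in_U: "u \<in> W \<Longrightarrow> E u \<in> U"
  using homeomorphism_image1[OF normal_parts(7)] by (auto simp: W_def E_def)

lemma Lg_E:
  assumes "u \<in> W"
  shows "Lg (E u) = u"
  using homeomorphism_apply1[OF normal_parts(7), of "tv u"] assms
  by (simp add: Lg_def E_def W_def coord_vector_self[OF c0])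

lemma Lg_U:
  assumes "q \<in> U"
  shows "tv (Lg q) = inv_into V (exp_map A g p) q" "Lg q \<in> W" "E (Lg q) = q"
proof -
  have V: "inv_into V (exp_map A g p) q \<in> V"
    using homeomorphism_image2[OF normal_parts(7)] assms by blast
  then show eq: "tv (Lg q) = inv_into V (exp_map A g p) q"
    unfolding Lg_def using V_tangent by (intro coord_vector_of_tangent[OF _ c0]) blast
  show "Lg q \<in> W" using V by (simp add: W_def eq)
  show "E (Lg q) = q"
    unfolding E_def eq by (rule homeomorphism_apply2[OF normal_parts(7) assms])
qed

lemma Gam_scale:
  assumes u: "u \<in> W" and r: "r \<in> {0..1}" and t: "t \<in> {0..1}"
  shows "Gam (r *\<^sub>R u) t = Gam u (r * t)" "vel (r *\<^sub>R u) t = (\<lambda>c. r *\<^sub>R vel u (r * t) c)"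
proof -
  note geo = Gam_geodesic[OF u]
  have r': "0 \<le> r" "r \<le> 1" using r by auto
  have v: "vl (\<lambda>t. Gam u (r * t)) 0 = tv (r *\<^sub>R u)"
    using geodesic_rescale(2)[OF geo(1) r', of 0] geo(3) by (simp add: vel_def coord_vector_scale[OF c0])
  note un = Gam_unique[OF W_star[OF u r] geodesic_rescale(1)[OF geo(1) r'] _ v t]
  show "Gam (r *\<^sub>R u) t = Gam u (r * t)" using un(1) geo(2) by simp
  show "vel (r *\<^sub>R u) t = (\<lambda>c. r *\<^sub>R vel u (r * t) c)"
    using un(2) geo(2) geodesic_rescale(2)[OF geo(1) r' t] by (simp add: vel_def)
qed

lemma E_scale: "u \<in> W \<Longrightarrow> r \<in> {0..1} \<Longrightarrow> E (r *\<^sub>R u) = Gam u r"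
  using E_Gam[OF W_star] Gam_scale(1)[of u r 1] by simp

lemma Gam_energy:
  assumes u: "u \<in> W" and t: "t \<in> {0..1}"
  shows "g (Gam u t) (vel u t) (vel u t) = Q u"
proof -
  have "g (Gam u t) (vel u t) (vel u t) = g (Gam u 0) (vel u 0) (vel u 0)"
    unfolding vel_def by (rule geodesic_energy[OF Gam_geodesic(1)[OF u]]) (use t in auto)
  then show ?thesis by (simp add: Gam_geodesic[OF u] Q_def mc_chart[OF c0])
qed

lemma vel_tangent: "u \<in> W \<Longrightarrow> t \<in> {0..1} \<Longrightarrow> vel u t \<in> tangent_space A (Gam u t)"
  unfolding vel_def by (rule geodesic_velocity_tangent[OF Gam_geodesic(1) zero_less_one])

lemma Gam_energy_chart:
  assumes "u \<in> W" "t \<in> {0..1}" "d \<in> A" "Gam u t \<in> fst d"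
  shows "mc d (snd d (Gam u t)) (vel u t d) (vel u t d) = Q u"
  using Gam_energy[OF assms(1,2)] g_tangent[OF assms(3,4) vel_tangent[OF assms(1,2)] vel_tangent[OF assms(1,2)]] by simp

lemma E_lipschitz_near:
  assumes w: "w \<in> W" and d: "d \<in> A" "E w \<in> fst d"
  obtains \<rho> L where "0 < \<rho>" "0 \<le> L" "ball w \<rho> \<subseteq> W" "\<And>v. v \<in> ball w \<rho> \<Longrightarrow> E v \<in> fst d"
    "\<And>v v'. v \<in> ball w \<rho> \<Longrightarrow> v' \<in> ball w \<rho> \<Longrightarrow> norm (snd d (E v) - snd d (E v')) \<le> L * norm (v - v')"
proof -
  define T where "T = {u. tv u \<in> V \<and> exp_map A g p (tv u) \<in> fst d}"
  have T: "T = W \<inter> E -` fst d" by (auto simp: T_def W_def E_def)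
  have "open T"
    unfolding T by (rule continuous_open_preimage[OF E_continuous W_open chart_open(1)[OF d(1)]])
  moreover have wT: "w \<in> T" using w d by (simp add: T)
  ultimately obtain r1 where r1: "0 < r1" "ball w r1 \<subseteq> T" by (meson openE)
  have "locally_lipschitz_on T (\<lambda>u. snd d (E u))"
    unfolding T_def E_def by (rule normal_parts(8)[OF c0(1) d(1) c0(2)])
  then obtain r2 L where r2: "0 < r2" "L-lipschitz_on (T \<inter> ball w r2) (\<lambda>u. snd d (E u))"
    using wT unfolding locally_lipschitz_on_def by blast
  define \<rho> where "\<rho> = min r1 r2"
  have sub: "ball w \<rho> \<subseteq> T \<inter> ball w r2" "ball w \<rho> \<subseteq> T"
    using r1(2) by (auto simp: \<rho>_def)
  show ?thesis
  proof (rule that[of \<rho> L])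
    show "0 < \<rho>" using r1 r2 by (simp add: \<rho>_def)
    show "0 \<le> L" using lipschitz_on_nonneg[OF r2(2)] .
    show "ball w \<rho> \<subseteq> W" using sub(2) T by blast
    show "E v \<in> fst d" if "v \<in> ball w \<rho>" for v using sub(2) T that by blast
    show "norm (snd d (E v) - snd d (E v')) \<le> L * norm (v - v')" if "v \<in> ball w \<rho>" "v' \<in> ball w \<rho>" for v v'
      using lipschitz_on_normD[OF r2(2)] sub(1) that by blast
  qed
qed

text \<open>The ray has to be followed beyond \<open>u\<close> for a two-sided derivative, but
  \<open>Gam u\<close> ends there. So \<open>u\<close> is seen as an interior point of the ray to a
  slightly longer vector of the open set \<open>W\<close>.\<close>

lemma radial_derivative:
  assumes u: "u \<in> W" and d: "d \<in> A" "E u \<in> fst d"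
  shows "((\<lambda>h. snd d (E ((1 + h) *\<^sub>R u))) has_vector_derivative vel u 1 d) (at 0)"
proof -
  obtain e where e: "e > 0" "ball u e \<subseteq> W" using W_open u by (meson openE)
  \<comment> \<open>Lengthening \<open>u\<close> by the factor \<open>1 + k\<close> moves it by at
    most \<open>e / 2\<close>, so the longer vector is still in \<open>W\<close>.\<close>
  define k where "k = e / (2 * (norm u + 1))"
  have n: "norm u + 1 > 0" using norm_ge_zero[of u] by linarith
  have k: "k > 0" using e n by (simp add: k_def)
  define v where "v = (1 + k) *\<^sub>R u"
  have "norm (v - u) = k * norm u" using k by (simp add: v_def scaleR_add_left)
  also have "\<dots> \<le> k * (norm u + 1)" using k by (intro mult_left_mono) auto
  also have "\<dots> = e / 2" unfolding k_def by (rule half_quotient(2)[OF n])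
  finally have "norm (v - u) < e" using e by simp
  then have v: "v \<in> W" using e(2) by (auto simp: dist_norm norm_minus_commute)
  define r0 where "r0 = 1 / (1 + k)"
  have r0: "0 < r0" "r0 < 1" using k by (auto simp: r0_def)
  have r0': "r0 \<in> {0..1}" using r0 by simp
  have uv: "u = r0 *\<^sub>R v" using k by (simp add: v_def r0_def)
  have Gu: "E u = Gam v r0" using E_scale[OF v r0'] uv by simp
  have vu: "vel u 1 d = r0 *\<^sub>R vel v r0 d" using Gam_scale(2)[OF v r0', of 1] uv by simp
  have "((snd d \<circ> Gam v) has_vector_derivative vel v r0 d) (at r0 within {0..1})"
    using geodesicD(2)[OF Gam_geodesic(1)[OF v] r0' d(1)] d(2) Gu by (simp add: vel_def)
  then have D: "((snd d \<circ> Gam v) has_vector_derivative vel v r0 d) (at ((\<lambda>h. (1 + h) * r0) 0))"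
    using r0 by (simp add: at_within_Icc_at)
  have "((\<lambda>h. (1 + h) * r0) has_vector_derivative r0) (at 0)"
    by (auto simp flip: has_real_derivative_iff_has_vector_derivative intro!: derivative_eq_intros)
  from vector_diff_chain_at[OF this D]
  have "((\<lambda>h. snd d (Gam v ((1 + h) * r0))) has_vector_derivative vel u 1 d) (at 0)"
    by (simp add: comp_def vu)
  then show ?thesis
  proof (rule has_vector_derivative_transform_within_open[of _ _ _ "{-1<..<k}"])
    fix h assume h: "h \<in> {-1<..<k}"
    have "(1 + h) * r0 \<in> {0..1}" using h k by (auto simp: r0_def field_simps)
    from E_scale[OF v this] show "snd d (Gam v ((1 + h) * r0)) = snd d (E ((1 + h) *\<^sub>R u))"
      by (simp add: uv)
  qed (use k in auto)
qed

subsection \<open>The Gauss lemma\<close>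

text \<open>The exponential map of a metric of class \<open>C\<^sup>1\<^sup>,\<^sup>1\<close> need not be differentiable, so the Gauss
  lemma is stated for the energy \<open>Q\<close> as a function of the end point: it is differentiable everywhere,
  by the first variation formula.\<close>

definition dev :: "'e \<Rightarrow> real \<Rightarrow> ('a, 'e) chart \<Rightarrow> 'e \<Rightarrow> real" where
  "dev u t d u' = t / 2 * (Q u' - Q u) - mc d (snd d (Gam u t)) (vel u t d) (snd d (Gam u' t) - snd d (Gam u t))"

text \<open>A derivative of the energy with respect to the point reached at time \<open>t\<close>.
  The error is measured in the initial vector, on which that point depends in a Lipschitz way. The
  formula compares coordinates, so the neighbouring points are required to lie in the same
  chart.\<close>

definition gauss_at :: "'e \<Rightarrow> real \<Rightarrow> ('a, 'e) chart \<Rightarrow> bool" where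
  "gauss_at u t d \<longleftrightarrow> (\<forall>e>0. \<exists>\<epsilon>>0. \<forall>u'\<in>W. norm (u' - u) < \<epsilon> \<longrightarrow> Gam u' t \<in> fst d \<and> \<bar>dev u t d u'\<bar> \<le> e * norm (u' - u))"

lemma gauss_at_0:
  assumes u: "u \<in> W" and d: "d \<in> A" "p \<in> fst d"
  shows "gauss_at u 0 d"
proof -
  interpret C11_form "snd d ` fst d" "mc d" by (rule mc_form[OF d(1)])
  have "dev u 0 d u' = 0" "Gam u' 0 = p" if "u' \<in> W" for u'
    using Gam_geodesic(2)[OF u] Gam_geodesic(2)[OF that] d G_simps(10)[of "snd d p"] by (simp_all add: dev_def)
  then show ?thesis using d by (auto simp: gauss_at_def intro: exI[of _ 1])
qed

text \<open>A difference of coordinates is not a tangent vector, but the transition map sends it to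
  its image under the derivative up to a remainder of smaller order. As coordinates of the end point
  depend on \<open>u'\<close> in a Lipschitz way, the remainder is also small relative to
  \<open>norm (u' - u)\<close>.\<close>

lemma gauss_at_chart_change:
  assumes u: "u \<in> W" and t: "t \<in> {0..1}" and c: "c \<in> A" "Gam u t \<in> fst c" and d: "d \<in> A" "Gam u t \<in> fst d"
    and gc: "gauss_at u t c"
  shows "gauss_at u t d"
  unfolding gauss_at_def
proof (intro allI impI)
  fix e :: real assume e: "e > 0"
  define q where "q = Gam u t"
  have qc: "q \<in> fst c" "q \<in> fst d" using c d by (auto simp: q_def)
  interpret D: C11_form "snd d ` fst d" "mc d" by (rule mc_form[OF d(1)])
  have qS: "snd d q \<in> snd d ` fst d" using qc by simp
  have Etu: "E (t *\<^sub>R u) = q" using E_scale[OF u t] by (simp add: q_def)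
  have tu: "t *\<^sub>R u \<in> W" by (rule W_star[OF u t])
  obtain \<rho> L where L: "0 < \<rho>" "0 \<le> L" "ball (t *\<^sub>R u) \<rho> \<subseteq> W" "\<And>v. v \<in> ball (t *\<^sub>R u) \<rho> \<Longrightarrow> E v \<in> fst c"
    "\<And>v v'. v \<in> ball (t *\<^sub>R u) \<rho> \<Longrightarrow> v' \<in> ball (t *\<^sub>R u) \<rho> \<Longrightarrow> norm (snd c (E v) - snd c (E v')) \<le> L * norm (v - v')"
    using E_lipschitz_near[OF tu c(1), of thesis] qc Etu by auto
  obtain \<rho>' L' where L': "0 < \<rho>'" "\<And>v. v \<in> ball (t *\<^sub>R u) \<rho>' \<Longrightarrow> E v \<in> fst d"
    using E_lipschitz_near[OF tu d(1), of thesis] qc Etu by auto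
  define K where "K = (\<Sum>i\<in>Basis. \<bar>mc d (snd d q) (vel u t d) i\<bar>)"
  have K: "0 \<le> K" "\<And>z. \<bar>mc d (snd d q) (vel u t d) z\<bar> \<le> K * norm z"
    unfolding K_def using linear_real_bound[OF D.lin2[OF qS]] by (auto simp: sum_nonneg)
  \<comment> \<open>The remainder of the transition map, multiplied by the Lipschitz constant
    \<open>L\<close> and by the bound \<open>K\<close> of the covector, has to stay within
    \<open>e / 2\<close>; adding 1 avoids division by zero.\<close>
  define e1 where "e1 = e / (2 * (K * L + 1))"
  have KL: "K * L + 1 > 0" using K(1) L(2) by (simp add: add_nonneg_pos)
  have e1: "e1 > 0" using e KL by (simp add: e1_def)
  have e1KL: "K * (e1 * L) \<le> e / 2"
  proof -
    have "K * (e1 * L) \<le> (K * L + 1) * e1" using e1 by (simp add: algebra_simps)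
    also have "\<dots> = e / 2" unfolding e1_def by (rule half_quotient(1)[OF KL])
    finally show ?thesis .
  qed
  obtain \<delta> where \<delta>: "\<delta> > 0" "\<And>y. norm (y - snd c q) < \<delta> \<Longrightarrow>
      norm (trans c d y - trans c d (snd c q) - Dtrans c d q (y - snd c q)) \<le> e1 * norm (y - snd c q)"
    using trans_has_derivative[OF c(1) d(1) qc] e1 unfolding has_derivative_at_alt by blast
  have "e / 2 > 0" using e by simp
  then obtain \<epsilon>1 where \<epsilon>1: "\<epsilon>1 > 0" "\<And>u'. u' \<in> W \<Longrightarrow> norm (u' - u) < \<epsilon>1 \<Longrightarrow> \<bar>dev u t c u'\<bar> \<le> e / 2 * norm (u' - u)"
    using gc unfolding gauss_at_def by blast
  define \<epsilon> where "\<epsilon> = min \<epsilon>1 (min (min \<rho> \<rho>') (\<delta> / (L + 1)))"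
  have \<epsilon>: "\<epsilon> > 0" "\<epsilon> \<le> \<epsilon>1" "\<epsilon> \<le> \<rho>" "\<epsilon> \<le> \<rho>'" "\<epsilon> \<le> \<delta> / (L + 1)"
    using \<epsilon>1 L L' \<delta> by (auto simp: \<epsilon>_def)
  show "\<exists>\<epsilon>>0. \<forall>u'\<in>W. norm (u' - u) < \<epsilon> \<longrightarrow> Gam u' t \<in> fst d \<and> \<bar>dev u t d u'\<bar> \<le> e * norm (u' - u)"
  proof (intro exI[of _ \<epsilon>] conjI ballI impI \<epsilon>(1))
    fix u' assume u': "u' \<in> W" and n: "norm (u' - u) < \<epsilon>"
    have tn: "norm (t *\<^sub>R u' - t *\<^sub>R u) \<le> norm (u' - u)"
      using t mult_right_mono[of t 1 "norm (u' - u)"] by (simp flip: scaleR_diff_right)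
    have mem: "t *\<^sub>R u' \<in> ball (t *\<^sub>R u) \<rho>" "t *\<^sub>R u' \<in> ball (t *\<^sub>R u) \<rho>'"
      using tn n \<epsilon> by (auto simp: dist_norm norm_minus_commute)
    define q' where "q' = Gam u' t"
    have Eq': "E (t *\<^sub>R u') = q'" using E_scale[OF u' t] by (simp add: q'_def)
    have q': "q' \<in> fst c" "q' \<in> fst d" using L(4)[OF mem(1)] L'(2)[OF mem(2)] Eq' by auto
    then show "Gam u' t \<in> fst d" by (simp add: q'_def)
    define \<Delta> where "\<Delta> = snd c q' - snd c q"
    have "norm \<Delta> \<le> L * norm (t *\<^sub>R u' - t *\<^sub>R u)"
      using L(5)[OF mem(1), of "t *\<^sub>R u"] L(1) Eq' Etu by (simp add: \<Delta>_def)
    also have "\<dots> \<le> L * norm (u' - u)" using tn L(2) by (rule mult_left_mono)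
    finally have \<Delta>: "norm \<Delta> \<le> L * norm (u' - u)" .
    also have "\<dots> \<le> L * \<epsilon>" using n L(2) by (intro mult_left_mono) auto
    also have "\<dots> < (L + 1) * \<epsilon>" using \<epsilon> by (simp add: algebra_simps)
    also have "\<dots> \<le> \<delta>" using \<epsilon>(5) L(2) by (simp add: field_simps)
    finally have "norm (snd c q' - snd c q) < \<delta>" by (simp add: \<Delta>_def)
    define R where "R = snd d q' - snd d q - Dtrans c d q \<Delta>"
    have "norm R \<le> e1 * norm \<Delta>"
      using \<delta>(2)[OF \<open>norm (snd c q' - snd c q) < \<delta>\<close>] q' qc
      by (simp add: R_def \<Delta>_def trans_apply[OF c(1)])
    also have "\<dots> \<le> e1 * (L * norm (u' - u))" using \<Delta> e1 by (intro mult_left_mono) auto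
    finally have R: "norm R \<le> e1 * (L * norm (u' - u))" .
    have T: "vel u t \<in> tangent_space A q" unfolding q_def by (rule vel_tangent[OF u t])
    have cv: "coord_vector A c q \<Delta> \<in> tangent_space A q" by (rule coord_vector_tangent[OF c(1) qc(1)])
    have "mc d (snd d q) (vel u t d) (Dtrans c d q \<Delta>) = mc c (snd c q) (vel u t c) \<Delta>"
      using g_tangent[OF d(1) qc(2) T cv] g_tangent[OF c(1) qc(1) T cv] coord_vector_self[OF c(1) qc(1), of \<Delta>] d(1) qc(2)
      by (simp add: coord_vector_apply)
    then have "mc d (snd d q) (vel u t d) (snd d q' - snd d q) = mc c (snd c q) (vel u t c) \<Delta> + mc d (snd d q) (vel u t d) R"
      using D.G_simps(3)[OF qS, of "vel u t d" "Dtrans c d q \<Delta>" R] by (simp add: R_def)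
    then have "dev u t d u' = dev u t c u' - mc d (snd d q) (vel u t d) R"
      by (simp add: dev_def q_def[symmetric] q'_def[symmetric] \<Delta>_def)
    then have "\<bar>dev u t d u'\<bar> \<le> \<bar>dev u t c u'\<bar> + \<bar>mc d (snd d q) (vel u t d) R\<bar>" by simp
    also have "\<dots> \<le> e / 2 * norm (u' - u) + K * (e1 * (L * norm (u' - u)))"
      using \<epsilon>1(2)[OF u'] n \<epsilon>(2) K(2)[of R] mult_left_mono[OF R K(1)] by linarith
    also have "\<dots> \<le> e / 2 * norm (u' - u) + e / 2 * norm (u' - u)"
      using mult_right_mono[OF e1KL norm_ge_zero[of "u' - u"]] by (simp add: mult.assoc)
    finally show "\<bar>dev u t d u'\<bar> \<le> e * norm (u' - u)" by simp
  qed
qed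

text \<open>By the first variation formula \<open>dev\<close> changes between two times in one chart
  by a multiple of the squared distance of the geodesics, hence of the square of
  \<open>norm (u' - u)\<close>. So smallness relative to \<open>norm (u' - u)\<close> passes from
  one time to the other.\<close>

lemma gauss_at_step:
  assumes u: "u \<in> W" and t0: "t0 \<in> {0..1}" and d: "d \<in> A" "Gam u t0 \<in> fst d"
  shows "\<exists>h>0. (\<forall>t\<in>{0..1} \<inter> ball t0 h. Gam u t \<in> fst d) \<and>
    (\<forall>s\<in>{0..1} \<inter> ball t0 h. \<forall>t\<in>{0..1} \<inter> ball t0 h. gauss_at u s d \<longrightarrow> gauss_at u t d)"
proof -
  interpret C11_form "snd d ` fst d" "mc d" by (rule mc_form[OF d(1)])
  define x0 where "x0 = snd d (Gam u t0)"
  have "x0 \<in> snd d ` fst d" using d(2) by (simp add: x0_def)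
  then obtain r C where gb: "good_ball x0 r C" by (rule good_ball_exists)
  have r: "0 < r" using good_ballD(1)[OF gb] .
  define w where "w = t0 *\<^sub>R u"
  have w: "w \<in> W" unfolding w_def by (rule W_star[OF u t0])
  have Ew: "E w = Gam u t0" unfolding w_def by (rule E_scale[OF u t0])
  then have "E w \<in> fst d" using d(2) by simp
  then obtain \<rho>1 L where L: "0 < \<rho>1" "0 \<le> L" "ball w \<rho>1 \<subseteq> W" "\<And>v. v \<in> ball w \<rho>1 \<Longrightarrow> E v \<in> fst d"
    "\<And>v v'. v \<in> ball w \<rho>1 \<Longrightarrow> v' \<in> ball w \<rho>1 \<Longrightarrow> norm (snd d (E v) - snd d (E v')) \<le> L * norm (v - v')"
    using E_lipschitz_near[OF w d(1)] by blast
  \<comment> \<open>On this ball \<open>E\<close> moves the coordinates by at most \<open>r\<close>,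
    so geodesics that run inside it remain in the good ball.\<close>
  define \<rho> where "\<rho> = min \<rho>1 (r / (L + 1))"
  have \<rho>: "0 < \<rho>" "\<rho> \<le> \<rho>1" "\<rho> \<le> r / (L + 1)" using L r by (auto simp: \<rho>_def)
  have near: "E v \<in> fst d" "snd d (E v) \<in> cball x0 r" if v: "v \<in> ball w \<rho>" for v
  proof -
    have v1: "v \<in> ball w \<rho>1" "w \<in> ball w \<rho>1" using v \<rho> by auto
    show "E v \<in> fst d" by (rule L(4)[OF v1(1)])
    have "norm (snd d (E v) - snd d (E w)) \<le> L * norm (v - w)" by (rule L(5)[OF v1])
    also have "\<dots> \<le> (L + 1) * (r / (L + 1))"
      using v L(2) \<rho>(3) by (intro mult_mono) (auto simp: dist_norm norm_minus_commute)
    also have "\<dots> = r" using L(2) by simp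
    finally show "snd d (E v) \<in> cball x0 r"
      by (simp add: dist_norm norm_minus_commute Ew x0_def)
  qed
  \<comment> \<open>Along the ray of \<open>u'\<close> the map \<open>E\<close> is Lipschitz with
    constant \<open>L * norm u'\<close>, which bounds the speed; \<open>norm u'\<close> is at most
    \<open>norm u + 1\<close> for the vectors considered.\<close>
  define M where "M = L * (norm u + 1)"
  have M: "0 \<le> M" using L(2) by (simp add: M_def)
  obtain h0 where h0: "0 < h0" "\<And>a b. a < b \<Longrightarrow> b - a \<le> h0 \<Longrightarrow> \<exists>K\<ge>0. variation_bound a b x0 r M K"
    using first_variation[OF gb M] by blast
  define \<epsilon>0 where "\<epsilon>0 = min 1 (\<rho> / 2)"
  have \<epsilon>0: "0 < \<epsilon>0" "\<epsilon>0 \<le> 1" "\<epsilon>0 \<le> \<rho> / 2" using \<rho> by (auto simp: \<epsilon>0_def)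
  \<comment> \<open>The distance from \<open>w\<close> to \<open>t *\<^sub>R u'\<close> has one part
    from the change of the vector and one from the change of time. Each gets half of
    \<open>\<rho>\<close>: the first by \<open>\<epsilon>0\<close>, the second by
    \<open>h\<close>.\<close>
  define h where "h = min (h0 / 2) (\<rho> / (2 * (norm u + 1)))"
  have n1: "0 < norm u + 1" using norm_ge_zero[of u] by linarith
  have h: "0 < h" "2 * h \<le> h0" "h * (norm u + 1) \<le> \<rho> / 2"
  proof -
    show "0 < h" "2 * h \<le> h0" using h0 \<rho> n1 by (auto simp: h_def)
    have "h * (norm u + 1) \<le> (\<rho> / (2 * (norm u + 1))) * (norm u + 1)"
      using n1 by (intro mult_right_mono) (auto simp: h_def)
    also have "\<dots> = \<rho> / 2" by (rule half_quotient(2)[OF n1])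
    finally show "h * (norm u + 1) \<le> \<rho> / 2" .
  qed
  obtain a b where ab: "a < b" "{a..b} \<subseteq> {0..1}" "b - a \<le> 2 * h" "{a..b} \<subseteq> cball t0 h" "{0..1} \<inter> ball t0 h \<subseteq> {a..b}"
    using interval_neighbourhood[OF t0 h(1)] by blast
  have inb: "t *\<^sub>R u' \<in> ball w \<rho>" if t: "t \<in> {a..b}" and u': "norm (u' - u) < \<epsilon>0" for t u'
  proof -
    have "t \<in> {0..1}" "t \<in> cball t0 h" using t ab(2,4) by blast+
    then have t': "t \<in> {0..1}" "\<bar>t - t0\<bar> \<le> h" by (auto simp: dist_real_def)
    have eq: "t *\<^sub>R u' - w = t *\<^sub>R (u' - u) + (t - t0) *\<^sub>R u" by (simp add: w_def algebra_simps)
    have "norm (t *\<^sub>R u' - w) \<le> norm (t *\<^sub>R (u' - u)) + norm ((t - t0) *\<^sub>R u)"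
      unfolding eq by (rule norm_triangle_ineq)
    also have "\<dots> \<le> 1 * norm (u' - u) + h * (norm u + 1)"
    proof (rule add_mono)
      show "norm (t *\<^sub>R (u' - u)) \<le> 1 * norm (u' - u)"
        unfolding norm_scaleR using t' by (intro mult_right_mono) auto
      show "norm ((t - t0) *\<^sub>R u) \<le> h * (norm u + 1)"
        unfolding norm_scaleR using t' h(1) by (intro mult_mono) auto
    qed
    also have "\<dots> < \<rho>" using u' \<epsilon>0 h(3) by simp
    finally show ?thesis by (simp add: dist_norm norm_minus_commute)
  qed
  have slow: "slow_geodesic {a..b} x0 r M (snd d \<circ> Gam u') (\<lambda>t. vel u' t d)"
    and inc: "\<And>t. t \<in> {a..b} \<Longrightarrow> Gam u' t \<in> fst d"
    if u': "u' \<in> W" "norm (u' - u) < \<epsilon>0" for u'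
  proof -
    have EG: "E (t *\<^sub>R u') = Gam u' t" if "t \<in> {a..b}" for t
      using E_scale[OF u'(1)] that ab(2) by blast
    show inc: "Gam u' t \<in> fst d" if t: "t \<in> {a..b}" for t
      using near(1)[OF inb[OF t u'(2)]] EG[OF t] by simp
    have cb: "snd d (Gam u' t) \<in> cball x0 r" if t: "t \<in> {a..b}" for t
      using near(2)[OF inb[OF t u'(2)]] EG[OF t] by simp
    have gc: "geodesic_coords {a..b} (snd d \<circ> Gam u') (\<lambda>t. vel u' t d)"
      unfolding vel_def by (rule geodesic_in_chart[OF Gam_geodesic(1)[OF u'(1)] d(1) ab(2)]) (use inc in blast)
    have "norm (vel u' t d) \<le> M" if t: "t \<in> {a..b}" for t
    proof -
      have "norm (vel u' t d) \<le> L * norm u'"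
      proof (rule vector_derivative_norm_le_lipschitz[OF _ ab(1) t])
        show "((snd d \<circ> Gam u') has_vector_derivative vel u' t d) (at t within {a..b})"
          using gc t by (simp add: geodesic_coords_def)
        fix s assume s: "s \<in> {a..b}"
        have m: "s *\<^sub>R u' \<in> ball w \<rho>1" "t *\<^sub>R u' \<in> ball w \<rho>1"
          using inb[OF s u'(2)] inb[OF t u'(2)] \<rho>(2) by auto
        have "norm (snd d (E (s *\<^sub>R u')) - snd d (E (t *\<^sub>R u'))) \<le> L * norm (s *\<^sub>R u' - t *\<^sub>R u')"
          by (rule L(5)[OF m])
        then show "norm ((snd d \<circ> Gam u') s - (snd d \<circ> Gam u') t) \<le> L * norm u' * \<bar>s - t\<bar>"
          by (simp add: EG[OF s] EG[OF t] mult_ac flip: scaleR_diff_left)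
      qed
      also have "\<dots> \<le> M"
        unfolding M_def using L(2) u'(2) \<epsilon>0(2) norm_triangle_sub[of u' u] by (intro mult_left_mono) auto
      finally show ?thesis .
    qed
    then show "slow_geodesic {a..b} x0 r M (snd d \<circ> Gam u') (\<lambda>t. vel u' t d)"
      unfolding slow_geodesic_def using gc cb by simp
  qed
  obtain K where K: "K \<ge> 0" "variation_bound a b x0 r M K"
    using h0(2)[OF ab(1) order.trans[OF ab(3) h(2)]] by (elim exE conjE)
  have u0: "norm (u - u) < \<epsilon>0" using \<epsilon>0 by simp
  have est: "\<bar>dev u t d u' - dev u s d u'\<bar> \<le> K * (L * norm (u' - u))\<^sup>2"
    if u': "u' \<in> W" "norm (u' - u) < \<epsilon>0" and s: "s \<in> {a..b}" and t: "t \<in> {a..b}" for u' s t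
  proof -
    have "\<forall>\<tau>\<in>{a..b}. norm ((snd d \<circ> Gam u) \<tau> - (snd d \<circ> Gam u') \<tau>) \<le> L * norm (u' - u)"
    proof
      fix \<tau> assume \<tau>: "\<tau> \<in> {a..b}"
      have \<tau>': "\<tau> \<in> {0..1}" using \<tau> ab(2) by blast
      have m: "\<tau> *\<^sub>R u \<in> ball w \<rho>1" "\<tau> *\<^sub>R u' \<in> ball w \<rho>1"
        using inb[OF \<tau> u0] inb[OF \<tau> u'(2)] \<rho>(2) by auto
      have "norm (snd d (E (\<tau> *\<^sub>R u)) - snd d (E (\<tau> *\<^sub>R u'))) \<le> L * norm (\<tau> *\<^sub>R u - \<tau> *\<^sub>R u')"
        by (rule L(5)[OF m])
      also have "\<dots> \<le> L * norm (u' - u)"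
        using \<tau>' L(2) mult_right_mono[of \<tau> 1 "norm (u' - u)"]
        by (intro mult_left_mono) (auto simp: norm_minus_commute simp flip: scaleR_diff_right)
      finally show "norm ((snd d \<circ> Gam u) \<tau> - (snd d \<circ> Gam u') \<tau>) \<le> L * norm (u' - u)"
        using E_scale[OF u \<tau>'] E_scale[OF u'(1) \<tau>'] by simp
    qed
    from K(2)[unfolded variation_bound_def, rule_format, OF slow[OF u u0] slow[OF u'] bspec[OF this] s t]
    have "\<bar>mc d (snd d (Gam u t)) (vel u t d) (snd d (Gam u' t) - snd d (Gam u t))
        - mc d (snd d (Gam u s)) (vel u s d) (snd d (Gam u' s) - snd d (Gam u s))
        - (t - s) * ((mc d (snd d (Gam u' a)) (vel u' a d) (vel u' a d) - mc d (snd d (Gam u a)) (vel u a d) (vel u a d)) / 2)\<bar>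
        \<le> K * (L * norm (u' - u))\<^sup>2" by simp
    moreover have a: "a \<in> {a..b}" "a \<in> {0..1}" using ab by auto
    ultimately show ?thesis
      unfolding Gam_energy_chart[OF u'(1) a(2) d(1) inc[OF u' a(1)]] Gam_energy_chart[OF u a(2) d(1) inc[OF u u0 a(1)]]
      by (simp add: dev_def field_simps abs_minus_commute)
  qed
  have step: "gauss_at u t d" if s: "s \<in> {a..b}" and t: "t \<in> {a..b}" and gs: "gauss_at u s d" for s t
    unfolding gauss_at_def
  proof (intro allI impI)
    fix e :: real assume e: "e > 0"
    then have "e / 2 > 0" by simp
    then obtain \<epsilon>1 where \<epsilon>1: "\<epsilon>1 > 0" "\<And>u'. u' \<in> W \<Longrightarrow> norm (u' - u) < \<epsilon>1 \<Longrightarrow> \<bar>dev u s d u'\<bar> \<le> e / 2 * norm (u' - u)"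
      using gs unfolding gauss_at_def by blast
    \<comment> \<open>For \<open>norm (u' - u)\<close> below \<open>e / (2 * k)\<close> the
      quadratic error is at most \<open>e / 2\<close> times the norm.\<close>
    define k where "k = K * L\<^sup>2 + 1"
    have k: "k > 0" "K * L\<^sup>2 \<le> k" using K(1) by (auto simp: k_def add_nonneg_pos)
    define \<epsilon> where "\<epsilon> = min \<epsilon>1 (min \<epsilon>0 (e / (2 * k)))"
    have \<epsilon>: "\<epsilon> > 0" "\<epsilon> \<le> \<epsilon>1" "\<epsilon> \<le> \<epsilon>0" "\<epsilon> \<le> e / (2 * k)"
      using \<epsilon>1 \<epsilon>0 e k by (auto simp: \<epsilon>_def)
    show "\<exists>\<epsilon>>0. \<forall>u'\<in>W. norm (u' - u) < \<epsilon> \<longrightarrow> Gam u' t \<in> fst d \<and> \<bar>dev u t d u'\<bar> \<le> e * norm (u' - u)"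
    proof (intro exI[of _ \<epsilon>] conjI ballI impI \<epsilon>(1))
      fix u' assume u': "u' \<in> W" and n: "norm (u' - u) < \<epsilon>"
      have n0: "norm (u' - u) < \<epsilon>0" using n \<epsilon> by simp
      show "Gam u' t \<in> fst d" by (rule inc[OF u' n0 t])
      have "K * (L * norm (u' - u))\<^sup>2 = (K * L\<^sup>2) * norm (u' - u) * norm (u' - u)"
        by (simp add: power2_eq_square mult_ac)
      also have "\<dots> \<le> k * (e / (2 * k)) * norm (u' - u)"
        using k n \<epsilon>(4) K(1) e by (intro mult_mono mult_nonneg_nonneg) auto
      also have "\<dots> = e / 2 * norm (u' - u)" using k by simp
      finally have "K * (L * norm (u' - u))\<^sup>2 \<le> e / 2 * norm (u' - u)" .
      moreover have "\<bar>dev u s d u'\<bar> \<le> e / 2 * norm (u' - u)" using \<epsilon>1(2)[OF u'] n \<epsilon>(2) by simp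
      ultimately have "\<bar>dev u t d u'\<bar> \<le> e / 2 * norm (u' - u) + e / 2 * norm (u' - u)"
        using est[OF u' n0 s t] by linarith
      then show "\<bar>dev u t d u'\<bar> \<le> e * norm (u' - u)" by simp
    qed
  qed
  show ?thesis
  proof (intro exI[of _ h] conjI ballI impI h(1))
    show "Gam u t \<in> fst d" if "t \<in> {0..1} \<inter> ball t0 h" for t
      using inc[OF u u0] that ab(5) by blast
    show "gauss_at u t d" if "s \<in> {0..1} \<inter> ball t0 h" "t \<in> {0..1} \<inter> ball t0 h" "gauss_at u s d" for s t
      using step that ab(5) by blast
  qed
qed

theorem gauss_lemma:
  assumes u: "u \<in> W" and d: "d \<in> A" "E u \<in> fst d" and e: "e > 0"
  obtains \<epsilon> where "\<epsilon> > 0" "\<And>u'. u' \<in> W \<Longrightarrow> norm (u' - u) < \<epsilon> \<Longrightarrow> E u' \<in> fst d \<and>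
    \<bar>(Q u' - Q u) / 2 - mc d (snd d (E u)) (vel u 1 d) (snd d (E u') - snd d (E u))\<bar> \<le> e * norm (u' - u)"
proof -
  \<comment> \<open>All charts around the current point are included, so that the chart may be
    exchanged on the way; the induction starts at time 0, where both terms of \<open>dev\<close>
    vanish.\<close>
  define P where "P t \<longleftrightarrow> (\<forall>d\<in>A. Gam u t \<in> fst d \<longrightarrow> gauss_at u t d)" for t
  have "P 1"
  proof (rule interval_connected_induction[of P 0 1])
    show "P 0" using gauss_at_0[OF u] Gam_geodesic(2)[OF u] by (simp add: P_def)
    fix t0 :: real assume t0: "t0 \<in> {0..1}"
    obtain c where c: "c \<in> A" "Gam u t0 \<in> fst c" by (rule chart_at)
    obtain h where h: "h > 0" "\<And>t. t \<in> {0..1} \<inter> ball t0 h \<Longrightarrow> Gam u t \<in> fst c"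
      "\<And>s t. s \<in> {0..1} \<inter> ball t0 h \<Longrightarrow> t \<in> {0..1} \<inter> ball t0 h \<Longrightarrow> gauss_at u s c \<Longrightarrow> gauss_at u t c"
      using gauss_at_step[OF u t0 c] by blast
    have "P t" if s: "s \<in> {0..1} \<inter> ball t0 h" and t: "t \<in> {0..1} \<inter> ball t0 h" and Ps: "P s" for s t
      unfolding P_def
    proof (intro ballI impI)
      fix d assume d: "d \<in> A" "Gam u t \<in> fst d"
      have "gauss_at u s c" using Ps c(1) h(2)[OF s] by (simp add: P_def)
      then have "gauss_at u t c" by (rule h(3)[OF s t])
      then show "gauss_at u t d"
        using t by (intro gauss_at_chart_change[OF u _ c(1) h(2)[OF t] d]) auto
    qed
    then show "\<exists>h>0. \<forall>x\<in>{0..1} \<inter> ball t0 h. \<forall>y\<in>{0..1} \<inter> ball t0 h. P x \<longrightarrow> P y"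
      using h(1) by blast
  qed auto
  then have "gauss_at u 1 d" using d E_Gam[OF u] by (simp add: P_def)
  then obtain \<epsilon> where "\<epsilon> > 0" "\<forall>u'\<in>W. norm (u' - u) < \<epsilon> \<longrightarrow> Gam u' 1 \<in> fst d \<and> \<bar>dev u 1 d u'\<bar> \<le> e * norm (u' - u)"
    using e unfolding gauss_at_def by blast
  then show ?thesis
    using that[of \<epsilon>] by (simp add: dev_def E_Gam u)
qed

end

section \<open>Causal curves in a normal neighbourhood\<close>

lemma nonpos_ae_imp_nonpos:
  fixes f :: "real \<Rightarrow> real"
  assumes cont: "continuous_on {0..1} f" and N: "negligible N" and le: "\<And>t. t \<in> {0<..<1} - N \<Longrightarrow> f t \<le> 0"
    and t: "t \<in> {0..1}"
  shows "f t \<le> 0"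
proof (rule ccontr)
  assume "\<not> f t \<le> 0"
  then have pos: "0 < f t" by simp
  have "continuous (at t within {0..1}) f"
    using cont t by (simp add: continuous_on_eq_continuous_within)
  then obtain d where d: "d > 0" "\<forall>s\<in>{0..1}. dist s t < d \<longrightarrow> dist (f s) (f t) < f t"
    using pos unfolding continuous_within_eps_delta by blast
  have "\<not> negligible {max 0 (t - d)<..<min 1 (t + d)}"
    using t d(1) by (intro open_not_negligible) auto
  then obtain s where s: "s \<in> {max 0 (t - d)<..<min 1 (t + d)}" "s \<notin> N"
    using negligible_subset[OF N] by blast
  then have "s \<in> {0..1}" "dist s t < d" "s \<in> {0<..<1} - N" by (auto simp: dist_real_def)
  then have "dist (f s) (f t) < f t" "f s \<le> 0" using d(2) le by blast+
  then show False by (simp add: dist_real_def)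
qed

lemma derivative_zero_of_small_difference:
  fixes f :: "real \<Rightarrow> 'b::real_normed_vector"
  assumes D: "(f has_vector_derivative D) (at t)"
    and small: "\<And>e. e > 0 \<Longrightarrow> \<exists>d>0. \<forall>s. \<bar>s - t\<bar> < d \<longrightarrow> norm (f s - f t) \<le> e * \<bar>s - t\<bar>"
  shows "D = 0"
proof -
  have "(f has_derivative (\<lambda>h. 0)) (at t)"
    unfolding has_derivative_at_alt using small by simp
  then have "(f has_vector_derivative 0) (at t)"
    by (simp add: has_vector_derivative_def)
  then show ?thesis by (rule vector_derivative_unique_at[OF D])
qed

lemma has_vector_derivative_at_difference:
  fixes f :: "real \<Rightarrow> 'b::real_normed_vector"
  assumes "(f has_vector_derivative 0) (at t)" "e > 0"
  shows "\<exists>d>0. \<forall>s. \<bar>s - t\<bar> < d \<longrightarrow> norm (f s - f t) \<le> e * \<bar>s - t\<bar>"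
proof -
  have "(f has_derivative (\<lambda>h. 0)) (at t)"
    using assms(1) by (simp add: has_vector_derivative_def)
  then show ?thesis
    using assms(2) unfolding has_derivative_at_alt by simp
qed

lemma lipschitz_divide:
  fixes f h :: "real \<Rightarrow> real"
  assumes f: "L-lipschitz_on {a..b} f" and h: "M-lipschitz_on {a..b} h" and m: "0 < m" "\<And>t. t \<in> {a..b} \<Longrightarrow> m \<le> h t"
    and F: "\<And>t. t \<in> {a..b} \<Longrightarrow> \<bar>f t\<bar> \<le> F" "0 \<le> F"
  shows "(L / m + F * M / m\<^sup>2)-lipschitz_on {a..b} (\<lambda>t. f t / h t)"
proof (rule lipschitz_onI)
  have LM: "0 \<le> L" "0 \<le> M" using f h lipschitz_on_nonneg by auto
  then show "0 \<le> L / m + F * M / m\<^sup>2" using m F(2) by simp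
  fix s t assume s: "s \<in> {a..b}" and t: "t \<in> {a..b}"
  have hs: "0 < h s" "0 < h t" using m s t by (meson less_le_trans)+
  have eq: "f s / h s - f t / h t = (f s - f t) / h s + f t * (h t - h s) / (h s * h t)"
    using hs by (simp add: field_simps)
  have "\<bar>(f s - f t) / h s\<bar> \<le> L * \<bar>s - t\<bar> / m"
    unfolding abs_divide using lipschitz_onD[OF f s t] m(1) m(2)[OF s] LM
    by (intro frac_le) (auto simp: dist_real_def)
  moreover have "\<bar>f t * (h t - h s) / (h s * h t)\<bar> \<le> F * (M * \<bar>s - t\<bar>) / (m * m)"
    unfolding abs_divide abs_mult
  proof (intro frac_le mult_mono)
    show "\<bar>h t - h s\<bar> \<le> M * \<bar>s - t\<bar>" using lipschitz_onD[OF h t s] by (simp add: dist_real_def abs_minus_commute)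
    show "m \<le> \<bar>h s\<bar>" "m \<le> \<bar>h t\<bar>" using m(2)[OF s] m(2)[OF t] by auto
  qed (use F t LM m in auto)
  ultimately have "\<bar>f s / h s - f t / h t\<bar> \<le> L * \<bar>s - t\<bar> / m + F * (M * \<bar>s - t\<bar>) / (m * m)"
    unfolding eq by linarith
  then show "dist (f s / h s) (f t / h t) \<le> (L / m + F * M / m\<^sup>2) * dist s t"
    by (simp add: dist_real_def power2_eq_square algebra_simps)
qed

lemma lipschitz_derivative_zero_imp_eq:
  fixes f :: "real \<Rightarrow> real"
  assumes ab: "a \<le> b" and f: "L-lipschitz_on {a..b} f" and N: "negligible N"
    and D: "\<And>t. t \<in> {a<..<b} - N \<Longrightarrow> (f has_real_derivative 0) (at t)"
  shows "f a = f b"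
proof (rule antisym)
  show "f a \<le> f b"
    by (rule lipschitz_derivative_nonneg_imp_le[OF ab f N]) (use D in blast)
  have "(\<lambda>t. - f t) a \<le> (\<lambda>t. - f t) b"
  proof (rule lipschitz_derivative_nonneg_imp_le[OF ab _ N])
    show "L-lipschitz_on {a..b} (\<lambda>t. - f t)" using f by simp
    fix t assume "t \<in> {a<..<b} - N"
    from DERIV_minus[OF D[OF this]] show "\<exists>D\<ge>0. ((\<lambda>t. - f t) has_real_derivative D) (at t)" by auto
  qed
  then show "f b \<le> f a" by simp
qed

lemma continuous_nonzero_neg:
  fixes f :: "real \<Rightarrow> real"
  assumes "continuous_on {a..b} f" "\<And>t. t \<in> {a..b} \<Longrightarrow> f t \<noteq> 0" "x \<in> {a..b}" "y \<in> {a..b}" "f x < 0"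
  shows "f y < 0"
proof (rule ccontr)
  assume "\<not> f y < 0"
  have "connected (f ` {a..b})" using assms(1) by (rule connected_continuous_image) auto
  from connected_contains_Icc[OF this, of "f x" "f y"] assms(3-5) \<open>\<not> f y < 0\<close>
  have "0 \<in> f ` {a..b}" by auto
  then show False using assms(2) by force
qed

section \<open>The cones at the base point in coordinates, and the time orientation along radial
  geodesics\<close>

context normal_nbhd
begin

definition x0 :: 'e where "x0 = X p c0"

abbreviation B :: "'e \<Rightarrow> 'e \<Rightarrow> real" where "B \<equiv> mc c0 (snd c0 p)"

lemma B_lorentz: "lorentz B"
  by (rule mc_lorentz[OF c0(1)]) (use c0 in simp)

lemma tv_x0: "tv x0 = X p"
  unfolding x0_def by (rule coord_vector_of_tangent[OF X_timelike(1) c0])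

lemma B_tv: "g p (tv u) (tv v) = B u v" "g p (X p) (tv v) = B x0 v"
  using mc_chart[OF c0, of u v] mc_chart[OF c0, of x0 v] by (simp_all add: tv_x0)

lemma x0_timelike: "B x0 x0 < 0"
  using X_timelike(2)[of p] B_tv(2)[of x0] by (simp add: tv_x0)

lemma B_orthogonal_imp_zero: "Q u \<le> 0 \<Longrightarrow> B x0 u = 0 \<Longrightarrow> u = 0"
  using lorentz.causal_not_orthogonal[OF B_lorentz x0_timelike, of u] by (auto simp: Q_def)

text \<open>The weak second inequality accounts for the zero vector, the only vector with
  \<open>Q\<close> at most 0 that is orthogonal to the timelike \<open>x0\<close>. In this form the
  cone is visibly closed.\<close>

lemma causal_cone_iff: "tv u \<in> causal_cone A g X p \<longleftrightarrow> Q u \<le> 0 \<and> B x0 u \<le> 0"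
proof -
  interpret lorentz B by (rule B_lorentz)
  have "tv u \<in> causal_cone A g X p \<longleftrightarrow> u = 0 \<or> (u \<noteq> 0 \<and> Q u \<le> 0 \<and> B x0 u < 0)"
    using coord_vector_tangent[OF c0, of u]
    by (auto simp: causal_cone_def causal_def coord_vector_eq_0_iff[OF c0] B_tv Q_def)
  also have "\<dots> \<longleftrightarrow> Q u \<le> 0 \<and> B x0 u \<le> 0"
    using B_orthogonal_imp_zero[of u] by (auto simp: Q_def h_0 less_le)
  finally show ?thesis .
qed

lemma timelike_cone_iff: "tv u \<in> timelike_cone A g X p \<longleftrightarrow> Q u < 0 \<and> B x0 u < 0"
proof -
  interpret lorentz B by (rule B_lorentz)
  show ?thesis
    using coord_vector_tangent[OF c0, of u]
    by (auto simp: timelike_cone_def timelike_def coord_vector_eq_0_iff[OF c0] B_tv Q_def h_0)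
qed

lemma tangent_tv: "v \<in> tangent_space A p \<Longrightarrow> tv (v c0) = v"
  by (rule coord_vector_of_tangent[OF _ c0])

lemma B_continuous:
  "continuous_on S f \<Longrightarrow> continuous_on S h \<Longrightarrow> continuous_on S (\<lambda>x. B (f x) (h x))"
proof -
  interpret lorentz B by (rule B_lorentz)
  assume f: "continuous_on S f" "continuous_on S h"
  have "bounded_bilinear B"
    using lin h_lin2 by (intro bilinear_conv_bounded_bilinear[THEN iffD1]) (simp add: bilinear_def)
  from bounded_bilinear.continuous_on[OF this f] show ?thesis .
qed

text \<open>Weak inequalities bound the closure from outside. Conversely a vector on the boundary is
  approached by \<open>u + e *\<^sub>R x0\<close>: in the expansion of \<open>Q\<close> the mixed
  term is nonpositive and the last term is negative, so these vectors are timelike and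
  future-directed.\<close>

lemma frontier_timelike_cone:
  "tv u \<in> top_of_set (tangent_space A p) frontier_of timelike_cone A g X p \<longleftrightarrow> Q u = 0 \<and> B x0 u \<le> 0"
proof -
  interpret lorentz B by (rule B_lorentz)
  let ?T = "top_of_set (tangent_space A p)"
  let ?I = "timelike_cone A g X p"
  have ev: "continuous_on UNIV (\<lambda>v :: ('a, 'e) tangent. v c0)"
    by (rule continuous_on_product_coordinates)
  have I: "?I = tangent_space A p \<inter> {v. Q (v c0) < 0 \<and> B x0 (v c0) < 0}"
  proof -
    have "v \<in> ?I \<longleftrightarrow> v \<in> tangent_space A p \<and> Q (v c0) < 0 \<and> B x0 (v c0) < 0" for v
    proof (cases "v \<in> tangent_space A p")
      case True
      then show ?thesis using timelike_cone_iff[of "v c0"] by (simp add: tangent_tv)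
    next
      case False
      then show ?thesis by (simp add: timelike_cone_def)
    qed
    then show ?thesis by blast
  qed
  have cQ: "continuous_on UNIV (\<lambda>v :: ('a, 'e) tangent. Q (v c0))" "continuous_on UNIV (\<lambda>v :: ('a, 'e) tangent. B x0 (v c0))"
    unfolding Q_def by (intro B_continuous ev continuous_on_const)+
  have "open {v :: ('a, 'e) tangent. Q (v c0) < 0 \<and> B x0 (v c0) < 0}"
    by (intro open_Collect_conj open_Collect_less cQ continuous_on_const)
  then have op: "openin ?T ?I" unfolding I by (rule openin_open_Int)
  have "closed {v :: ('a, 'e) tangent. Q (v c0) \<le> 0 \<and> B x0 (v c0) \<le> 0}"
    by (intro closed_Collect_conj closed_Collect_le cQ continuous_on_const)
  then have "closedin ?T (tangent_space A p \<inter> {v. Q (v c0) \<le> 0 \<and> B x0 (v c0) \<le> 0})"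
    by (rule closedin_closed_Int)
  moreover have "?I \<subseteq> tangent_space A p \<inter> {v. Q (v c0) \<le> 0 \<and> B x0 (v c0) \<le> 0}"
    unfolding I by auto
  ultimately have cl: "?T closure_of ?I \<subseteq> tangent_space A p \<inter> {v. Q (v c0) \<le> 0 \<and> B x0 (v c0) \<le> 0}"
    by (rule closure_of_minimal[rotated])
  have fr: "?T frontier_of ?I = ?T closure_of ?I - ?I"
    unfolding frontier_of_def by (simp add: interior_of_openin[OF op])
  show ?thesis
  proof
    assume "tv u \<in> ?T frontier_of ?I"
    then have "tv u \<in> ?T closure_of ?I" "tv u \<notin> ?I" unfolding fr by auto
    then have "Q u \<le> 0" "B x0 u \<le> 0" "\<not> (Q u < 0 \<and> B x0 u < 0)"
      using cl by (auto simp: coord_vector_self[OF c0] timelike_cone_iff)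
    moreover have "Q u = 0" if "B x0 u = 0"
      using B_orthogonal_imp_zero[OF \<open>Q u \<le> 0\<close> that] by (simp add: Q_def h_0)
    ultimately show "Q u = 0 \<and> B x0 u \<le> 0" by fastforce
  next
    assume u: "Q u = 0 \<and> B x0 u \<le> 0"
    have "tv u \<in> ?T closure_of ?I"
      unfolding in_closure_of
    proof (intro conjI allI impI)
      show "tv u \<in> topspace ?T" using coord_vector_tangent[OF c0] by simp
      fix T assume T: "tv u \<in> T \<and> openin ?T T"
      then have "open {w. tv w \<in> T}" "u \<in> {w. tv w \<in> T}" using tv_image_open by auto
      then obtain r where r: "r > 0" "ball u r \<subseteq> {w. tv w \<in> T}" by (meson openE)
      define e where "e = r / (2 * (norm x0 + 1))"
      have n: "norm x0 + 1 > 0" using norm_ge_zero[of x0] by linarith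
      have e: "e > 0" using r n by (simp add: e_def)
      define w where "w = u + e *\<^sub>R x0"
      have "norm (w - u) \<le> e * (norm x0 + 1)" using e by (simp add: w_def)
      also have "\<dots> = r / 2" unfolding e_def by (rule half_quotient(2)[OF n])
      also have "\<dots> < r" using r by simp
      finally have "tv w \<in> T" using r(2) by (auto simp: dist_norm norm_minus_commute)
      have "Q w = Q u + 2 * e * B x0 u + e\<^sup>2 * B x0 x0"
        unfolding w_def Q_def by (simp add: h_add h_scale sym[of u x0] power2_eq_square distrib_left)
      moreover have "2 * e * B x0 u \<le> 0" "e\<^sup>2 * B x0 x0 < 0"
        using u e x0_timelike by (auto simp: mult_nonneg_nonpos mult_pos_neg)
      ultimately have "Q w < 0" using u by linarith
      moreover have "B x0 w < 0"
        using u mult_pos_neg[OF e x0_timelike] by (simp add: w_def h_add h_scale)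
      ultimately have "tv w \<in> ?I" by (simp add: timelike_cone_iff)
      with \<open>tv w \<in> T\<close> show "\<exists>y. y \<in> ?I \<and> y \<in> T" by blast
    qed
    then show "tv u \<in> ?T frontier_of ?I" unfolding fr using u by (simp add: timelike_cone_iff)
  qed
qed

lemma Q_lipschitz:
  obtains K where "0 \<le> K" "\<And>u v. \<bar>Q u - Q v\<bar> \<le> K * (norm u + norm v) * norm (u - v)"
proof -
  interpret lorentz B by (rule B_lorentz)
  define K where "K = (\<Sum>i\<in>Basis. \<Sum>j\<in>Basis. \<bar>B i j\<bar>)"
  have K: "0 \<le> K" unfolding K_def by (intro sum_nonneg) auto
  have b: "\<bar>B u w\<bar> \<le> K * norm u * norm w" for u w
    unfolding K_def by (rule bilinear_real_bound[OF lin h_lin2])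
  show ?thesis
  proof (rule that[OF K])
    fix u v
    have "Q u - Q v = B (u - v) u + B v (u - v)" by (simp add: Q_def h_diff)
    then have "\<bar>Q u - Q v\<bar> \<le> K * norm (u - v) * norm u + K * norm v * norm (u - v)"
      using b[of "u - v" u] b[of v "u - v"] by linarith
    then show "\<bar>Q u - Q v\<bar> \<le> K * (norm u + norm v) * norm (u - v)" by (simp add: algebra_simps)
  qed
qed

lemma Q_has_derivative:
  assumes "(f has_vector_derivative w) (at t)"
  shows "((\<lambda>s. Q (f s)) has_real_derivative 2 * B (f t) w) (at t)"
proof -
  interpret lorentz B by (rule B_lorentz)
  have bb: "bounded_bilinear B"
    using lin h_lin2 by (intro bilinear_conv_bounded_bilinear[THEN iffD1]) (simp add: bilinear_def)
  have "((\<lambda>s. B (f s) (f s)) has_vector_derivative B (f t) w + B w (f t)) (at t)"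
    by (rule bounded_bilinear.has_vector_derivative[OF bb assms assms])
  then show ?thesis
    unfolding Q_def has_real_derivative_iff_has_vector_derivative by (simp add: sym[of w])
qed

lemma vel_nonzero:
  assumes u: "u \<in> W" "u \<noteq> 0" and t: "t \<in> {0..1}"
  shows "vel u t \<noteq> (\<lambda>_. 0)"
  unfolding vel_def
proof (rule geodesic_velocity_nonzero[OF Gam_geodesic(1)[OF u(1)] _ t])
  show "vl (Gam u) 0 \<noteq> (\<lambda>_. 0)"
    using Gam_geodesic(3)[OF u(1)] u(2) coord_vector_eq_0_iff[OF c0, of u] by (simp add: vel_def)
qed simp

text \<open>The product of the velocity with \<open>X\<close> is continuous along the geodesic and
  never 0, because a nonzero causal vector is not orthogonal to a timelike one. Hence it keeps the
  sign that it has at \<open>p\<close>.\<close>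

lemma vel_future:
  assumes u: "u \<in> W" "Q u \<le> 0" "B x0 u < 0" and t: "t \<in> {0..1}"
  shows "g (Gam u t) (X (Gam u t)) (vel u t) < 0"
proof (rule interval_connected_induction[of "\<lambda>t. g (Gam u t) (X (Gam u t)) (vel u t) < 0" 0 t])
  have u0: "u \<noteq> 0" using u(3) lorentz.h_0(2)[OF B_lorentz] by auto
  show "g (Gam u 0) (X (Gam u 0)) (vel u 0) < 0"
    using Gam_geodesic[OF u(1)] u(3) by (simp add: B_tv)
  fix t0 :: real assume t0: "t0 \<in> {0..1}"
  obtain c where c: "c \<in> A" "Gam u t0 \<in> fst c" by (rule chart_at)
  note geo = Gam_geodesic(1)[OF u(1)]
  obtain h where h: "0 < h" "\<And>t. t \<in> {0..1} \<Longrightarrow> \<bar>t - t0\<bar> \<le> h \<Longrightarrow> Gam u t \<in> fst c"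
    using curve_locally_in_open[OF geodesicD(1)[OF geo] t0 chart_open(1)[OF c(1)] c(2)] by blast
  obtain a b where ab: "a < b" "{a..b} \<subseteq> {0..1}" "b - a \<le> 2 * h" "{a..b} \<subseteq> cball t0 h" "{0..1} \<inter> ball t0 h \<subseteq> {a..b}"
    using interval_neighbourhood[OF t0 h(1)] by blast
  have inc: "Gam u t \<in> fst c" "t \<in> {0..1}" if "t \<in> {a..b}" for t
  proof -
    have "t \<in> {0..1}" "t \<in> cball t0 h" using that ab by blast+
    then show "Gam u t \<in> fst c" "t \<in> {0..1}" by (auto intro!: h(2) simp: dist_real_def)
  qed
  interpret C11_form "snd c ` fst c" "mc c" by (rule mc_form[OF c(1)])
  let ?x = "\<lambda>t. snd c (Gam u t)" and ?X = "\<lambda>t. X (Gam u t) c" and ?v = "\<lambda>t. vel u t c"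
  have eq: "g (Gam u t) (X (Gam u t)) (vel u t) = mc c (?x t) (?X t) (?v t)" if t: "t \<in> {a..b}" for t
    using g_tangent[OF c(1) inc(1)[OF t] X_timelike(1) vel_tangent[OF u(1) inc(2)[OF t]]] .
  have contG: "continuous_on {a..b} (Gam u)" using geodesicD(1)[OF geo] ab(2) continuous_on_subset by blast
  have im: "Gam u ` {a..b} \<subseteq> fst c" using inc by blast
  have cx: "continuous_on {a..b} ?x" by (rule continuous_on_compose2[OF chart_continuous[OF c(1)] contG im])
  have cX: "continuous_on {a..b} ?X" by (rule continuous_on_compose2[OF X_continuous[OF c(1)] contG im])
  have cv: "continuous_on {a..b} ?v"
    unfolding vel_def
    by (rule continuous_on_vector_derivative, rule has_vector_derivative_within_subset[OF geodesicD(3)[OF geo] ab(2)])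
      (use inc c in auto)
  have cG: "continuous_on (snd c ` fst c) (\<lambda>x. mc c x i j)" for i j
    by (rule has_derivative_continuous_on, rule has_derivative_at_withinI, rule G_has_derivative)
  have imx: "?x ` {a..b} \<subseteq> snd c ` fst c" using inc by blast
  have "continuous_on {a..b} (\<lambda>t. \<Sum>i\<in>Basis. \<Sum>j\<in>Basis. (?X t \<bullet> i) * (?v t \<bullet> j) * mc c (?x t) i j)"
    by (intro continuous_on_sum continuous_on_mult continuous_on_inner continuous_on_const cX cv continuous_on_compose2[OF cG cx imx])
  moreover have "(\<Sum>i\<in>Basis. \<Sum>j\<in>Basis. (?X t \<bullet> i) * (?v t \<bullet> j) * mc c (?x t) i j) = mc c (?x t) (?X t) (?v t)" if t: "t \<in> {a..b}" for t
  proof -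
    have S: "?x t \<in> snd c ` fst c" using inc(1)[OF t] by simp
    show ?thesis by (rule bilinear_real_expand[of "mc c (?x t)", OF lin[OF S] lin2[OF S], symmetric])
  qed
  ultimately have cont: "continuous_on {a..b} (\<lambda>t. mc c (?x t) (?X t) (?v t))"
    by (rule continuous_on_eq)
  have nz: "mc c (?x t) (?X t) (?v t) \<noteq> 0" if t: "t \<in> {a..b}" for t
  proof (rule lorentz.causal_not_orthogonal[OF mc_lorentz[OF c(1)]])
    show "?x t \<in> snd c ` fst c" using inc(1)[OF t] by simp
    show "mc c (?x t) (?X t) (?X t) < 0"
      using X_timelike(2)[of "Gam u t"] g_tangent[OF c(1) inc(1)[OF t] X_timelike(1) X_timelike(1)] by metis
    show "mc c (?x t) (?v t) (?v t) \<le> 0"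
      using Gam_energy_chart[OF u(1) inc(2)[OF t] c(1) inc(1)[OF t]] u(2) by simp
    show "?v t \<noteq> 0"
      using vel_nonzero[OF u(1) u0 inc(2)[OF t]] coord_vector_of_tangent[OF vel_tangent[OF u(1) inc(2)[OF t]] c(1) inc(1)[OF t]]
        coord_vector_0[OF c(1) inc(1)[OF t]] by metis
  qed
  have "g (Gam u y) (X (Gam u y)) (vel u y) < 0"
    if "x \<in> {0..1} \<inter> ball t0 h" "y \<in> {0..1} \<inter> ball t0 h" "g (Gam u x) (X (Gam u x)) (vel u x) < 0" for x y
  proof -
    have xy: "x \<in> {a..b}" "y \<in> {a..b}" using that ab(5) by blast+
    show ?thesis using continuous_nonzero_neg[OF cont nz xy] that(3) by (simp add: eq[OF xy(1)] eq[OF xy(2)])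
  qed
  then show "\<exists>h>0. \<forall>x\<in>{0..1} \<inter> ball t0 h. \<forall>y\<in>{0..1} \<inter> ball t0 h.
      g (Gam u x) (X (Gam u x)) (vel u x) < 0 \<longrightarrow> g (Gam u y) (X (Gam u y)) (vel u y) < 0"
    using h(1) by blast
qed (use t in auto)

lemma Lg_lipschitz_near:
  assumes q: "q \<in> U" and d: "d \<in> A" "q \<in> fst d"
  obtains \<rho> L where "0 < \<rho>" "0 \<le> L"
    "\<And>q1 q2. q1 \<in> U \<inter> fst d \<Longrightarrow> q2 \<in> U \<inter> fst d \<Longrightarrow> norm (snd d q1 - snd d q) < \<rho> \<Longrightarrow> norm (snd d q2 - snd d q) < \<rho> \<Longrightarrow>
      norm (Lg q1 - Lg q2) \<le> L * norm (snd d q1 - snd d q2)"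
proof -
  have "locally_lipschitz_on (snd d ` (U \<inter> fst d)) (\<lambda>x. Lg (chart_inv d x))"
    unfolding Lg_def by (rule normal_parts(9)[OF c0(1) d(1) c0(2)])
  moreover have "snd d q \<in> snd d ` (U \<inter> fst d)" using q d by simp
  ultimately obtain \<rho> L where rL: "0 < \<rho>" "L-lipschitz_on (snd d ` (U \<inter> fst d) \<inter> ball (snd d q) \<rho>) (\<lambda>x. Lg (chart_inv d x))"
    unfolding locally_lipschitz_on_def by blast
  show ?thesis
  proof (rule that[OF rL(1) lipschitz_on_nonneg[OF rL(2)]])
    fix q1 q2 assume 1: "q1 \<in> U \<inter> fst d" "q2 \<in> U \<inter> fst d" "norm (snd d q1 - snd d q) < \<rho>" "norm (snd d q2 - snd d q) < \<rho>"
    have "norm (Lg (chart_inv d (snd d q1)) - Lg (chart_inv d (snd d q2))) \<le> L * norm (snd d q1 - snd d q2)"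
      by (rule lipschitz_on_normD[OF rL(2)]) (use 1 in \<open>auto simp: dist_norm norm_minus_commute\<close>)
    then show "norm (Lg q1 - Lg q2) \<le> L * norm (snd d q1 - snd d q2)"
      using 1 by (simp add: chart_inv_chart[OF d(1)])
  qed
qed

end

lemma locally_lipschitz_on_subset:
  assumes "locally_lipschitz_on S f" "T \<subseteq> S"
  shows "locally_lipschitz_on T f"
  unfolding locally_lipschitz_on_def
proof
  fix x assume "x \<in> T"
  then obtain r L where "r > 0" and L: "L-lipschitz_on (S \<inter> ball x r) f"
    using assms unfolding locally_lipschitz_on_def by blast
  moreover have "T \<inter> ball x r \<subseteq> S \<inter> ball x r" using assms(2) by blast
  ultimately show "\<exists>r>0. \<exists>L. L-lipschitz_on (T \<inter> ball x r) f"
    using lipschitz_on_subset[OF L] by blast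
qed

lemma locally_lipschitz_compact_imp_lipschitz:
  fixes f :: "real \<Rightarrow> 'b::metric_space"
  assumes "\<And>t. t \<in> {a..b} \<Longrightarrow> \<exists>r>0. \<exists>L. L-lipschitz_on ({a..b} \<inter> ball t r) f"
  obtains L where "L-lipschitz_on {a..b} f"
proof -
  have "local_lipschitz {0::real} {a..b} (\<lambda>_. f)"
  proof (rule local_lipschitzI)
    fix s :: real and t assume "t \<in> {a..b}"
    then obtain r L where r: "r > 0" and L: "L-lipschitz_on ({a..b} \<inter> ball t r) f"
      using assms by blast
    have sub: "cball t (r / 2) \<inter> {a..b} \<subseteq> {a..b} \<inter> ball t r" using r by auto
    show "\<exists>u>0. \<exists>L. \<forall>s\<in>cball s u \<inter> {0}. L-lipschitz_on (cball t u \<inter> {a..b}) f"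
      using lipschitz_on_subset[OF L sub] r by (intro exI[of _ "r / 2"]) auto
  qed
  from local_lipschitz_compact_implies_lipschitz[OF this, of thesis] that
  show ?thesis by auto
qed

locale boundary_curve = normal_nbhd A g X p V U c0
  for A :: "('a::{t2_space,second_countable_topology}, 'e::euclidean_space) chart set"
    and g :: "('a, 'e) metric" and X :: "'a \<Rightarrow> ('a, 'e) tangent"
    and p :: 'a and V :: "('a, 'e) tangent set" and U :: "'a set" and c0 :: "('a, 'e) chart" +
  fixes \<alpha> :: "real \<Rightarrow> 'a"
  assumes curve: "future_causal_curve A g X {0..1} \<alpha>"
    and in_U: "\<alpha> ` {0..1} \<subseteq> U" and start: "\<alpha> 0 = p"
    and causal_future: "causal_future A g X p U = exp_map A g p ` (causal_cone A g X p \<inter> V)"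
    and end_null: "Q (Lg (\<alpha> 1)) = 0"
begin

section \<open>The curve pulled back to the tangent space\<close>

definition \<beta> :: "real \<Rightarrow> 'e" where "\<beta> t = Lg (\<alpha> t)"

lemma \<alpha>_cont: "continuous_on {0..1} \<alpha>"
  using curve by (simp add: future_causal_curve_def locally_lipschitz_curve_def)

lemma \<alpha>_U: "t \<in> {0..1} \<Longrightarrow> \<alpha> t \<in> U"
  using in_U by blast

lemma \<beta>: "t \<in> {0..1} \<Longrightarrow> \<beta> t \<in> W" "t \<in> {0..1} \<Longrightarrow> E (\<beta> t) = \<alpha> t"
  unfolding \<beta>_def using Lg_U[OF \<alpha>_U] by blast+

lemma \<beta>_0: "\<beta> 0 = 0"
proof -
  have "E 0 = p" using E_scale[OF zero_in_W, of 0] Gam_geodesic(2)[OF zero_in_W] by simp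
  then show ?thesis using Lg_E[OF zero_in_W] by (simp add: \<beta>_def start)
qed

lemma \<alpha>_chart_lipschitz:
  assumes t: "t \<in> {0..1}" and d: "d \<in> A" "\<alpha> t \<in> fst d"
  obtains r L where "0 < r" "0 \<le> L" "\<And>s. s \<in> {0..1} \<inter> ball t r \<Longrightarrow> \<alpha> s \<in> fst d"
    "L-lipschitz_on ({0..1} \<inter> ball t r) (snd d \<circ> \<alpha>)"
proof -
  obtain h where h: "0 < h" "\<And>s. s \<in> {0..1} \<Longrightarrow> \<bar>s - t\<bar> \<le> h \<Longrightarrow> \<alpha> s \<in> fst d"
    using curve_locally_in_open[OF \<alpha>_cont t chart_open(1)[OF d(1)] d(2)] by blast
  have "locally_lipschitz_on {s\<in>{0..1}. \<alpha> s \<in> fst d} (snd d \<circ> \<alpha>)"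
    using curve d(1) by (simp add: future_causal_curve_def locally_lipschitz_curve_def)
  moreover have "t \<in> {s\<in>{0..1}. \<alpha> s \<in> fst d}" using t d by simp
  ultimately obtain r L where r: "0 < r" and L: "L-lipschitz_on ({s\<in>{0..1}. \<alpha> s \<in> fst d} \<inter> ball t r) (snd d \<circ> \<alpha>)"
    unfolding locally_lipschitz_on_def by blast
  have inc: "\<alpha> s \<in> fst d" if "s \<in> {0..1} \<inter> ball t (min h r)" for s
    by (rule h(2)) (use that in \<open>auto simp: dist_real_def\<close>)
  show ?thesis
  proof (rule that[of "min h r" L])
    show "0 < min h r" using h r by simp
    show "0 \<le> L" by (rule lipschitz_on_nonneg[OF L])
    show "L-lipschitz_on ({0..1} \<inter> ball t (min h r)) (snd d \<circ> \<alpha>)"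
      by (rule lipschitz_on_subset[OF L]) (use inc in auto)
  qed (rule inc)
qed

lemma \<beta>_lipschitz: obtains L where "L-lipschitz_on {0..1} \<beta>"
proof (rule locally_lipschitz_compact_imp_lipschitz[of 0 1 \<beta>])
  fix t :: real assume t: "t \<in> {0..1}"
  obtain d where d: "d \<in> A" "\<alpha> t \<in> fst d" by (rule chart_at)
  obtain r L where r: "0 < r" "0 \<le> L" "\<And>s. s \<in> {0..1} \<inter> ball t r \<Longrightarrow> \<alpha> s \<in> fst d"
    and L: "L-lipschitz_on ({0..1} \<inter> ball t r) (snd d \<circ> \<alpha>)"
    using \<alpha>_chart_lipschitz[OF t d] by blast
  obtain \<rho> K where K: "0 < \<rho>" "0 \<le> K"
    "\<And>q1 q2. q1 \<in> U \<inter> fst d \<Longrightarrow> q2 \<in> U \<inter> fst d \<Longrightarrow> norm (snd d q1 - snd d (\<alpha> t)) < \<rho> \<Longrightarrow> norm (snd d q2 - snd d (\<alpha> t)) < \<rho> \<Longrightarrow>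
      norm (Lg q1 - Lg q2) \<le> K * norm (snd d q1 - snd d q2)"
    using Lg_lipschitz_near[OF \<alpha>_U[OF t] d] by blast
  define r' where "r' = min r (\<rho> / (L + 1))"
  have r': "0 < r'" "r' \<le> r" "r' \<le> \<rho> / (L + 1)" using r K by (auto simp: r'_def)
  have near: "norm (snd d (\<alpha> s) - snd d (\<alpha> t)) < \<rho>" if s: "s \<in> {0..1} \<inter> ball t r'" for s
  proof -
    have "norm (snd d (\<alpha> s) - snd d (\<alpha> t)) \<le> L * norm (s - t)"
      using lipschitz_on_normD[OF L, of s t] s t r r' by auto
    also have "\<dots> \<le> (L + 1) * norm (s - t)" using r(2) by (intro mult_right_mono) auto
    also have "\<dots> < (L + 1) * (\<rho> / (L + 1))"
      using s r'(3) r(2) by (intro mult_strict_left_mono) (auto simp: dist_real_def)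
    also have "\<dots> = \<rho>" using r(2) by simp
    finally show ?thesis .
  qed
  have "(K * L)-lipschitz_on ({0..1} \<inter> ball t r') \<beta>"
  proof (rule lipschitz_onI)
    fix s1 s2 assume s: "s1 \<in> {0..1} \<inter> ball t r'" "s2 \<in> {0..1} \<inter> ball t r'"
    then have s': "s1 \<in> {0..1} \<inter> ball t r" "s2 \<in> {0..1} \<inter> ball t r" using r'(2) by auto
    have "norm (\<beta> s1 - \<beta> s2) \<le> K * norm (snd d (\<alpha> s1) - snd d (\<alpha> s2))"
      unfolding \<beta>_def by (rule K(3)) (use s s' \<alpha>_U r(3) near in auto)
    also have "\<dots> \<le> K * (L * norm (s1 - s2))"
      using lipschitz_on_normD[OF L s'] K(2) by (intro mult_left_mono) auto
    finally show "dist (\<beta> s1) (\<beta> s2) \<le> K * L * dist s1 s2" by (simp add: dist_norm mult.assoc)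
  qed (use K r in simp)
  then show "\<exists>r>0. \<exists>L. L-lipschitz_on ({0..1} \<inter> ball t r) \<beta>" using r'(1) by blast
qed (use that in blast)

text \<open>Two separate sources: with an inverse exponential map that is merely Lipschitz,
  differentiability of \<alpha> does not yield that of \<beta>. End points are left out, so that
  derivatives at the remaining times are two-sided.\<close>

definition N :: "real set" where
  "N = {t \<in> {0<..<1}. \<not> curve_differentiable A {0..1} \<alpha> t} \<union> {t \<in> {0<..<1}. \<not> \<beta> differentiable (at t)}"

lemma N_negligible: "negligible N"
proof -
  obtain L where "L-lipschitz_on {0..1} \<beta>" by (rule \<beta>_lipschitz)
  then have 2: "negligible {t \<in> {0<..<1}. \<not> \<beta> differentiable (at t)}"
    by (rule lipschitz_differentiable_ae)
  let ?N = "{t \<in> {0<..<1}. \<not> curve_differentiable A {0..1} \<alpha> t}"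
  have "negligible ?N"
  proof (subst locally_negligible_alt, intro ballI)
    fix t assume t: "t \<in> ?N"
    then have t1: "t \<in> {0..1}" by simp
    obtain d where d: "d \<in> A" "\<alpha> t \<in> fst d" by (rule chart_at)
    obtain r L where r: "0 < r" "0 \<le> L" "\<And>s. s \<in> {0..1} \<inter> ball t r \<Longrightarrow> \<alpha> s \<in> fst d"
      and L: "L-lipschitz_on ({0..1} \<inter> ball t r) (snd d \<circ> \<alpha>)"
      using \<alpha>_chart_lipschitz[OF t1 d] by blast
    define a b where "a = max 0 (t - r / 2)" and "b = min 1 (t + r / 2)"
    have ab: "{a..b} \<subseteq> {0..1} \<inter> ball t r" "t \<in> {a<..<b}"
      using t r(1) by (auto simp: a_def b_def dist_real_def)
    have "negligible {s \<in> {a<..<b}. \<not> (snd d \<circ> \<alpha>) differentiable (at s)}"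
      by (rule lipschitz_differentiable_ae[OF lipschitz_on_subset[OF L ab(1)]])
    then have "negligible (?N \<inter> {a<..<b})"
    proof (rule negligible_subset, intro subsetI)
      fix s assume s: "s \<in> ?N \<inter> {a<..<b}"
      have "\<not> (snd d \<circ> \<alpha>) differentiable (at s)"
      proof
        assume "(snd d \<circ> \<alpha>) differentiable (at s)"
        then have "(snd d \<circ> \<alpha>) differentiable (at s within {0..1})"
          by (rule differentiable_at_withinI)
        moreover have "\<alpha> s \<in> fst d"
        proof -
          have "s \<in> {a..b}" using s by simp
          then show ?thesis using ab(1) r(3) by blast
        qed
        ultimately have "curve_differentiable A {0..1} \<alpha> s"
          using d(1) unfolding curve_differentiable_def by blast
        then show False using s by simp
      qed
      then show "s \<in> {s \<in> {a<..<b}. \<not> (snd d \<circ> \<alpha>) differentiable (at s)}" using s by simp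
    qed
    moreover have "openin (top_of_set ?N) (?N \<inter> {a<..<b})" by (simp add: openin_open_Int)
    moreover have "t \<in> ?N \<inter> {a<..<b}" using t ab(2) by simp
    ultimately show "\<exists>T. openin (top_of_set ?N) T \<and> t \<in> T \<and> negligible T" by blast
  qed
  with 2 show ?thesis unfolding N_def by (rule negligible_Un[rotated])
qed

lemma regular_point:
  assumes t: "t \<in> {0<..<1} - N"
  obtains v w where "v = vl \<alpha> t" "v \<in> tangent_space A (\<alpha> t)" "v \<noteq> (\<lambda>_. 0)" "g (\<alpha> t) v v \<le> 0" "g (\<alpha> t) (X (\<alpha> t)) v < 0"
    "\<And>d. d \<in> A \<Longrightarrow> \<alpha> t \<in> fst d \<Longrightarrow> ((snd d \<circ> \<alpha>) has_vector_derivative v d) (at t)"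
    "(\<beta> has_vector_derivative w) (at t)"
proof -
  have t1: "t \<in> {0..1}" using t by simp
  have cd: "curve_differentiable A {0..1} \<alpha> t" and bd: "\<beta> differentiable (at t)"
    using t by (auto simp: N_def)
  obtain w where w: "(\<beta> has_vector_derivative w) (at t)"
    using bd vector_derivative_works by blast
  define v where "v = vl \<alpha> t"
  have fut: "causal g (\<alpha> t) v" "g (\<alpha> t) (X (\<alpha> t)) v < 0"
    using curve cd t1 unfolding future_causal_curve_def v_def by blast+
  note vd = curve_differentiableD[OF zero_less_one \<alpha>_cont t1 cd]
  have at: "at t within {0..1} = at t" using t by (simp add: at_within_Icc_at)
  show ?thesis
  proof (rule that[OF v_def _ _ _ fut(2) _ w])
    show "v \<in> tangent_space A (\<alpha> t)" unfolding v_def by (rule vd(1))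
    show "v \<noteq> (\<lambda>_. 0)" "g (\<alpha> t) v v \<le> 0" using fut(1) by (simp_all add: causal_def)
    show "((snd d \<circ> \<alpha>) has_vector_derivative v d) (at t)" if "d \<in> A" "\<alpha> t \<in> fst d" for d
      using vd(2)[OF that] unfolding v_def at .
  qed
qed

text \<open>Where \<open>\<alpha>\<close> is not differentiable at \<open>t\<close>, its restriction to \<open>{0..t}\<close> may have a vanishing one-sided
  derivative at \<open>t\<close> and then fails to be a causal curve.\<close>

lemma restricted_curve_causal:
  assumes t: "t \<in> {0<..<1} - N"
  shows "future_causal_curve A g X {0..t} \<alpha>"
  unfolding future_causal_curve_def locally_lipschitz_curve_def
proof (intro conjI ballI impI)
  have sub: "{0..t} \<subseteq> {0..1}" and t0: "0 < t" and t1: "t \<in> {0..1}" using t by auto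
  show cont: "continuous_on {0..t} \<alpha>" by (rule continuous_on_subset[OF \<alpha>_cont sub])
  show "locally_lipschitz_on {s \<in> {0..t}. \<alpha> s \<in> fst c} (snd c \<circ> \<alpha>)" if "c \<in> A" for c
    by (rule locally_lipschitz_on_subset[of "{s \<in> {0..1}. \<alpha> s \<in> fst c}"])
      (use curve that sub in \<open>auto simp: future_causal_curve_def locally_lipschitz_curve_def\<close>)
  fix s assume s: "s \<in> {0..t}" and cd: "curve_differentiable A {0..t} \<alpha> s"
  then have s1: "s \<in> {0..1}" using sub by blast
  have "curve_differentiable A {0..1} \<alpha> s \<and> velocity A {0..t} \<alpha> s = vl \<alpha> s"
  proof (cases "s < t")
    case True
    have "at s within {0..t} = at s within {0..1}"
      by (rule at_within_nhd[of s "{..<t}"]) (use True t in auto)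
    then show ?thesis using cd by (auto simp: curve_differentiable_def velocity_def)
  next
    case False
    then have st: "s = t" using s by simp
    \<comment> \<open>At the right end \<open>t\<close> the velocity within \<open>{0..t}\<close> is
      the one within \<open>{0..1}\<close>, which exists because \<open>t\<close> is not in
      \<open>N\<close>.\<close>
    have cd1: "curve_differentiable A {0..1} \<alpha> t" using t by (auto simp: N_def)
    obtain c where c: "c \<in> A" "\<alpha> t \<in> fst c" by (rule chart_at)
    note vd = curve_differentiableD[OF zero_less_one \<alpha>_cont t1 cd1]
    have "velocity A {0..t} \<alpha> t = coord_vector A c (\<alpha> t) (vl \<alpha> t c)"
      by (rule velocity_eq_coord_vector[OF t0 cont _ c has_vector_derivative_within_subset[OF vd(2)[OF c] sub]]) (use t0 in simp)
    also have "\<dots> = vl \<alpha> t" by (rule coord_vector_of_tangent[OF vd(1) c])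
    finally show ?thesis using cd1 st by simp
  qed
  then show "causal g (\<alpha> s) (velocity A {0..t} \<alpha> s)" "g (\<alpha> s) (X (\<alpha> s)) (velocity A {0..t} \<alpha> s) < 0"
    using curve s1 unfolding future_causal_curve_def by auto
qed

lemma \<beta>_continuous: "continuous_on {0..1} \<beta>"
  by (rule \<beta>_lipschitz) (rule lipschitz_on_continuous_on)

text \<open>Up to a time outside \<open>N\<close> the curve is itself a causal curve, so its end is
  in the causal future and is the image of a vector of the causal cone. Continuity extends the
  closed conditions to all times.\<close>

lemma \<beta>_causal:
  assumes t: "t \<in> {0..1}"
  shows "Q (\<beta> t) \<le> 0" "B x0 (\<beta> t) \<le> 0"
proof -
  have reg: "Q (\<beta> t) \<le> 0 \<and> B x0 (\<beta> t) \<le> 0" if t: "t \<in> {0<..<1} - N" for t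
  proof -
    have t1: "t \<in> {0..1}" "0 < t" "{0..t} \<subseteq> {0..1}" using t by auto
    have "\<alpha> t \<in> causal_future A g X p U"
      unfolding causal_future_def using restricted_curve_causal[OF t] \<alpha>_U t1 start
      by (intro UnI1 CollectI conjI exI[of _ 0] exI[of _ t] exI[of _ \<alpha>]) auto
    then obtain v where v: "v \<in> causal_cone A g X p" "v \<in> V" "\<alpha> t = exp_map A g p v"
      unfolding causal_future by blast
    have "v \<in> tangent_space A p" using v(2) V_tangent by blast
    then have tvv: "tv (v c0) = v" by (rule tangent_tv)
    then have "v c0 \<in> W" "E (v c0) = \<alpha> t" using v by (simp_all add: W_def E_def)
    then have "\<beta> t = v c0" using Lg_E by (metis \<beta>_def)
    then show ?thesis using v(1) tvv causal_cone_iff[of "\<beta> t"] by simp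
  qed
  have cQ: "continuous_on {0..1} (\<lambda>t. Q (\<beta> t))" "continuous_on {0..1} (\<lambda>t. B x0 (\<beta> t))"
    unfolding Q_def by (intro B_continuous \<beta>_continuous continuous_on_const)+
  show "Q (\<beta> t) \<le> 0" by (rule nonpos_ae_imp_nonpos[OF cQ(1) N_negligible _ t]) (use reg in blast)
  show "B x0 (\<beta> t) \<le> 0" by (rule nonpos_ae_imp_nonpos[OF cQ(2) N_negligible _ t]) (use reg in blast)
qed

lemma \<beta>_nonzero_future: "t \<in> {0..1} \<Longrightarrow> \<beta> t \<noteq> 0 \<Longrightarrow> B x0 (\<beta> t) < 0"
  using \<beta>_causal[of t] B_orthogonal_imp_zero[of "\<beta> t"] by fastforce

lemma vel_1_tangent: "t \<in> {0..1} \<Longrightarrow> vel (\<beta> t) 1 \<in> tangent_space A (\<alpha> t)"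
  using vel_tangent[OF \<beta>(1), of t 1] E_Gam[OF \<beta>(1), of t] \<beta>(2)[of t] by simp

text \<open>Replaces the chain rule for the exponential map: both sides are derivatives of real
  functions along the curve, and by the Gauss lemma the difference of these functions changes by
  less than any multiple of \<open>norm (\<beta> s - \<beta> t)\<close>, thus of the elapsed
  time.\<close>

lemma gauss_along_curve:
  assumes t: "t \<in> {0<..<1}" and d: "d \<in> A" "\<alpha> t \<in> fst d"
    and v: "((snd d \<circ> \<alpha>) has_vector_derivative v) (at t)" and w: "(\<beta> has_vector_derivative w) (at t)"
  shows "B (\<beta> t) w = mc d (snd d (\<alpha> t)) (vel (\<beta> t) 1 d) v"
proof -
  have t1: "t \<in> {0..1}" using t by simp
  interpret C11_form "snd d ` fst d" "mc d" by (rule mc_form[OF d(1)])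
  let ?x = "snd d (\<alpha> t)" and ?P = "vel (\<beta> t) 1 d"
  have xS: "?x \<in> snd d ` fst d" using d by simp
  obtain L where L: "L-lipschitz_on {0..1} \<beta>" by (rule \<beta>_lipschitz)
  have L0: "0 \<le> L" by (rule lipschitz_on_nonneg[OF L])
  define \<psi> where "\<psi> s = Q (\<beta> s) / 2 - mc d ?x ?P (snd d (\<alpha> s))" for s
  have bl: "bounded_linear (mc d ?x ?P)" using lin2[OF xS] by (simp add: linear_conv_bounded_linear)
  have "((\<lambda>s. Q (\<beta> s) / 2) has_vector_derivative B (\<beta> t) w) (at t)"
    using DERIV_cdivide[OF Q_has_derivative[OF w], of 2] by (simp add: has_real_derivative_iff_has_vector_derivative)
  moreover have "((\<lambda>s. mc d ?x ?P (snd d (\<alpha> s))) has_vector_derivative mc d ?x ?P v) (at t)"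
    using bounded_linear.has_vector_derivative[OF bl v] by (simp add: comp_def)
  ultimately have D: "(\<psi> has_vector_derivative B (\<beta> t) w - mc d ?x ?P v) (at t)"
    unfolding \<psi>_def by (rule has_vector_derivative_diff)
  have "B (\<beta> t) w - mc d ?x ?P v = 0"
  proof (rule derivative_zero_of_small_difference[OF D])
    fix e :: real assume e: "e > 0"
    define e1 where "e1 = e / (L + 1)"
    have e1: "e1 > 0" "e1 * L \<le> e"
      using e L0 by (auto simp: e1_def field_simps)
    have Ed: "E (\<beta> t) \<in> fst d" using \<beta>(2)[OF t1] d by simp
    obtain \<epsilon> where \<epsilon>: "\<epsilon> > 0" "\<And>u'. u' \<in> W \<Longrightarrow> norm (u' - \<beta> t) < \<epsilon> \<Longrightarrow> E u' \<in> fst d \<and>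
      \<bar>(Q u' - Q (\<beta> t)) / 2 - mc d (snd d (E (\<beta> t))) ?P (snd d (E u') - snd d (E (\<beta> t)))\<bar> \<le> e1 * norm (u' - \<beta> t)"
      using gauss_lemma[OF \<beta>(1)[OF t1] d(1) Ed e1(1)] by blast
    define \<delta> where "\<delta> = min (min t (1 - t)) (\<epsilon> / (L + 1))"
    have \<delta>: "\<delta> > 0" "\<delta> \<le> t" "\<delta> \<le> 1 - t" "\<delta> \<le> \<epsilon> / (L + 1)" using t \<epsilon>(1) L0 by (auto simp: \<delta>_def)
    show "\<exists>\<delta>>0. \<forall>s. \<bar>s - t\<bar> < \<delta> \<longrightarrow> norm (\<psi> s - \<psi> t) \<le> e * \<bar>s - t\<bar>"
    proof (intro exI[of _ \<delta>] conjI allI impI \<delta>(1))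
      fix s assume s: "\<bar>s - t\<bar> < \<delta>"
      have s1: "s \<in> {0..1}" using s \<delta> by auto
      have n: "norm (\<beta> s - \<beta> t) \<le> L * \<bar>s - t\<bar>" using lipschitz_on_normD[OF L s1 t1] by simp
      also have "\<dots> \<le> (L + 1) * \<bar>s - t\<bar>" using L0 by (intro mult_right_mono) auto
      also have "\<dots> < (L + 1) * (\<epsilon> / (L + 1))"
        using s \<delta>(4) L0 by (intro mult_strict_left_mono) auto
      also have "\<dots> = \<epsilon>" using L0 by simp
      finally have "norm (\<beta> s - \<beta> t) < \<epsilon>" .
      from \<epsilon>(2)[OF \<beta>(1)[OF s1] this, unfolded \<beta>(2)[OF s1] \<beta>(2)[OF t1]]
      have "\<bar>(Q (\<beta> s) - Q (\<beta> t)) / 2 - mc d ?x ?P (snd d (\<alpha> s) - ?x)\<bar> \<le> e1 * norm (\<beta> s - \<beta> t)"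
        by (rule conjunct2)
      moreover have "\<psi> s - \<psi> t = (Q (\<beta> s) - Q (\<beta> t)) / 2 - mc d ?x ?P (snd d (\<alpha> s) - ?x)"
        by (simp add: \<psi>_def G_simps[OF xS] diff_divide_distrib)
      ultimately have "norm (\<psi> s - \<psi> t) \<le> e1 * norm (\<beta> s - \<beta> t)" by simp
      also have "\<dots> \<le> e1 * (L * \<bar>s - t\<bar>)" using n e1(1) by (intro mult_left_mono) auto
      also have "\<dots> = (e1 * L) * \<bar>s - t\<bar>" by simp
      also have "\<dots> \<le> e * \<bar>s - t\<bar>" using e1(2) by (intro mult_right_mono) auto
      finally show "norm (\<psi> s - \<psi> t) \<le> e * \<bar>s - t\<bar>" .
    qed
  qed
  then show ?thesis by simp
qed

text \<open>Both claims are the reverse Cauchy-Schwarz inequality for the radial vector and the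
  velocity of \<alpha>, transported by the Gauss lemma. In the case of equality the velocity is
  \<open>l\<close> times the radial vector in the manifold; the work lies in bringing this relation
  back to the tangent space.\<close>

lemma radial_product:
  assumes t: "t \<in> {0<..<1} - N" and w: "(\<beta> has_vector_derivative w) (at t)"
  shows "B (\<beta> t) w \<le> 0" "B (\<beta> t) w = 0 \<Longrightarrow> \<beta> t \<noteq> 0 \<Longrightarrow> \<exists>l>0. w = l *\<^sub>R \<beta> t"
proof -
  have t1: "t \<in> {0..1}" and t': "t \<in> {0<..<1}" using t by auto
  obtain v where v: "v \<in> tangent_space A (\<alpha> t)" "v \<noteq> (\<lambda>_. 0)" "g (\<alpha> t) v v \<le> 0" "g (\<alpha> t) (X (\<alpha> t)) v < 0"
    "\<And>d. d \<in> A \<Longrightarrow> \<alpha> t \<in> fst d \<Longrightarrow> ((snd d \<circ> \<alpha>) has_vector_derivative v d) (at t)"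
    using regular_point[OF t] by metis
  obtain d where d: "d \<in> A" "\<alpha> t \<in> fst d" by (rule chart_at)
  let ?x = "snd d (\<alpha> t)" and ?P = "vel (\<beta> t) 1"
  have xS: "?x \<in> snd d ` fst d" using d by simp
  interpret L: lorentz "mc d ?x" by (rule mc_lorentz[OF d(1) xS])
  have eq: "B (\<beta> t) w = mc d ?x (?P d) (v d)"
    by (rule gauss_along_curve[OF t' d v(5)[OF d] w])
  note gt = g_tangent[OF d]
  have Xx: "mc d ?x (X (\<alpha> t) d) (X (\<alpha> t) d) < 0"
    using X_timelike(2)[of "\<alpha> t"] gt[OF X_timelike(1) X_timelike(1)] by simp
  have vv: "mc d ?x (v d) (v d) \<le> 0" "mc d ?x (X (\<alpha> t) d) (v d) < 0"
    using v gt[OF v(1) v(1)] gt[OF X_timelike(1) v(1)] by simp_all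
  have G1: "Gam (\<beta> t) 1 = \<alpha> t" using E_Gam[OF \<beta>(1)[OF t1]] \<beta>(2)[OF t1] by simp
  have PP: "mc d ?x (?P d) (?P d) \<le> 0"
    using Gam_energy_chart[OF \<beta>(1)[OF t1], of 1 d] G1 d \<beta>_causal(1)[OF t1] by simp
  have XP: "mc d ?x (X (\<alpha> t) d) (?P d) < 0" if "\<beta> t \<noteq> 0"
  proof -
    have "g (Gam (\<beta> t) 1) (X (Gam (\<beta> t) 1)) (?P) < 0"
      by (rule vel_future[OF \<beta>(1)[OF t1] \<beta>_causal(1)[OF t1] \<beta>_nonzero_future[OF t1 that]]) simp
    then show ?thesis using gt[OF X_timelike(1) vel_1_tangent[OF t1]] G1 by simp
  qed
  show "B (\<beta> t) w \<le> 0"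
  proof (cases "\<beta> t = 0")
    case True
    then show ?thesis using lorentz.h_0(1)[OF B_lorentz] by simp
  next
    case False
    show ?thesis unfolding eq by (rule L.reverse_Cauchy_Schwarz(1)[OF Xx PP XP[OF False] vv])
  qed
  assume B0: "B (\<beta> t) w = 0" and nz: "\<beta> t \<noteq> 0"
  obtain l where l: "l > 0" "v d = l *\<^sub>R ?P d"
    using L.reverse_Cauchy_Schwarz(2)[OF Xx PP XP[OF nz] vv] B0 eq by auto
  have Ed: "E (\<beta> t) \<in> fst d" using \<beta>(2)[OF t1] d by simp
  \<comment> \<open>The comparison curve
    \<open>s \<mapsto> E ((1 + l * (s - t)) *\<^sub>R \<beta> t)\<close> meets \<alpha> at time
    \<open>t\<close> with the same velocity.\<close>
  have "((\<lambda>s. l * (s - t)) has_vector_derivative l) (at t)"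
    by (auto simp flip: has_real_derivative_iff_has_vector_derivative intro!: derivative_eq_intros)
  moreover have "((\<lambda>h. snd d (E ((1 + h) *\<^sub>R \<beta> t))) has_vector_derivative ?P d) (at ((\<lambda>s. l * (s - t)) t))"
    using radial_derivative[OF \<beta>(1)[OF t1] d(1) Ed] by simp
  ultimately have "(((\<lambda>h. snd d (E ((1 + h) *\<^sub>R \<beta> t))) \<circ> (\<lambda>s. l * (s - t))) has_vector_derivative l *\<^sub>R ?P d) (at t)"
    by (rule vector_diff_chain_at)
  then have "((\<lambda>s. snd d (E ((1 + l * (s - t)) *\<^sub>R \<beta> t))) has_vector_derivative v d) (at t)"
    by (simp add: comp_def l(2))
  from has_vector_derivative_diff[OF v(5)[OF d] this]
  have D0: "((\<lambda>s. snd d (\<alpha> s) - snd d (E ((1 + l * (s - t)) *\<^sub>R \<beta> t))) has_vector_derivative 0) (at t)"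
    by (simp add: comp_def)
  \<comment> \<open>The difference of the two curves in the tangent space. By the Lipschitz bound
    for \<open>Lg\<close> it is of smaller order than the elapsed time, like the difference of the
    curves themselves, so its derivative \<open>w - l *\<^sub>R \<beta> t\<close> vanishes.\<close>
  define \<zeta> where "\<zeta> s = \<beta> s - (1 + l * (s - t)) *\<^sub>R \<beta> t" for s
  have "((\<lambda>s. (1 + l * (s - t))) has_real_derivative l) (at t)"
    by (auto intro!: derivative_eq_intros)
  from has_vector_derivative_scaleR[OF this has_vector_derivative_const[of "\<beta> t"]]
  have "((\<lambda>s. (1 + l * (s - t)) *\<^sub>R \<beta> t) has_vector_derivative l *\<^sub>R \<beta> t) (at t)" by simp
  then have D\<zeta>: "(\<zeta> has_vector_derivative w - l *\<^sub>R \<beta> t) (at t)"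
    unfolding \<zeta>_def by (rule has_vector_derivative_diff[OF w])
  obtain \<rho> K where K: "0 < \<rho>" "0 \<le> K"
    "\<And>q1 q2. q1 \<in> U \<inter> fst d \<Longrightarrow> q2 \<in> U \<inter> fst d \<Longrightarrow> norm (snd d q1 - snd d (\<alpha> t)) < \<rho> \<Longrightarrow> norm (snd d q2 - snd d (\<alpha> t)) < \<rho> \<Longrightarrow>
      norm (Lg q1 - Lg q2) \<le> K * norm (snd d q1 - snd d q2)"
    using Lg_lipschitz_near[OF \<alpha>_U[OF t1] d] by blast
  obtain r M where r: "0 < r" "0 \<le> M" "\<And>s. s \<in> {0..1} \<inter> ball t r \<Longrightarrow> \<alpha> s \<in> fst d"
    and M: "M-lipschitz_on ({0..1} \<inter> ball t r) (snd d \<circ> \<alpha>)"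
    using \<alpha>_chart_lipschitz[OF t1 d] by blast
  obtain \<rho>2 M2 where M2: "0 < \<rho>2" "0 \<le> M2" "ball (\<beta> t) \<rho>2 \<subseteq> W" "\<And>v. v \<in> ball (\<beta> t) \<rho>2 \<Longrightarrow> E v \<in> fst d"
    "\<And>v v'. v \<in> ball (\<beta> t) \<rho>2 \<Longrightarrow> v' \<in> ball (\<beta> t) \<rho>2 \<Longrightarrow> norm (snd d (E v) - snd d (E v')) \<le> M2 * norm (v - v')"
    using E_lipschitz_near[OF \<beta>(1)[OF t1] d(1) Ed] by blast
  \<comment> \<open>Dominates three speeds: of \<alpha> in the chart, of the comparison ray in the
    tangent space, and of its image in the chart. Within \<open>\<delta>0\<close> all three stay
    where the Lipschitz bounds hold.\<close>
  define k where "k = M + (M2 + 1) * (l * norm (\<beta> t)) + 1"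
  have k: "k > 0" "M < k" "l * norm (\<beta> t) < k" "M2 * (l * norm (\<beta> t)) < k"
  proof -
    have "0 \<le> l * norm (\<beta> t)" "0 \<le> M2 * (l * norm (\<beta> t))" using l M2(2) by auto
    then show "k > 0" "M < k" "l * norm (\<beta> t) < k" "M2 * (l * norm (\<beta> t)) < k"
      using r(2) unfolding k_def distrib_right by linarith+
  qed
  define \<delta>0 where "\<delta>0 = min (min t (1 - t)) (min r (min (\<rho> / k) (\<rho>2 / k)))"
  have \<delta>0: "\<delta>0 > 0" "\<delta>0 \<le> t" "\<delta>0 \<le> 1 - t" "\<delta>0 \<le> r" "\<delta>0 \<le> \<rho> / k" "\<delta>0 \<le> \<rho>2 / k"
    using t' r(1) K(1) M2(1) k(1) by (auto simp: \<delta>0_def)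
  have \<zeta>K: "norm (\<zeta> s) \<le> K * norm (snd d (\<alpha> s) - snd d (E ((1 + l * (s - t)) *\<^sub>R \<beta> t)))" if s: "\<bar>s - t\<bar> < \<delta>0" for s
  proof -
    let ?u = "(1 + l * (s - t)) *\<^sub>R \<beta> t"
    have s1: "s \<in> {0..1}" using s \<delta>0 by auto
    have sr: "s \<in> {0..1} \<inter> ball t r" "t \<in> {0..1} \<inter> ball t r"
      using s s1 t1 \<delta>0(4) r(1) by (auto simp: dist_real_def)
    have ks: "k * \<bar>s - t\<bar> < \<rho>" "k * \<bar>s - t\<bar> < \<rho>2"
      using mult_strict_left_mono[of "\<bar>s - t\<bar>" "\<rho> / k" k] mult_strict_left_mono[of "\<bar>s - t\<bar>" "\<rho>2 / k" k] s \<delta>0(5,6) k(1)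
      by simp_all
    have un: "norm (?u - \<beta> t) = l * norm (\<beta> t) * \<bar>s - t\<bar>"
      using l(1) by (simp add: scaleR_add_left abs_mult)
    also have "\<dots> \<le> k * \<bar>s - t\<bar>" using k(3) by (intro mult_right_mono) auto
    also have "\<dots> < \<rho>2" by (rule ks(2))
    finally have ub: "?u \<in> ball (\<beta> t) \<rho>2" by (simp add: dist_norm norm_minus_commute)
    then have uW: "?u \<in> W" and uE: "E ?u \<in> fst d" using M2(3,4) by blast+
    have 1: "norm (snd d (\<alpha> s) - snd d (\<alpha> t)) < \<rho>"
    proof -
      have "norm (snd d (\<alpha> s) - snd d (\<alpha> t)) \<le> M * \<bar>s - t\<bar>"
        using lipschitz_on_normD[OF M sr] by simp
      also have "\<dots> \<le> k * \<bar>s - t\<bar>" using k(2) by (intro mult_right_mono) auto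
      finally show ?thesis using ks(1) by simp
    qed
    have 2: "norm (snd d (E ?u) - snd d (\<alpha> t)) < \<rho>"
    proof -
      have "norm (snd d (E ?u) - snd d (E (\<beta> t))) \<le> M2 * norm (?u - \<beta> t)"
        by (rule M2(5)[OF ub]) (use M2(1) in simp)
      also have "\<dots> = M2 * (l * norm (\<beta> t)) * \<bar>s - t\<bar>" unfolding un by simp
      also have "\<dots> \<le> k * \<bar>s - t\<bar>" using k(4) by (intro mult_right_mono) auto
      finally show ?thesis using ks(1) \<beta>(2)[OF t1] by simp
    qed
    have "norm (Lg (\<alpha> s) - Lg (E ?u)) \<le> K * norm (snd d (\<alpha> s) - snd d (E ?u))"
      by (rule K(3)) (use \<alpha>_U[OF s1] r(3)[OF sr(1)] E_in_U[OF uW] uE 1 2 in auto)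
    then show ?thesis by (simp add: \<zeta>_def \<beta>_def[of s] Lg_E[OF uW])
  qed
  have "w - l *\<^sub>R \<beta> t = 0"
  proof (rule derivative_zero_of_small_difference[OF D\<zeta>])
    fix e :: real assume e: "e > 0"
    define e1 where "e1 = e / (K + 1)"
    have e1: "e1 > 0" "K * e1 \<le> e" using e K(2) by (auto simp: e1_def field_simps)
    obtain \<delta> where \<delta>: "\<delta> > 0" "\<And>s. \<bar>s - t\<bar> < \<delta> \<Longrightarrow>
        norm ((snd d (\<alpha> s) - snd d (E ((1 + l * (s - t)) *\<^sub>R \<beta> t))) - (snd d (\<alpha> t) - snd d (E ((1 + l * (t - t)) *\<^sub>R \<beta> t)))) \<le> e1 * \<bar>s - t\<bar>"
      using has_vector_derivative_at_difference[OF D0 e1(1)] by blast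
    show "\<exists>\<delta>>0. \<forall>s. \<bar>s - t\<bar> < \<delta> \<longrightarrow> norm (\<zeta> s - \<zeta> t) \<le> e * \<bar>s - t\<bar>"
    proof (intro exI[of _ "min \<delta> \<delta>0"] conjI allI impI)
      show "min \<delta> \<delta>0 > 0" using \<delta>(1) \<delta>0(1) by simp
      fix s assume s: "\<bar>s - t\<bar> < min \<delta> \<delta>0"
      have "norm (\<zeta> s) \<le> K * norm (snd d (\<alpha> s) - snd d (E ((1 + l * (s - t)) *\<^sub>R \<beta> t)))"
        using \<zeta>K s by simp
      also have "\<dots> \<le> K * (e1 * \<bar>s - t\<bar>)"
        using \<delta>(2)[of s] s K(2) \<beta>(2)[OF t1] by (intro mult_left_mono) auto
      also have "\<dots> = K * e1 * \<bar>s - t\<bar>" by simp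
      also have "\<dots> \<le> e * \<bar>s - t\<bar>" using e1(2) by (intro mult_right_mono) auto
      finally show "norm (\<zeta> s - \<zeta> t) \<le> e * \<bar>s - t\<bar>" by (simp add: \<zeta>_def[of t])
    qed
  qed
  then show "\<exists>l>0. w = l *\<^sub>R \<beta> t" using l(1) by auto
qed

section \<open>The pulled-back curve runs along a null ray\<close>

lemma Q\<beta>_lipschitz: obtains L where "L-lipschitz_on {0..1} (\<lambda>t. Q (\<beta> t))"
proof -
  obtain L where L: "L-lipschitz_on {0..1} \<beta>" by (rule \<beta>_lipschitz)
  have L0: "0 \<le> L" by (rule lipschitz_on_nonneg[OF L])
  obtain K where K: "0 \<le> K" "\<And>u v. \<bar>Q u - Q v\<bar> \<le> K * (norm u + norm v) * norm (u - v)"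
    using Q_lipschitz by blast
  have n: "norm (\<beta> t) \<le> L" if "t \<in> {0..1}" for t
  proof -
    have "norm (\<beta> t - \<beta> 0) \<le> L * norm (t - 0)" by (rule lipschitz_on_normD[OF L that]) simp
    also have "\<dots> \<le> L * 1" using that L0 by (intro mult_left_mono) auto
    finally show ?thesis by (simp add: \<beta>_0)
  qed
  have "(K * (L + L) * L)-lipschitz_on {0..1} (\<lambda>t. Q (\<beta> t))"
  proof (rule lipschitz_onI)
    fix s t :: real assume s: "s \<in> {0..1}" and t: "t \<in> {0..1}"
    have "\<bar>Q (\<beta> s) - Q (\<beta> t)\<bar> \<le> K * (norm (\<beta> s) + norm (\<beta> t)) * norm (\<beta> s - \<beta> t)" by (rule K(2))
    also have "\<dots> \<le> K * (L + L) * (L * norm (s - t))"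
      using n[OF s] n[OF t] K(1) L0 lipschitz_on_normD[OF L s t] by (intro mult_mono mult_nonneg_nonneg add_mono) auto
    finally show "dist (Q (\<beta> s)) (Q (\<beta> t)) \<le> K * (L + L) * L * dist s t"
      by (simp add: dist_real_def mult.assoc)
  qed (use K L0 in simp)
  then show ?thesis by (rule that)
qed

text \<open>\<open>Q \<circ> \<beta>\<close> is nonincreasing, so its value is at least the final
  one, which is 0; it is at most 0 since \<beta> stays in the causal cone.\<close>

lemma Q\<beta>_zero:
  assumes t: "t \<in> {0..1}"
  shows "Q (\<beta> t) = 0"
proof -
  obtain L where L: "L-lipschitz_on {0..1} (\<lambda>t. Q (\<beta> t))" by (rule Q\<beta>_lipschitz)
  have "(\<lambda>t. - Q (\<beta> t)) t \<le> (\<lambda>t. - Q (\<beta> t)) 1"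
  proof (rule lipschitz_derivative_nonneg_imp_le[where f = "\<lambda>t. - Q (\<beta> t)", OF _ _ N_negligible])
    show "L-lipschitz_on {t..1} (\<lambda>t. - Q (\<beta> t))"
      using lipschitz_on_subset[OF L, of "{t..1}"] t by simp
    fix s assume "s \<in> {t<..<1} - N"
    then have s: "s \<in> {0<..<1} - N" using t by auto
    obtain w where w: "(\<beta> has_vector_derivative w) (at s)" using regular_point[OF s] by metis
    from DERIV_minus[OF Q_has_derivative[OF w]] radial_product(1)[OF s w]
    show "\<exists>D\<ge>0. ((\<lambda>t. - Q (\<beta> t)) has_real_derivative D) (at s)"
      by (intro exI[of _ "- (2 * B (\<beta> s) w)"]) auto
  qed (use t in auto)
  then show ?thesis using \<beta>_causal(1)[OF t] end_null by (simp add: \<beta>_def)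
qed

text \<open>On a constant stretch the curve would be differentiable with velocity 0, but causal
  vectors are nonzero.\<close>

lemma \<alpha>_not_constant:
  assumes "a < b" "{a..b} \<subseteq> {0..1}"
  shows "\<exists>t\<in>{a..b}. \<alpha> t \<noteq> \<alpha> a"
proof (rule ccontr)
  assume "\<not> (\<exists>t\<in>{a..b}. \<alpha> t \<noteq> \<alpha> a)"
  then have c: "\<alpha> t = \<alpha> a" if "t \<in> {a..b}" for t using that by blast
  define m where "m = (a + b) / 2"
  have m: "m \<in> {a<..<b}" "m \<in> {a..b}" using assms(1) by (auto simp: m_def)
  have m1: "m \<in> {0..1}" using m assms(2) by blast
  obtain d where d: "d \<in> A" "\<alpha> m \<in> fst d" by (rule chart_at)
  have "((\<lambda>_. snd d (\<alpha> a)) has_vector_derivative 0) (at m)" by simp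
  then have "((snd d \<circ> \<alpha>) has_vector_derivative 0) (at m)"
  proof (rule has_vector_derivative_transform_within_open[of _ _ _ "{a<..<b}"])
    fix y assume "y \<in> {a<..<b}"
    then have "\<alpha> y = \<alpha> a" by (intro c) auto
    then show "snd d (\<alpha> a) = (snd d \<circ> \<alpha>) y" by (simp only: comp_apply)
  qed (use m in auto)
  then have D: "((snd d \<circ> \<alpha>) has_vector_derivative 0) (at m within {0..1})"
    by (rule has_vector_derivative_at_within)
  have "vl \<alpha> m = coord_vector A d (\<alpha> m) 0"
    by (rule velocity_eq_coord_vector[OF zero_less_one \<alpha>_cont m1 d D])
  then have "vl \<alpha> m = (\<lambda>_. 0)" by (simp add: coord_vector_0[OF d])
  moreover have "curve_differentiable A {0..1} \<alpha> m"
    unfolding curve_differentiable_def using d differentiableI_vector[OF D] by blast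
  ultimately show False using curve m1 unfolding future_causal_curve_def causal_def by metis
qed

text \<open>A linear time function on the tangent space: nonnegative on the causal cone and zero
  only at the origin. Dividing by it singles out the direction of a ray.\<close>

definition ht :: "real \<Rightarrow> real" where "ht t = - B x0 (\<beta> t)"

lemma B_x0_linear: "bounded_linear (B x0)"
  using lorentz.h_lin2[OF B_lorentz] by (simp add: linear_conv_bounded_linear)

lemma ht_lipschitz: obtains L where "L-lipschitz_on {0..1} ht"
proof -
  obtain L where L: "L-lipschitz_on {0..1} \<beta>" by (rule \<beta>_lipschitz)
  obtain K where K: "K-lipschitz_on (\<beta> ` {0..1}) (B x0)"
    by (rule bounded_linear.lipschitz_boundE[OF B_x0_linear])
  have "(K * L)-lipschitz_on {0..1} (\<lambda>t. - B x0 (\<beta> t))"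
    using lipschitz_on_compose2[OF L K] by simp
  then show ?thesis using that unfolding ht_def[abs_def] by blast
qed

lemma ht_nonneg: "t \<in> {0..1} \<Longrightarrow> 0 \<le> ht t"
  using \<beta>_causal(2) by (simp add: ht_def)

lemma ht_zero: "t \<in> {0..1} \<Longrightarrow> ht t = 0 \<Longrightarrow> \<beta> t = 0"
  using B_orthogonal_imp_zero[of "\<beta> t"] \<beta>_causal(1)[of t] by (simp add: ht_def)

lemma ht_derivative:
  assumes w: "(\<beta> has_vector_derivative w) (at t)"
  shows "(ht has_real_derivative - B x0 w) (at t)"
  using bounded_linear.has_vector_derivative[OF B_x0_linear w, THEN has_vector_derivative_minus]
  unfolding has_real_derivative_iff_has_vector_derivative ht_def[abs_def] .

lemma \<beta>_derivative_radial:
  assumes t: "t \<in> {0<..<1} - N" and nz: "\<beta> t \<noteq> 0"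
  obtains l where "l > 0" "(\<beta> has_vector_derivative l *\<^sub>R \<beta> t) (at t)"
proof -
  obtain w where w: "(\<beta> has_vector_derivative w) (at t)" using regular_point[OF t] by metis
  have "((\<lambda>s. 0) has_real_derivative 0) (at t)" by simp
  then have "((\<lambda>s. Q (\<beta> s)) has_real_derivative 0) (at t)"
    by (rule has_field_derivative_transform_within_open[of _ _ _ "{0<..<1}"]) (use t Q\<beta>_zero in auto)
  then have "B (\<beta> t) w = 0" using DERIV_unique[OF Q_has_derivative[OF w]] by fastforce
  from radial_product(2)[OF t w this nz] w show ?thesis using that by blast
qed

lemma ht_mono:
  assumes "s \<le> t" "s \<in> {0..1}" "t \<in> {0..1}"
  shows "ht s \<le> ht t"
proof -
  obtain L where L: "L-lipschitz_on {0..1} ht" by (rule ht_lipschitz)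
  show ?thesis
  proof (rule lipschitz_derivative_nonneg_imp_le[OF assms(1) _ N_negligible])
    show "L-lipschitz_on {s..t} ht" by (rule lipschitz_on_subset[OF L]) (use assms in auto)
    fix r assume "r \<in> {s<..<t} - N"
    then have r: "r \<in> {0<..<1} - N" using assms by auto
    then have r1: "r \<in> {0..1}" by simp
    show "\<exists>D\<ge>0. (ht has_real_derivative D) (at r)"
    proof (cases "\<beta> r = 0")
      case True
      obtain w where w: "(\<beta> has_vector_derivative w) (at r)" using regular_point[OF r] by metis
      \<comment> \<open>At the origin no radial factor is available; there \<open>ht\<close> has an
        interior minimum, so its derivative is 0.\<close>
      have "ht r = 0" using True lorentz.h_0(2)[OF B_lorentz] by (simp add: ht_def)
      have "\<forall>y. \<bar>r - y\<bar> < min r (1 - r) \<longrightarrow> ht r \<le> ht y"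
      proof (intro allI impI)
        fix y assume "\<bar>r - y\<bar> < min r (1 - r)"
        then have "y \<in> {0..1}" by auto
        then show "ht r \<le> ht y" using ht_nonneg \<open>ht r = 0\<close> by simp
      qed
      moreover have "0 < min r (1 - r)" using r by simp
      ultimately have "- B x0 w = 0" using DERIV_local_min[OF ht_derivative[OF w]] by blast
      then show ?thesis using ht_derivative[OF w] by (intro exI[of _ 0]) simp
    next
      case False
      obtain l where l: "l > 0" "(\<beta> has_vector_derivative l *\<^sub>R \<beta> r) (at r)" by (rule \<beta>_derivative_radial[OF r False])
      have "- B x0 (l *\<^sub>R \<beta> r) = l * ht r" using lorentz.h_scale(2)[OF B_lorentz] by (simp add: ht_def)
      then show ?thesis using ht_derivative[OF l(2)] l(1) ht_nonneg[OF r1] by (intro exI[of _ "l * ht r"]) auto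
    qed
  qed
qed

text \<open>Otherwise monotonicity would keep \<open>ht\<close> at 0, so \<beta> would stay at the
  origin and \<alpha> would be constant.\<close>

lemma ht_1_pos: "0 < ht 1"
proof (rule ccontr)
  assume "\<not> 0 < ht 1"
  have const: "\<alpha> t = \<alpha> 0" if t: "t \<in> {0..1}" for t
  proof -
    have "ht t = 0" using ht_mono[of t 1] ht_nonneg[OF t] t \<open>\<not> 0 < ht 1\<close> by simp
    then have "\<beta> t = \<beta> 0" using ht_zero[OF t] \<beta>_0 by simp
    then show ?thesis using \<beta>(2)[OF t] \<beta>(2)[of 0] by simp
  qed
  obtain t where "t \<in> {0..1}" "\<alpha> t \<noteq> \<alpha> 0" using \<alpha>_not_constant[of 0 1] by auto
  then show False using const by blast
qed

definition r :: "real \<Rightarrow> real" where "r t = ht t / ht 1"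

text \<open>The derivatives of \<beta> and of \<open>ht\<close> are both \<open>l\<close> times the
  function, with the same \<open>l\<close>, so the quotient has derivative 0 almost everywhere. On
  \<open>{t..1}\<close> it is Lipschitz because \<open>ht\<close> is at least \<open>ht t\<close>
  there, hence it is constant.\<close>

lemma \<beta>_radial:
  assumes t: "t \<in> {0..1}"
  shows "\<beta> t = r t *\<^sub>R \<beta> 1"
proof (cases "ht t = 0")
  case True
  then show ?thesis using ht_zero[OF t] by (simp add: r_def)
next
  case False
  then have pos: "0 < ht t" using ht_nonneg[OF t] by simp
  obtain L where L: "L-lipschitz_on {0..1} \<beta>" by (rule \<beta>_lipschitz)
  have L0: "0 \<le> L" by (rule lipschitz_on_nonneg[OF L])
  obtain M where M: "M-lipschitz_on {0..1} ht" by (rule ht_lipschitz)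
  have sub: "{t..1} \<subseteq> {0..1}" using t by auto
  have "(\<beta> t \<bullet> i) / ht t = (\<beta> 1 \<bullet> i) / ht 1" if i: "i \<in> Basis" for i
  proof (rule lipschitz_derivative_zero_imp_eq[OF _ _ N_negligible, of t 1 _ "\<lambda>s. (\<beta> s \<bullet> i) / ht s"])
    have fi: "L-lipschitz_on {0..1} (\<lambda>s. \<beta> s \<bullet> i)"
    proof (rule lipschitz_onI[OF _ L0])
      fix s s' :: real assume s: "s \<in> {0..1}" "s' \<in> {0..1}"
      have "\<bar>(\<beta> s - \<beta> s') \<bullet> i\<bar> \<le> norm (\<beta> s - \<beta> s')" by (rule Basis_le_norm[OF i])
      also have "\<dots> \<le> L * dist s s'" using lipschitz_onD[OF L s] by (simp add: dist_norm)
      finally show "dist (\<beta> s \<bullet> i) (\<beta> s' \<bullet> i) \<le> L * dist s s'" by (simp add: dist_real_def inner_diff_left)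
    qed
    have bnd: "\<bar>\<beta> s \<bullet> i\<bar> \<le> L" if "s \<in> {t..1}" for s
    proof -
      have s: "s \<in> {0..1}" using that sub by blast
      have "dist (\<beta> s \<bullet> i) (\<beta> 0 \<bullet> i) \<le> L * dist s 0" by (rule lipschitz_onD[OF fi s]) simp
      also have "\<dots> \<le> L * 1" using s L0 by (intro mult_left_mono) auto
      finally show ?thesis by (simp add: \<beta>_0)
    qed
    have low: "ht t \<le> ht s" if "s \<in> {t..1}" for s using ht_mono[of t s] that t by auto
    show "(L / ht t + L * M / (ht t)\<^sup>2)-lipschitz_on {t..1} (\<lambda>s. (\<beta> s \<bullet> i) / ht s)"
      by (rule lipschitz_divide[OF lipschitz_on_subset[OF fi sub] lipschitz_on_subset[OF M sub] pos low bnd L0])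
    fix s assume s': "s \<in> {t<..<1} - N"
    then have s: "s \<in> {0<..<1} - N" using t by auto
    have ls: "0 < ht s" using low[of s] s' pos by simp
    then have nz: "\<beta> s \<noteq> 0" using lorentz.h_0(2)[OF B_lorentz] by (auto simp: ht_def)
    obtain l where l: "l > 0" "(\<beta> has_vector_derivative l *\<^sub>R \<beta> s) (at s)" by (rule \<beta>_derivative_radial[OF s nz])
    have "((\<lambda>s. \<beta> s \<bullet> i) has_real_derivative (l *\<^sub>R \<beta> s) \<bullet> i) (at s)"
      using bounded_linear.has_vector_derivative[OF bounded_linear_inner_left l(2)]
      by (simp add: has_real_derivative_iff_has_vector_derivative)
    moreover have "(ht has_real_derivative l * ht s) (at s)"
      using ht_derivative[OF l(2)] lorentz.h_scale(2)[OF B_lorentz] by (simp add: ht_def)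
    ultimately have "((\<lambda>s. (\<beta> s \<bullet> i) / ht s) has_real_derivative
        ((l *\<^sub>R \<beta> s) \<bullet> i * ht s - (\<beta> s \<bullet> i) * (l * ht s)) / (ht s * ht s)) (at s)"
      by (rule DERIV_divide) (use ls in simp)
    then show "((\<lambda>s. (\<beta> s \<bullet> i) / ht s) has_real_derivative 0) (at s)" by simp
  qed (use t in auto)
  then have "\<beta> t \<bullet> i = (r t *\<^sub>R \<beta> 1) \<bullet> i" if "i \<in> Basis" for i
    using that pos ht_1_pos by (simp add: r_def field_simps)
  then show ?thesis by (rule euclidean_eqI)
qed

lemma r_0: "r 0 = 0"
  using \<beta>_0 lorentz.h_0(2)[OF B_lorentz] by (simp add: r_def ht_def)

lemma r_1: "r 1 = 1"
  using ht_1_pos by (simp add: r_def)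

lemma r_continuous: "continuous_on {0..1} r"
proof -
  obtain L where L: "L-lipschitz_on {0..1} ht" by (rule ht_lipschitz)
  show ?thesis
    unfolding r_def by (intro continuous_on_divide lipschitz_on_continuous_on[OF L] continuous_on_const) (use ht_1_pos in simp)
qed

lemma r_mono: "s \<le> t \<Longrightarrow> s \<in> {0..1} \<Longrightarrow> t \<in> {0..1} \<Longrightarrow> r s \<le> r t"
  unfolding r_def using ht_mono[of s t] ht_1_pos by (intro divide_right_mono) auto

text \<open>If \<open>r\<close> took the same value twice, \<beta> and with it \<alpha> would be
  constant in between.\<close>

lemma r_strict_mono:
  assumes "s < t" "s \<in> {0..1}" "t \<in> {0..1}"
  shows "r s < r t"
proof (rule ccontr)
  assume "\<not> r s < r t"
  have sub: "{s..t} \<subseteq> {0..1}" using assms by auto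
  have "\<alpha> \<tau> = \<alpha> s" if \<tau>: "\<tau> \<in> {s..t}" for \<tau>
  proof -
    have \<tau>1: "\<tau> \<in> {0..1}" using \<tau> sub by blast
    have "r s \<le> r \<tau>" "r \<tau> \<le> r t" using r_mono[of s \<tau>] r_mono[of \<tau> t] \<tau> \<tau>1 assms by auto
    then have "r \<tau> = r s" using \<open>\<not> r s < r t\<close> by simp
    then have "\<beta> \<tau> = \<beta> s" using \<beta>_radial[OF \<tau>1] \<beta>_radial[OF assms(2)] by simp
    then show ?thesis using \<beta>(2)[OF \<tau>1] \<beta>(2)[OF assms(2)] by simp
  qed
  then show False using \<alpha>_not_constant[OF assms(1) sub] by blast
qed

lemma r_image: "r ` {0..1} = {0..1}"
proof
  show "r ` {0..1} \<subseteq> {0..1}"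
  proof
    fix y assume "y \<in> r ` {0..1}"
    then obtain t where t: "t \<in> {0..1}" "y = r t" by blast
    then show "y \<in> {0..1}" using r_mono[of 0 t] r_mono[of t 1] r_0 r_1 by auto
  qed
  have "connected (r ` {0..1})" by (rule connected_continuous_image[OF r_continuous]) auto
  then show "{0..1} \<subseteq> r ` {0..1}"
    by (rule connected_contains_Icc) (use r_0 r_1 in \<open>auto intro!: image_eqI[of _ r]\<close>)
qed

theorem null_geodesic_reparametrisation:
  "\<exists>a b \<phi>. a < b \<and> reparametrisation {a..b} {0..1} \<phi> \<and> null_geodesic A g {a..b} (\<alpha> \<circ> \<phi>)"
proof -
  \<comment> \<open>The position on the ray becomes the parameter:
    \<open>\<alpha> \<circ> \<phi>\<close> is \<open>s \<mapsto> E (s *\<^sub>R \<beta> 1)\<close>,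
    the radial geodesic to \<open>\<alpha> 1\<close>. Its energy is \<open>Q (\<beta> 1)\<close>,
    that is 0, and its velocity never vanishes because \<open>\<beta> 1\<close> is nonzero.\<close>
  define \<phi> where "\<phi> = inv_into {0..1} r"
  have inj: "inj_on r {0..1}"
  proof (rule inj_onI)
    fix s t assume st: "s \<in> {0..1}" "t \<in> {0..1}" "r s = r t"
    show "s = t"
    proof (rule ccontr)
      assume "s \<noteq> t"
      then have "s < t \<or> t < s" by linarith
      then show False using r_strict_mono[OF _ st(1,2)] r_strict_mono[OF _ st(2,1)] st(3) by auto
    qed
  qed
  have \<phi>r: "\<phi> (r t) = t" if "t \<in> {0..1}" for t unfolding \<phi>_def by (rule inv_into_f_f[OF inj that])
  have r\<phi>: "r (\<phi> s) = s" and \<phi>1: "\<phi> s \<in> {0..1}" if "s \<in> {0..1}" for s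
  proof -
    have "s \<in> r ` {0..1}" using that by (simp add: r_image)
    then show "r (\<phi> s) = s" "\<phi> s \<in> {0..1}"
      unfolding \<phi>_def by (rule f_inv_into_f, rule inv_into_into)
  qed
  have rep: "reparametrisation {0..1} {0..1} \<phi>"
    unfolding reparametrisation_def
  proof (intro conjI)
    have "continuous_on (r ` {0..1}) \<phi>"
      by (rule continuous_on_inv[OF r_continuous compact_Icc]) (use \<phi>r in blast)
    then show "continuous_on {0..1} \<phi>" by (simp only: r_image)
    show "strict_mono_on {0..1} \<phi>"
    proof (rule strict_mono_onI)
      fix s t :: real assume st: "s \<in> {0..1}" "t \<in> {0..1}" "s < t"
      show "\<phi> s < \<phi> t"
      proof (rule ccontr)
        assume "\<not> \<phi> s < \<phi> t"
        then have "r (\<phi> t) \<le> r (\<phi> s)" using \<phi>1 st by (intro r_mono) auto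
        then show False using r\<phi> st by simp
      qed
    qed
    show "\<phi> ` {0..1} = {0..1}"
    proof
      show "\<phi> ` {0..1} \<subseteq> {0..1}" using \<phi>1 by blast
      show "{0..1} \<subseteq> \<phi> ` {0..1}"
      proof
        fix t :: real assume t: "t \<in> {0..1}"
        then have "r t \<in> {0..1}" using r_image by blast
        then show "t \<in> \<phi> ` {0..1}" using \<phi>r[OF t] by (metis image_eqI)
      qed
    qed
  qed
  have one: "(1::real) \<in> {0..1}" by simp
  have eq: "(\<alpha> \<circ> \<phi>) s = Gam (\<beta> 1) s" if s: "s \<in> {0..1}" for s
  proof -
    have "\<alpha> (\<phi> s) = E (s *\<^sub>R \<beta> 1)"
      using \<beta>(2)[OF \<phi>1[OF s]] \<beta>_radial[OF \<phi>1[OF s]] r\<phi>[OF s] by simp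
    then show ?thesis using E_scale[OF \<beta>(1)[OF one] s] by simp
  qed
  note geo = Gam_geodesic(1)[OF \<beta>(1)[OF one]]
  have nz: "\<beta> 1 \<noteq> 0" using ht_1_pos lorentz.h_0(2)[OF B_lorentz] by (auto simp: ht_def)
  have "null_geodesic A g {0..1} (\<alpha> \<circ> \<phi>)"
    unfolding null_geodesic_def
  proof (intro conjI ballI)
    show "geodesic A g {0..1} (\<alpha> \<circ> \<phi>)" by (rule geodesic_cong(1)[OF geo eq])
    fix t :: real assume t: "t \<in> {0..1}"
    have v: "vl (\<alpha> \<circ> \<phi>) t = vel (\<beta> 1) t"
      unfolding vel_def by (rule geodesic_cong(2)[OF geo eq t])
    show "null g ((\<alpha> \<circ> \<phi>) t) (vl (\<alpha> \<circ> \<phi>) t)"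
      unfolding null_def v eq[OF t]
      using vel_nonzero[OF \<beta>(1)[OF one] nz t] Gam_energy[OF \<beta>(1)[OF one] t] Q\<beta>_zero[OF one] by simp
  qed
  with rep show ?thesis by (intro exI[of _ 0] exI[of _ 1] exI[of _ \<phi>]) simp
qed

lemma curve_in_frontier:
  "\<alpha> ` {0..1} \<subseteq> exp_map A g p ` ((top_of_set (tangent_space A p) frontier_of timelike_cone A g X p) \<inter> V)"
proof
  fix q assume "q \<in> \<alpha> ` {0..1}"
  then obtain t where t: "t \<in> {0..1}" "q = \<alpha> t" by blast
  have "tv (\<beta> t) \<in> top_of_set (tangent_space A p) frontier_of timelike_cone A g X p"
    using frontier_timelike_cone Q\<beta>_zero[OF t(1)] \<beta>_causal(2)[OF t(1)] by simp
  moreover have "tv (\<beta> t) \<in> V" using \<beta>(1)[OF t(1)] by (simp add: W_def)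
  moreover have "exp_map A g p (tv (\<beta> t)) = q" using \<beta>(2)[OF t(1)] t(2) by (simp add: E_def)
  ultimately show "q \<in> exp_map A g p ` ((top_of_set (tangent_space A p) frontier_of timelike_cone A g X p) \<inter> V)"
    by blast
qed

end

theorem corollary3p11:
  fixes A :: "('a::{t2_space,second_countable_topology}, 'e::euclidean_space) chart set"
    and g :: "('a, 'e) metric" and X :: "'a \<Rightarrow> ('a, 'e) tangent"
    and p :: 'a and U :: "'a set" and V :: "('a, 'e) tangent set"
    and \<alpha> :: "real \<Rightarrow> 'a"
  assumes "C11_spacetime A g X"
    and "normal_neighbourhood A g p V U"
    and "chronological_future A g X p U = exp_map A g p ` (timelike_cone A g X p \<inter> V)"
    and "causal_future A g X p U = exp_map A g p ` (causal_cone A g X p \<inter> V)"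
    and "top_of_set U frontier_of chronological_future A g X p U =
         top_of_set U frontier_of causal_future A g X p U"
    and "top_of_set U frontier_of causal_future A g X p U =
         exp_map A g p ` ((top_of_set (tangent_space A p) frontier_of timelike_cone A g X p) \<inter> V)"
    and "future_causal_curve A g X {0..1} \<alpha>"
    and "\<alpha> ` {0..1} \<subseteq> U"
    and "\<alpha> 0 = p"
    and "\<alpha> 1 \<in> top_of_set U frontier_of causal_future A g X p U"
  shows "\<alpha> ` {0..1} \<subseteq> top_of_set U frontier_of causal_future A g X p U \<and>
         (\<exists>a b \<phi>. a < b \<and> reparametrisation {a..b} {0..1} \<phi> \<and> null_geodesic A g {a..b} (\<alpha> \<circ> \<phi>))"
proof -
  have "smooth_manifold A" using assms(1) by (simp add: C11_spacetime_def)
  then interpret manifold A by unfold_locales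
  obtain c0 where c0: "c0 \<in> A" "p \<in> fst c0" by (rule chart_at)
  interpret normal_nbhd A g X p V U c0
    by unfold_locales (use assms c0 in auto)
  \<comment> \<open>The boundary condition at the end enters here: the end point is the image of a
    vector \<open>v\<close> in \<open>V\<close> on the boundary of the cone. Injectivity of the
    exponential map on \<open>V\<close> identifies \<open>v\<close> with the logarithm of
    \<open>\<alpha> 1\<close>, whose \<open>Q\<close> is therefore 0.\<close>
  obtain v where v: "v \<in> top_of_set (tangent_space A p) frontier_of timelike_cone A g X p" "v \<in> V" "\<alpha> 1 = exp_map A g p v"
    using assms(6,10) by auto
  have tvv: "tv (v c0) = v" using v(2) V_tangent by (intro tangent_tv) blast
  have "Lg (\<alpha> 1) = v c0"
    using Lg_E[of "v c0"] v tvv by (simp add: E_def W_def)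
  then have "Q (Lg (\<alpha> 1)) = 0" using frontier_timelike_cone[of "v c0"] v(1) tvv by simp
  then interpret boundary_curve A g X p V U c0 \<alpha>
    by unfold_locales (use assms in auto)
  show ?thesis
    using curve_in_frontier null_geodesic_reparametrisation unfolding assms(6) by blast
qed

end
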